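(* Let $R$ be a commutative ring with identity. Then the following statements are equivalent: (1) $R$ is a WQ-ring; (2) every $R$-module is semi-regular $w$-flat; (3) for every finitely generated semi-regular ideal $I$ of $R$, $R/I$ is a $w$-flat $R$-module; (4) $I\subseteq (I^2)_w$ for every finitely generated semi-regular ideal $I$ of $R$; (5) every $w$-module over $R$ is a Lucas module; (6) $Q_0(R)=R$.
   Context: An ideal $I$ of $R$ is dense if $(0:_R I)=\{r\in R\mid Ir=0\}=0$, and semi-regular if it contains a finitely generated dense sub-ideal. $\mathcal{Q}$ denotes the set of all finitely generated semi-regular ideals of $R$. $T(A)$ denotes the total quotient ring of a ring $A$. The ring of finite fractions of $R$ is $Q_0(R)=\{\alpha\in T(R[x])\mid \text{there exists } I\in\mathcal{Q} \text{ such that } I\alpha\subseteq R\}$, and $R\subseteq T(R)\subseteq Q_0(R)$. A finitely generated ideal $J$ of $R$ is a GV-ideal if the natural homomorphism $R\to \mathrm{Hom}_R(J,R)$, $r\mapsto (x\mapsto rx)$, is an isomorphism; $\mathrm{GV}(R)$ is the set of all GV-ideals. $R$ is a WQ-ring if every finitely generated semi-regular ideal of $R$ is a GV-ideal. For an $R$-module $M$, $\mathrm{tor}_{\mathrm{GV}}(M)=\{x\in M\mid Jx=0 \text{ for some } J\in \mathrm{GV}(R)\}$; $M$ is GV-torsion if $\mathrm{tor}_{\mathrm{GV}}(M)=M$ and GV-torsion-free if $\mathrm{tor}_{\mathrm{GV}}(M)=0$. A GV-torsion-free module $M$ is a $w$-module if $\mathrm{Ext}^1_R(R/J,M)=0$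 for every $J\in\mathrm{GV}(R)$. The $w$-envelope of a GV-torsion-free module $M$ is $M_w=\{x\in E(M)\mid Jx\subseteq M \text{ for some } J\in\mathrm{GV}(R)\}$, where $E(M)$ is the injective envelope of $M$; $R$ itself is a $w$-module, and for an ideal $A$ of $R$ one has $A_w=\{r\in R\mid Jr\subseteq A\text{ for some }J\in\mathrm{GV}(R)\}$. A maximal $w$-ideal is an ideal of $R$ that is maximal among all proper $w$-submodules of $R$ (such ideals are prime); $w\text{-}\mathrm{Max}(R)$ is the set of them. A homomorphism $f:M\to N$ is a $w$-monomorphism if $f_{\mathfrak m}:M_{\mathfrak m}\to N_{\mathfrak m}$ is a monomorphism for every $\mathfrak m\in w\text{-}\mathrm{Max}(R)$. An $R$-module $M$ is $w$-flat if for every $w$-monomorphism $f:A\to B$ the map $f\otimes_R 1:A\otimes_R M\to B\otimes_R M$ is a $w$-monomorphism. An $R$-module $M$ is semi-regular $w$-flat if $\mathrm{Tor}_1^R(R/I,M)$ is GV-torsion for every $I\in\mathcal{Q}$. An $R$-module $M$ is $\mathcal{Q}$-torsion-free if $Im=0$ with $I\in\mathcal{Q}$, $m\in M$ implies $m=0$. For a $\mathcal{Q}$-torsion-free module $M$, its Lucas envelope is $M_q=\{x\in E(M)\mid \text{there exists } I\in\mathcal{Q} \text{ such that } Ix\subseteq M\}$. A $\mathcal{Q}$-torsion-free module $M$ is a Lucas module if $M_q=M$. *)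

theory Defs
  imports Complex_Main "HOL-Algebra.UnivPoly" "HOL-Algebra.QuotRing" "HOL-Algebra.Ideal_Product"
begin

text \<open>
  Modules are records of type \<open>('a, 'b) module\<close>, whose fields \<open>mult\<close> and \<open>one\<close> (inherited from
  rings) play no role and are left unspecified where a module is constructed.  A submodule \<open>N\<close> of
  \<open>M\<close> is regarded as a module by \<open>M\<lparr>carrier := N\<rparr>\<close>.
\<close>

section \<open>Modules\<close>

definition self_mod :: "('a, 'r) ring_scheme \<Rightarrow> ('a, 'a) module" where
  "self_mod R = \<lparr>carrier = carrier R, mult = mult R, one = one R, zero = zero R, add = add R,
     smult = mult R\<rparr>"

definition mod_hom ::
  "('a, 'r) ring_scheme \<Rightarrow> ('a, 'b, 'm) module_scheme \<Rightarrow> ('a, 'c, 'n) module_scheme \<Rightarrow> ('b \<Rightarrow> 'c) set"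
  where
  "mod_hom R M N = {f \<in> carrier M \<rightarrow> carrier N.
     (\<forall>x\<in>carrier M. \<forall>y\<in>carrier M. f (x \<oplus>\<^bsub>M\<^esub> y) = f x \<oplus>\<^bsub>N\<^esub> f y) \<and>
     (\<forall>r\<in>carrier R. \<forall>x\<in>carrier M. f (r \<odot>\<^bsub>M\<^esub> x) = r \<odot>\<^bsub>N\<^esub> f x)}"

definition mod_iso ::
  "('a, 'r) ring_scheme \<Rightarrow> ('a, 'b, 'm) module_scheme \<Rightarrow> ('a, 'c, 'n) module_scheme \<Rightarrow> ('b \<Rightarrow> 'c) set"
  where
  "mod_iso R M N = {f \<in> mod_hom R M N. bij_betw f (carrier M) (carrier N)}"

definition hom_mod ::
  "('a, 'r) ring_scheme \<Rightarrow> ('a, 'b, 'm) module_scheme \<Rightarrow> ('a, 'c, 'n) module_scheme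
    \<Rightarrow> ('a, 'b \<Rightarrow> 'c) module" where
  "hom_mod R M N = \<lparr>carrier = mod_hom R M N \<inter> extensional (carrier M),
     mult = undefined, one = undefined,
     zero = (\<lambda>x\<in>carrier M. \<zero>\<^bsub>N\<^esub>),
     add = (\<lambda>f g. \<lambda>x\<in>carrier M. f x \<oplus>\<^bsub>N\<^esub> g x),
     smult = (\<lambda>r f. \<lambda>x\<in>carrier M. r \<odot>\<^bsub>N\<^esub> f x)\<rparr>"

definition quot_mod :: "('a, 'b, 'm) module_scheme \<Rightarrow> 'b set \<Rightarrow> ('a, 'b set) module" where
  "quot_mod M H = \<lparr>carrier = a_rcosets\<^bsub>M\<^esub> H, mult = undefined, one = undefined,
     zero = H, add = set_add M, smult = (\<lambda>r X. \<Union>x\<in>X. H +>\<^bsub>M\<^esub> (r \<odot>\<^bsub>M\<^esub> x))\<rparr>"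

definition mod_span :: "('a, 'r) ring_scheme \<Rightarrow> ('a, 'b, 'm) module_scheme \<Rightarrow> 'b set \<Rightarrow> 'b set" where
  "mod_span R M X = \<Inter>{H. submodule H R M \<and> X \<subseteq> H}"

definition ideal_mod :: "('a, 'r) ring_scheme \<Rightarrow> 'a set \<Rightarrow> ('a, 'a) module" where
  "ideal_mod R I = (self_mod R)\<lparr>carrier := I\<rparr>"

abbreviation quot_by_ideal :: "('a, 'r) ring_scheme \<Rightarrow> 'a set \<Rightarrow> ('a, 'a set) module" where
  "quot_by_ideal R I \<equiv> quot_mod (self_mod R) I"

section \<open>Free modules and tensor products\<close>

definition free_mod :: "('a, 'r) ring_scheme \<Rightarrow> 'x set \<Rightarrow> ('a, 'x \<Rightarrow> 'a) module" where
  "free_mod R X = \<lparr>carrier = {g. (\<forall>x. g x \<in> carrier R) \<and> finite {x. g x \<noteq> \<zero>\<^bsub>R\<^esub>} \<and>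
       {x. g x \<noteq> \<zero>\<^bsub>R\<^esub>} \<subseteq> X},
     mult = undefined, one = undefined, zero = (\<lambda>x. \<zero>\<^bsub>R\<^esub>),
     add = (\<lambda>g h x. g x \<oplus>\<^bsub>R\<^esub> h x), smult = (\<lambda>r g x. r \<otimes>\<^bsub>R\<^esub> g x)\<rparr>"

definition free_gen :: "('a, 'r) ring_scheme \<Rightarrow> 'x \<Rightarrow> 'x \<Rightarrow> 'a" where
  "free_gen R x = (\<lambda>y. if y = x then \<one>\<^bsub>R\<^esub> else \<zero>\<^bsub>R\<^esub>)"

text \<open>The homomorphism from a free module to \<open>N\<close> which sends the basis element of \<open>x\<close> to \<open>\<phi> x\<close>.\<close>

definition free_lift ::
  "('a, 'r) ring_scheme \<Rightarrow> ('a, 'b, 'm) module_scheme \<Rightarrow> ('x \<Rightarrow> 'b) \<Rightarrow> ('x \<Rightarrow> 'a) \<Rightarrow> 'b" where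
  "free_lift R N \<phi> g = (\<Oplus>\<^bsub>N\<^esub>x\<in>{x. g x \<noteq> \<zero>\<^bsub>R\<^esub>}. g x \<odot>\<^bsub>N\<^esub> \<phi> x)"

definition tensor_rel ::
  "('a, 'r) ring_scheme \<Rightarrow> ('a, 'b, 'm) module_scheme \<Rightarrow> ('a, 'c, 'n) module_scheme
    \<Rightarrow> ('b \<times> 'c \<Rightarrow> 'a) set" where
  "tensor_rel R M N = (let F = free_mod R (carrier M \<times> carrier N); e = free_gen R in
     mod_span R F
      ({e (x \<oplus>\<^bsub>M\<^esub> x', y) \<ominus>\<^bsub>F\<^esub> (e (x, y) \<oplus>\<^bsub>F\<^esub> e (x', y)) | x x' y.
           x \<in> carrier M \<and> x' \<in> carrier M \<and> y \<in> carrier N} \<union>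
       {e (x, y \<oplus>\<^bsub>N\<^esub> y') \<ominus>\<^bsub>F\<^esub> (e (x, y) \<oplus>\<^bsub>F\<^esub> e (x, y')) | x y y'.
           x \<in> carrier M \<and> y \<in> carrier N \<and> y' \<in> carrier N} \<union>
       {e (r \<odot>\<^bsub>M\<^esub> x, y) \<ominus>\<^bsub>F\<^esub> r \<odot>\<^bsub>F\<^esub> e (x, y) | r x y.
           r \<in> carrier R \<and> x \<in> carrier M \<and> y \<in> carrier N} \<union>
       {e (x, r \<odot>\<^bsub>N\<^esub> y) \<ominus>\<^bsub>F\<^esub> r \<odot>\<^bsub>F\<^esub> e (x, y) | r x y.
           r \<in> carrier R \<and> x \<in> carrier M \<and> y \<in> carrier N}))"

definition tensor ::
  "('a, 'r) ring_scheme \<Rightarrow> ('a, 'b, 'm) module_scheme \<Rightarrow> ('a, 'c, 'n) module_scheme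
    \<Rightarrow> ('a, ('b \<times> 'c \<Rightarrow> 'a) set) module" where
  "tensor R M N = quot_mod (free_mod R (carrier M \<times> carrier N)) (tensor_rel R M N)"

text \<open>The map \<open>f \<otimes> 1 : A \<otimes> M \<rightarrow> B \<otimes> M\<close>; all representatives of a coset contribute the same coset
  to the union.\<close>

definition tensor_map ::
  "('a, 'r) ring_scheme \<Rightarrow> ('a, 'b, 'm) module_scheme \<Rightarrow> ('a, 'd, 'n) module_scheme
    \<Rightarrow> ('b \<Rightarrow> 'c) \<Rightarrow> ('a, 'c, 'k) module_scheme
    \<Rightarrow> ('b \<times> 'd \<Rightarrow> 'a) set \<Rightarrow> ('c \<times> 'd \<Rightarrow> 'a) set" where
  "tensor_map R A M f B T = (let F = free_mod R (carrier B \<times> carrier M) in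
     \<Union>t\<in>T. tensor_rel R B M +>\<^bsub>F\<^esub> free_lift R F (\<lambda>(x, y). free_gen R (f x, y)) t)"

section \<open>Tor and Ext in degree one\<close>

text \<open>
  \<open>Tor\<^sub>1(N, M)\<close> and \<open>Ext\<^sup>1(N, M)\<close> are computed from the standard free resolution
  \<open>\<dots> \<rightarrow> F\<^sub>2 \<rightarrow> F\<^sub>1 \<rightarrow> F\<^sub>0 \<rightarrow> N\<close> in which \<open>F\<^sub>0\<close> is free on the set \<open>N\<close>, \<open>F\<^sub>1\<close> is free on the set
  \<open>K = ker(F\<^sub>0 \<rightarrow> N)\<close>, and \<open>F\<^sub>2\<close> is free on the set \<open>ker(F\<^sub>1 \<rightarrow> F\<^sub>0)\<close>.  With \<open>cover\<close> and
  \<open>syzygy\<close> as below, \<open>F\<^sub>0 = cover N\<close>, \<open>F\<^sub>1 = cover (syzygy N)\<close>, \<open>F\<^sub>2 = cover (syzygy (syzygy N))\<close>.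
\<close>

definition cover :: "('a, 'r) ring_scheme \<Rightarrow> ('a, 'b, 'm) module_scheme \<Rightarrow> ('a, 'b \<Rightarrow> 'a) module" where
  "cover R N = free_mod R (carrier N)"

definition cover_map ::
  "('a, 'r) ring_scheme \<Rightarrow> ('a, 'b, 'm) module_scheme \<Rightarrow> ('b \<Rightarrow> 'a) \<Rightarrow> 'b" where
  "cover_map R N = free_lift R N (\<lambda>x. x)"

definition syzygy :: "('a, 'r) ring_scheme \<Rightarrow> ('a, 'b, 'm) module_scheme \<Rightarrow> ('a, 'b \<Rightarrow> 'a) module" where
  "syzygy R N = (cover R N)\<lparr>carrier := a_kernel (cover R N) N (cover_map R N)\<rparr>"

text \<open>The homology of \<open>A \<rightarrow> B \<rightarrow> C\<close> at \<open>B\<close>.\<close>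

definition homology ::
  "('a, 'b, 'm) module_scheme \<Rightarrow> ('b \<Rightarrow> 'c) \<Rightarrow> ('a, 'c) module \<Rightarrow> ('c \<Rightarrow> 'd)
    \<Rightarrow> ('a, 'd, 'n) module_scheme \<Rightarrow> ('a, 'c set) module" where
  "homology A f B g C = quot_mod (B\<lparr>carrier := a_kernel B C g\<rparr>) (f ` carrier A)"

definition Tor1 ::
  "('a, 'r) ring_scheme \<Rightarrow> ('a, 'b, 'm) module_scheme \<Rightarrow> ('a, 'c, 'n) module_scheme
    \<Rightarrow> ('a, ((('b \<Rightarrow> 'a) \<Rightarrow> 'a) \<times> 'c \<Rightarrow> 'a) set set) module" where
  "Tor1 R N M =
     (let K = syzygy R N; L = syzygy R K; F0 = cover R N; F1 = cover R K; F2 = cover R L in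
      homology (tensor R F2 M) (tensor_map R F2 M (cover_map R L) F1)
               (tensor R F1 M) (tensor_map R F1 M (cover_map R K) F0)
               (tensor R F0 M))"

definition Ext1 ::
  "('a, 'r) ring_scheme \<Rightarrow> ('a, 'b, 'm) module_scheme \<Rightarrow> ('a, 'c, 'n) module_scheme
    \<Rightarrow> ('a, ((('b \<Rightarrow> 'a) \<Rightarrow> 'a) \<Rightarrow> 'c) set) module" where
  "Ext1 R N M =
     (let K = syzygy R N; L = syzygy R K; F0 = cover R N; F1 = cover R K; F2 = cover R L in
      homology (hom_mod R F0 M) (\<lambda>h. compose (carrier F1) h (cover_map R K))
               (hom_mod R F1 M) (\<lambda>h. compose (carrier F2) h (cover_map R L))
               (hom_mod R F2 M))"

section \<open>Localization\<close>

text \<open>\<open>loc_frac R S M x s\<close> is the fraction \<open>x/s\<close> of \<open>S\<^sup>-\<^sup>1M\<close>, i.e. the class of \<open>(x, s)\<close>.\<close>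

definition loc_frac ::
  "('a, 'r) ring_scheme \<Rightarrow> 'a set \<Rightarrow> ('a, 'b, 'm) module_scheme \<Rightarrow> 'b \<Rightarrow> 'a \<Rightarrow> ('b \<times> 'a) set" where
  "loc_frac R S M x s = {(y, t). y \<in> carrier M \<and> t \<in> S \<and>
     (\<exists>u\<in>S. u \<odot>\<^bsub>M\<^esub> (t \<odot>\<^bsub>M\<^esub> x) = u \<odot>\<^bsub>M\<^esub> (s \<odot>\<^bsub>M\<^esub> y))}"

text \<open>The module \<open>S\<^sup>-\<^sup>1M\<close> over \<open>S\<^sup>-\<^sup>1R\<close>.\<close>

definition loc_mod ::
  "('a, 'r) ring_scheme \<Rightarrow> 'a set \<Rightarrow> ('a, 'b, 'm) module_scheme
    \<Rightarrow> (('a \<times> 'a) set, ('b \<times> 'a) set) module" where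
  "loc_mod R S M = \<lparr>carrier = {loc_frac R S M x s | x s. x \<in> carrier M \<and> s \<in> S},
     mult = undefined, one = undefined, zero = loc_frac R S M \<zero>\<^bsub>M\<^esub> \<one>\<^bsub>R\<^esub>,
     add = (\<lambda>X Y. \<Union>(x, s)\<in>X. \<Union>(y, t)\<in>Y.
       loc_frac R S M (t \<odot>\<^bsub>M\<^esub> x \<oplus>\<^bsub>M\<^esub> s \<odot>\<^bsub>M\<^esub> y) (s \<otimes>\<^bsub>R\<^esub> t)),
     smult = (\<lambda>A X. \<Union>(a, s)\<in>A. \<Union>(x, t)\<in>X. loc_frac R S M (a \<odot>\<^bsub>M\<^esub> x) (s \<otimes>\<^bsub>R\<^esub> t))\<rparr>"

definition loc_ring :: "('a, 'r) ring_scheme \<Rightarrow> 'a set \<Rightarrow> ('a \<times> 'a) set ring" where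
  "loc_ring R S = (let L = loc_mod R S (self_mod R) in
     \<lparr>carrier = carrier L, mult = smult L, one = loc_frac R S (self_mod R) \<one>\<^bsub>R\<^esub> \<one>\<^bsub>R\<^esub>,
      zero = zero L, add = add L\<rparr>)"

definition loc_map ::
  "('a, 'r) ring_scheme \<Rightarrow> 'a set \<Rightarrow> ('a, 'c, 'n) module_scheme \<Rightarrow> ('b \<Rightarrow> 'c)
    \<Rightarrow> ('b \<times> 'a) set \<Rightarrow> ('c \<times> 'a) set" where
  "loc_map R S N f X = (\<Union>(x, s)\<in>X. loc_frac R S N (f x) s)"

definition regular_elements :: "('a, 'r) ring_scheme \<Rightarrow> 'a set" where
  "regular_elements A = {s \<in> carrier A. \<forall>r\<in>carrier A. s \<otimes>\<^bsub>A\<^esub> r = \<zero>\<^bsub>A\<^esub> \<longrightarrow> r = \<zero>\<^bsub>A\<^esub>}"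

definition total_quotient :: "('a, 'r) ring_scheme \<Rightarrow> ('a \<times> 'a) set ring" where
  "total_quotient A = loc_ring A (regular_elements A)"

section \<open>Semi-regular ideals and the ring of finite fractions\<close>

definition fg_ideal :: "('a, 'r) ring_scheme \<Rightarrow> 'a set \<Rightarrow> bool" where
  "fg_ideal R I \<longleftrightarrow> ideal I R \<and> (\<exists>X. finite X \<and> X \<subseteq> carrier R \<and> I = Idl\<^bsub>R\<^esub> X)"

definition dense_ideal :: "('a, 'r) ring_scheme \<Rightarrow> 'a set \<Rightarrow> bool" where
  "dense_ideal R I \<longleftrightarrow> ideal I R \<and>
     {r \<in> carrier R. \<forall>a\<in>I. a \<otimes>\<^bsub>R\<^esub> r = \<zero>\<^bsub>R\<^esub>} = {\<zero>\<^bsub>R\<^esub>}"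

definition semi_regular_ideal :: "('a, 'r) ring_scheme \<Rightarrow> 'a set \<Rightarrow> bool" where
  "semi_regular_ideal R I \<longleftrightarrow> ideal I R \<and> (\<exists>J. fg_ideal R J \<and> dense_ideal R J \<and> J \<subseteq> I)"

definition Q_ideals :: "('a, 'r) ring_scheme \<Rightarrow> 'a set set" where
  "Q_ideals R = {I. fg_ideal R I \<and> semi_regular_ideal R I}"

text \<open>The embedding \<open>R \<rightarrow> R[x] \<rightarrow> T(R[x])\<close>.\<close>

definition to_TRx :: "('a, 'r) ring_scheme \<Rightarrow> 'a \<Rightarrow> ((nat \<Rightarrow> 'a) \<times> (nat \<Rightarrow> 'a)) set" where
  "to_TRx R r = loc_frac (UP R) (regular_elements (UP R)) (self_mod (UP R))
     (monom (UP R) r 0) \<one>\<^bsub>UP R\<^esub>"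

definition Q0 :: "('a, 'r) ring_scheme \<Rightarrow> ((nat \<Rightarrow> 'a) \<times> (nat \<Rightarrow> 'a)) set set" where
  "Q0 R = {\<alpha> \<in> carrier (total_quotient (UP R)). \<exists>I\<in>Q_ideals R. \<forall>a\<in>I.
     to_TRx R a \<otimes>\<^bsub>total_quotient (UP R)\<^esub> \<alpha> \<in> to_TRx R ` carrier R}"

section \<open>GV-ideals and w-modules\<close>

definition GV :: "('a, 'r) ring_scheme \<Rightarrow> 'a set set" where
  "GV R = {J. fg_ideal R J \<and>
     (\<lambda>r\<in>carrier R. \<lambda>x\<in>J. r \<otimes>\<^bsub>R\<^esub> x)
       \<in> mod_iso R (self_mod R) (hom_mod R (ideal_mod R J) (self_mod R))}"

definition WQ_ring :: "('a, 'r) ring_scheme \<Rightarrow> bool" where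
  "WQ_ring R \<longleftrightarrow> (\<forall>I\<in>Q_ideals R. I \<in> GV R)"

definition tor_GV :: "('a, 'r) ring_scheme \<Rightarrow> ('a, 'b, 'm) module_scheme \<Rightarrow> 'b set" where
  "tor_GV R M = {x \<in> carrier M. \<exists>J\<in>GV R. \<forall>a\<in>J. a \<odot>\<^bsub>M\<^esub> x = \<zero>\<^bsub>M\<^esub>}"

definition GV_torsion :: "('a, 'r) ring_scheme \<Rightarrow> ('a, 'b, 'm) module_scheme \<Rightarrow> bool" where
  "GV_torsion R M \<longleftrightarrow> tor_GV R M = carrier M"

definition GV_torsion_free :: "('a, 'r) ring_scheme \<Rightarrow> ('a, 'b, 'm) module_scheme \<Rightarrow> bool" where
  "GV_torsion_free R M \<longleftrightarrow> tor_GV R M = {\<zero>\<^bsub>M\<^esub>}"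

definition w_module :: "('a, 'r) ring_scheme \<Rightarrow> ('a, 'b, 'm) module_scheme \<Rightarrow> bool" where
  "w_module R M \<longleftrightarrow> module R M \<and> GV_torsion_free R M \<and>
     (\<forall>J\<in>GV R. carrier (Ext1 R (quot_by_ideal R J) M) = {\<zero>\<^bsub>Ext1 R (quot_by_ideal R J) M\<^esub>})"

definition w_env_ideal :: "('a, 'r) ring_scheme \<Rightarrow> 'a set \<Rightarrow> 'a set" where
  "w_env_ideal R A = {r \<in> carrier R. \<exists>J\<in>GV R. \<forall>a\<in>J. a \<otimes>\<^bsub>R\<^esub> r \<in> A}"

definition proper_w_ideal :: "('a, 'r) ring_scheme \<Rightarrow> 'a set \<Rightarrow> bool" where
  "proper_w_ideal R I \<longleftrightarrow> ideal I R \<and> I \<noteq> carrier R \<and> w_module R (ideal_mod R I)"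

definition w_Max :: "('a, 'r) ring_scheme \<Rightarrow> 'a set set" where
  "w_Max R = {P. proper_w_ideal R P \<and> (\<forall>I. proper_w_ideal R I \<and> P \<subseteq> I \<longrightarrow> I = P)}"

definition w_mono ::
  "('a, 'r) ring_scheme \<Rightarrow> ('a, 'b, 'm) module_scheme \<Rightarrow> ('b \<Rightarrow> 'c) \<Rightarrow> ('a, 'c, 'n) module_scheme \<Rightarrow> bool"
  where
  "w_mono R M f N \<longleftrightarrow> f \<in> mod_hom R M N \<and>
     (\<forall>P\<in>w_Max R. inj_on (loc_map R (carrier R - P) N f) (carrier (loc_mod R (carrier R - P) M)))"

text \<open>
  HOL cannot quantify over types inside a formula.  A statement about all modules is therefore made
  about all modules with carrier in a universe type \<open>'u\<close>, which is arbitrary except that it has to be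
  large enough to hold a copy of \<open>R\<close>.  This applies in particular to the modules \<open>A\<close> and \<open>B\<close> against
  which w-flatness of \<open>M\<close> is tested; as their carrier type is not determined by \<open>R\<close> and \<open>M\<close>, it is
  passed as the argument \<open>U\<close>.
\<close>

definition w_flat :: "'u itself \<Rightarrow> ('a, 'r) ring_scheme \<Rightarrow> ('a, 'b, 'm) module_scheme \<Rightarrow> bool" where
  "w_flat U R M \<longleftrightarrow> (\<forall>(A :: ('a, 'u) module) (B :: ('a, 'u) module) f.
     module R A \<and> module R B \<and> w_mono R A f B \<longrightarrow>
     w_mono R (tensor R A M) (tensor_map R A M f B) (tensor R B M))"

definition semi_regular_w_flat :: "('a, 'r) ring_scheme \<Rightarrow> ('a, 'b, 'm) module_scheme \<Rightarrow> bool" where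
  "semi_regular_w_flat R M \<longleftrightarrow> (\<forall>I\<in>Q_ideals R. GV_torsion R (Tor1 R (quot_by_ideal R I) M))"

section \<open>Injective envelopes and Lucas modules\<close>

text \<open>
  The test modules \<open>A\<close> and \<open>B\<close> have their carriers in the type \<open>'e\<close> of \<open>E\<close>.  By Baer's criterion
  this loses nothing when \<open>'e\<close> has room for \<open>R\<close>, as the type \<open>('a, 'b) envelope\<close> below has.
\<close>

definition injective_module :: "('a, 'r) ring_scheme \<Rightarrow> ('a, 'e) module \<Rightarrow> bool" where
  "injective_module R E \<longleftrightarrow> module R E \<and>
     (\<forall>(A :: ('a, 'e) module) (B :: ('a, 'e) module) f g.
        module R A \<and> module R B \<and> f \<in> mod_hom R A B \<and> inj_on f (carrier A) \<and> g \<in> mod_hom R A E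
        \<longrightarrow> (\<exists>h\<in>mod_hom R B E. \<forall>x\<in>carrier A. h (f x) = g x))"

definition injective_envelope ::
  "('a, 'r) ring_scheme \<Rightarrow> ('a, 'b, 'm) module_scheme \<Rightarrow> ('a, 'e) module \<Rightarrow> ('b \<Rightarrow> 'e) \<Rightarrow> bool" where
  "injective_envelope R M E \<iota> \<longleftrightarrow> injective_module R E \<and>
     \<iota> \<in> mod_hom R M E \<and> inj_on \<iota> (carrier M) \<and>
     (\<forall>H. submodule H R E \<and> H \<noteq> {\<zero>\<^bsub>E\<^esub>} \<longrightarrow> H \<inter> \<iota> ` carrier M \<noteq> {\<zero>\<^bsub>E\<^esub>})"

text \<open>
  A type in which every \<open>R\<close>-module with carrier in \<open>'b\<close> has an injective envelope, for \<open>R\<close> a ring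
  with carrier in \<open>'a\<close>: the additive group of \<open>M\<close> is a quotient of a free abelian group, hence embeds
  in a quotient \<open>D\<close> of the rational vector space with basis \<open>M\<close>; the elements of \<open>D\<close> are sets of
  functions \<open>'b \<Rightarrow> rat\<close>.  As \<open>D\<close> is divisible, the group of additive maps \<open>R \<rightarrow> D\<close> is an injective
  \<open>R\<close>-module containing \<open>M\<close>, and \<open>E(M)\<close> can be found as a submodule of it.
\<close>

type_synonym ('a, 'b) envelope = "'a \<Rightarrow> ('b \<Rightarrow> rat) set"

definition Q_torsion_free :: "('a, 'r) ring_scheme \<Rightarrow> ('a, 'b, 'm) module_scheme \<Rightarrow> bool" where
  "Q_torsion_free R M \<longleftrightarrow> (\<forall>I\<in>Q_ideals R. \<forall>x\<in>carrier M.
     (\<forall>a\<in>I. a \<odot>\<^bsub>M\<^esub> x = \<zero>\<^bsub>M\<^esub>) \<longrightarrow> x = \<zero>\<^bsub>M\<^esub>)"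

text \<open>\<open>M\<^sub>q\<close>, computed in the injective envelope \<open>\<iota> : M \<rightarrow> E\<close>.\<close>

definition Lucas_envelope ::
  "('a, 'r) ring_scheme \<Rightarrow> ('a, 'b, 'm) module_scheme \<Rightarrow> ('a, 'e) module \<Rightarrow> ('b \<Rightarrow> 'e) \<Rightarrow> 'e set" where
  "Lucas_envelope R M E \<iota> =
     {x \<in> carrier E. \<exists>I\<in>Q_ideals R. \<forall>a\<in>I. a \<odot>\<^bsub>E\<^esub> x \<in> \<iota> ` carrier M}"

text \<open>Injective envelopes are unique up to isomorphism over \<open>M\<close>, so the choice of \<open>E\<close> is immaterial.\<close>

definition Lucas_module :: "('a, 'r) ring_scheme \<Rightarrow> ('a, 'b, 'm) module_scheme \<Rightarrow> bool" where
  "Lucas_module R M \<longleftrightarrow> module R M \<and> Q_torsion_free R M \<and>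
     (\<forall>(E :: ('a, ('a, 'b) envelope) module) \<iota>. injective_envelope R M E \<iota> \<longrightarrow>
        Lucas_envelope R M E \<iota> = \<iota> ` carrier M)"

end

theory Submission
  imports Defs "HOL-Library.Equipollence"
begin

text \<open>
  Let \<open>R\<close> be a WQ-ring.  Then \<open>I \<subseteq> (I\<^sup>2)\<^sub>w\<close> for \<open>I \<in> \<Q>\<close> because \<open>I I \<subseteq> I\<^sup>2\<close>, and the remaining
  statements follow from two properties of a GV-ideal \<open>I\<close>.  It annihilates \<open>R/I\<close>, hence also
  \<open>Tor\<^sub>1(R/I, M)\<close>, where multiplication by an element of \<open>I\<close> is null-homotopic on the resolution
  (\<open>Tor1_annihilated\<close>), and \<open>A \<otimes> R/I\<close>, whose localizations at the maximal \<open>w\<close>-ideals are therefore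
  zero (\<open>w_flat_if_GV\<close>).  And every homomorphism from \<open>I\<close> to a \<open>w\<close>-module is multiplication by an
  element of that module (\<open>w_module_iff\<close>, which computes \<open>Ext\<^sup>1\<close>); so a \<open>w\<close>-module is equal to its
  Lucas envelope, and a finite fraction is equal to an element of \<open>R\<close>.

  The converse implications from \<open>w\<close>-flatness, semi-regular \<open>w\<close>-flatness and \<open>I \<subseteq> (I\<^sup>2)\<^sub>w\<close> are local.
  Let \<open>P\<close> be maximal among the ideals that contain no GV-ideal.  Such \<open>P\<close> are prime because GV-ideals
  are closed under products, there are enough of them because GV-ideals are finitely generated, and
  they are exactly the maximal \<open>w\<close>-ideals (\<open>w_Max_iff\<close>).  Suppose that \<open>I \<in> \<Q>\<close> satisfies
  \<open>I\<^sub>P = I\<^sub>P\<^sup>2\<close> for all such \<open>P \<supseteq> I\<close>.  If there were such a \<open>P\<close>, Nakayama's lemma would give an element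
  outside \<open>P\<close> that annihilates \<open>I\<close>, although \<open>I\<close> is dense.  So \<open>I\<close> lies in no such \<open>P\<close>; it contains a
  GV-ideal and, being finitely generated, is one itself (\<open>GV_if_locally_idempotent\<close>).  The local
  hypothesis is supplied
    \<^item> by \<open>I \<subseteq> (I\<^sup>2)\<^sub>w\<close>, since no GV-ideal lies in \<open>P\<close>;
    \<^item> by semi-regular \<open>w\<close>-flatness of \<open>R/I\<close>, since \<open>Tor\<^sub>1(R/I, R/I) = I/I\<^sup>2\<close>;
    \<^item> by \<open>w\<close>-flatness of \<open>R/I\<close>: tensoring \<open>I \<rightarrow> R\<close> with \<open>R/I\<close> sends \<open>a \<otimes> 1\<close> to \<open>0\<close>, so \<open>a \<otimes> 1\<close> vanishes
      locally in \<open>I \<otimes> R/I = I/I\<^sup>2\<close>.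

  If \<open>R\<close> is not a WQ-ring, some \<open>I \<in> \<Q>\<close> lies in a \<open>P\<close> as above.  Every GV-ideal meets the complement
  of \<open>P\<close>, and therefore the residue field \<open>\<kappa>(P)\<close> is a \<open>w\<close>-module (\<open>fraction_mod_w_module\<close>); but
  \<open>I\<close> annihilates it, so it is not \<open>\<Q>\<close>-torsion-free, let alone a Lucas module.  A copy of
  \<open>\<kappa>(P)\<close> lies in the given universe because \<open>\<kappa>(P)\<close> has no more elements than \<open>R\<close>.

  Finally let \<open>\<phi> : I \<rightarrow> R\<close> with \<open>I = (a\<^sub>0, \<dots>, a\<^sub>n) \<in> \<Q>\<close>.  By McCoy's theorem \<open>f = \<Sum> a\<^sub>i x\<^sup>i\<close> is a regular
  element of \<open>R[x]\<close>, and \<open>\<alpha> = (\<Sum> \<phi>(a\<^sub>i) x\<^sup>i) / f\<close> satisfies \<open>a \<alpha> = \<phi>(a)\<close> for \<open>a \<in> I\<close>, whence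
  \<open>\<alpha> \<in> Q\<^sub>0(R)\<close>.  So \<open>Q\<^sub>0(R) = R\<close> says precisely that every such \<open>\<phi>\<close> is a multiplication.
\<close>

section \<open>Module homomorphisms, images and quotients\<close>

lemma mod_homI:
  assumes "\<And>x. x \<in> carrier M \<Longrightarrow> f x \<in> carrier N"
    and "\<And>x y. x \<in> carrier M \<Longrightarrow> y \<in> carrier M \<Longrightarrow> f (x \<oplus>\<^bsub>M\<^esub> y) = f x \<oplus>\<^bsub>N\<^esub> f y"
    and "\<And>r x. r \<in> carrier R \<Longrightarrow> x \<in> carrier M \<Longrightarrow> f (r \<odot>\<^bsub>M\<^esub> x) = r \<odot>\<^bsub>N\<^esub> f x"
  shows "f \<in> mod_hom R M N"
  using assms by (auto simp: mod_hom_def)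

lemma mod_hom_closed: "f \<in> mod_hom R M N \<Longrightarrow> x \<in> carrier M \<Longrightarrow> f x \<in> carrier N"
  by (auto simp: mod_hom_def)

lemma mod_hom_add:
  "f \<in> mod_hom R M N \<Longrightarrow> x \<in> carrier M \<Longrightarrow> y \<in> carrier M \<Longrightarrow> f (x \<oplus>\<^bsub>M\<^esub> y) = f x \<oplus>\<^bsub>N\<^esub> f y"
  by (auto simp: mod_hom_def)

lemma mod_hom_smult:
  "f \<in> mod_hom R M N \<Longrightarrow> r \<in> carrier R \<Longrightarrow> x \<in> carrier M \<Longrightarrow> f (r \<odot>\<^bsub>M\<^esub> x) = r \<odot>\<^bsub>N\<^esub> f x"
  by (auto simp: mod_hom_def)

lemma mod_hom_comp:
  "f \<in> mod_hom R M N \<Longrightarrow> g \<in> mod_hom R N K \<Longrightarrow> (\<lambda>x. g (f x)) \<in> mod_hom R M K"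
  by (auto simp: mod_hom_def Pi_def)

lemma mod_hom_zero:
  assumes "module R M" "module R N" "f \<in> mod_hom R M N"
  shows "f \<zero>\<^bsub>M\<^esub> = \<zero>\<^bsub>N\<^esub>"
proof -
  interpret M: module R M by fact
  interpret N: module R N by fact
  have "f \<zero>\<^bsub>M\<^esub> = f (\<zero>\<^bsub>R\<^esub> \<odot>\<^bsub>M\<^esub> \<zero>\<^bsub>M\<^esub>)" by simp
  also have "\<dots> = \<zero>\<^bsub>N\<^esub>"
    using mod_hom_smult[OF assms(3), of "\<zero>\<^bsub>R\<^esub>" "\<zero>\<^bsub>M\<^esub>"] mod_hom_closed[OF assms(3)] by simp
  finally show ?thesis .
qed

lemma (in module) minus_zero_right [simp]: "x \<in> carrier M \<Longrightarrow> x \<ominus>\<^bsub>M\<^esub> \<zero>\<^bsub>M\<^esub> = x"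
  by (simp add: a_minus_def)

lemma (in module) eq_if_minus_eq_zero:
  "x \<in> carrier M \<Longrightarrow> y \<in> carrier M \<Longrightarrow> x \<ominus>\<^bsub>M\<^esub> y = \<zero>\<^bsub>M\<^esub> \<Longrightarrow> x = y"
  by (metis M.a_inv_closed M.add.inv_equality M.minus_eq M.minus_minus)

lemma (in module) smult_minus_one: "x \<in> carrier M \<Longrightarrow> (\<ominus> \<one>) \<odot>\<^bsub>M\<^esub> x = \<ominus>\<^bsub>M\<^esub> x"
  by (simp add: smult_l_minus)

lemma mod_hom_minus:
  assumes "module R M" "module R N" "f \<in> mod_hom R M N" "x \<in> carrier M" "y \<in> carrier M"
  shows "f (x \<ominus>\<^bsub>M\<^esub> y) = f x \<ominus>\<^bsub>N\<^esub> f y"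
proof -
  interpret M: module R M by fact
  interpret N: module R N by fact
  have "f (\<ominus>\<^bsub>M\<^esub> y) = \<ominus>\<^bsub>N\<^esub> f y"
    using mod_hom_smult[OF assms(3), of "\<ominus>\<^bsub>R\<^esub> \<one>\<^bsub>R\<^esub>" y] assms
    by (simp add: M.smult_minus_one N.smult_minus_one mod_hom_closed[OF assms(3)])
  then show ?thesis using assms by (simp add: a_minus_def mod_hom_add[OF assms(3)])
qed

text \<open>Negation is multiplication by the scalar \<open>- 1\<close>.\<close>

lemma (in module) submodule_closedI:
  assumes "H \<subseteq> carrier M" "\<zero>\<^bsub>M\<^esub> \<in> H"
    and "\<And>x y. x \<in> H \<Longrightarrow> y \<in> H \<Longrightarrow> x \<oplus>\<^bsub>M\<^esub> y \<in> H"
    and smult: "\<And>r x. r \<in> carrier R \<Longrightarrow> x \<in> H \<Longrightarrow> r \<odot>\<^bsub>M\<^esub> x \<in> H"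
  shows "submodule H R M"
proof (rule submoduleI)
  fix a assume "a \<in> H"
  then show "\<ominus>\<^bsub>M\<^esub> a \<in> H" using smult[of "\<ominus> \<one>" a] assms(1) by (auto simp: smult_minus_one)
qed (use assms in auto)

lemma submoduleD:
  assumes "submodule H R M"
  shows "H \<subseteq> carrier M" "\<zero>\<^bsub>M\<^esub> \<in> H"
    "\<And>x y. x \<in> H \<Longrightarrow> y \<in> H \<Longrightarrow> x \<oplus>\<^bsub>M\<^esub> y \<in> H"
    "\<And>r x. r \<in> carrier R \<Longrightarrow> x \<in> H \<Longrightarrow> r \<odot>\<^bsub>M\<^esub> x \<in> H"
proof -
  interpret submodule H R M by fact
  show "H \<subseteq> carrier M" using subset by simp
  show "\<zero>\<^bsub>M\<^esub> \<in> H" using one_closed by simp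
  show "\<And>x y. x \<in> H \<Longrightarrow> y \<in> H \<Longrightarrow> x \<oplus>\<^bsub>M\<^esub> y \<in> H" using m_closed by simp
qed (rule submodule.smult_closed[OF assms])

lemma submodule_kernel:
  assumes "module R M" "module R N" "f \<in> mod_hom R M N"
  shows "submodule (a_kernel M N f) R M"
proof -
  interpret M: module R M by fact
  interpret N: module R N by fact
  show ?thesis
    by (rule M.submodule_closedI)
      (auto simp: a_kernel_def' mod_hom_zero[OF assms] mod_hom_add[OF assms(3)] mod_hom_smult[OF assms(3)])
qed

lemma submodule_image:
  assumes "module R M" "module R N" "f \<in> mod_hom R M N"
  shows "submodule (f ` carrier M) R N"
proof -
  interpret M: module R M by fact
  interpret N: module R N by fact
  show ?thesis
  proof (rule N.submodule_closedI)
    show "f ` carrier M \<subseteq> carrier N" using mod_hom_closed[OF assms(3)] by auto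
    show "\<zero>\<^bsub>N\<^esub> \<in> f ` carrier M" using mod_hom_zero[OF assms] by (metis M.zero_closed imageI)
  next
    fix x y assume "x \<in> f ` carrier M" "y \<in> f ` carrier M"
    then show "x \<oplus>\<^bsub>N\<^esub> y \<in> f ` carrier M"
      by (metis (no_types, lifting) M.a_closed image_iff mod_hom_add[OF assms(3)])
  next
    fix r x assume "r \<in> carrier R" "x \<in> f ` carrier M"
    then show "r \<odot>\<^bsub>N\<^esub> x \<in> f ` carrier M"
      by (metis (no_types, lifting) M.smult_closed image_iff mod_hom_smult[OF assms(3)])
  qed
qed

text \<open>The module axioms are equations, so they pass to the image of a map that respects the
  operations.  Quotients, and copies of a module in another type, are modules for this reason.\<close>

lemma module_image:
  fixes N :: "('a, 'c, 'n) module_scheme"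
  assumes M: "module R M" and carr: "carrier N = q ` carrier M" and zero: "\<zero>\<^bsub>N\<^esub> = q \<zero>\<^bsub>M\<^esub>"
    and add: "\<And>x y. x \<in> carrier M \<Longrightarrow> y \<in> carrier M \<Longrightarrow> q x \<oplus>\<^bsub>N\<^esub> q y = q (x \<oplus>\<^bsub>M\<^esub> y)"
    and smult: "\<And>r x. r \<in> carrier R \<Longrightarrow> x \<in> carrier M \<Longrightarrow> r \<odot>\<^bsub>N\<^esub> q x = q (r \<odot>\<^bsub>M\<^esub> x)"
  shows "module R N"
proof -
  interpret M: module R M by fact
  have "abelian_group N"
  proof (rule abelian_groupI)
    fix x assume "x \<in> carrier N"
    then obtain a where "a \<in> carrier M" "x = q a" using carr by auto
    then show "\<exists>y\<in>carrier N. y \<oplus>\<^bsub>N\<^esub> x = \<zero>\<^bsub>N\<^esub>"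
      by (intro bexI[of _ "q (\<ominus>\<^bsub>M\<^esub> a)"]) (auto simp: carr add zero M.M.l_neg)
  qed (auto simp: carr add zero M.M.a_ac)
  then show ?thesis
    by (intro moduleI)
      (auto simp: carr add smult M.is_cring M.smult_l_distr M.smult_r_distr M.smult_assoc1)
qed

lemma (in cring) self_mod_module: "module R (self_mod R)"
proof -
  have "abelian_group (self_mod R)"
    by (rule abelian_groupI)
      (auto simp: self_mod_def a_ac intro: add.l_inv_ex)
  then show ?thesis
    by (intro moduleI) (auto simp: self_mod_def is_cring l_distr r_distr m_assoc)
qed

lemma self_mod_simps [simp]:
  "carrier (self_mod R) = carrier R" "zero (self_mod R) = zero R" "add (self_mod R) = add R"
  "smult (self_mod R) = mult R"
  by (simp_all add: self_mod_def)

lemma self_mod_minus: "x \<ominus>\<^bsub>self_mod R\<^esub> y = x \<ominus>\<^bsub>R\<^esub> y"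
  by (simp add: a_minus_def a_inv_def m_inv_def self_mod_def)

lemma ideal_mod_simps [simp]:
  "carrier (ideal_mod R I) = I" "zero (ideal_mod R I) = zero R" "add (ideal_mod R I) = add R"
  "smult (ideal_mod R I) = mult R"
  by (simp_all add: ideal_mod_def)

lemma (in cring) ideal_iff_submodule: "ideal I R \<longleftrightarrow> submodule I R (self_mod R)"
proof
  assume "ideal I R"
  then interpret ideal I R .
  show "submodule I R (self_mod R)"
    by (rule module.submodule_closedI[OF self_mod_module])
      (auto simp: a_subset I_l_closed)
next
  assume I: "submodule I R (self_mod R)"
  note D = submoduleD[OF I, simplified]
  have neg: "\<ominus> x \<in> I" if "x \<in> I" for x
    using D(4)[of "\<ominus> \<one>" x] that D(1) by (auto simp: l_minus)
  show "ideal I R"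
  proof (rule idealI[OF ring_axioms])
    show "subgroup I (add_monoid R)"
      by (rule subgroup.intro) (use D neg in \<open>auto simp: a_inv_def\<close>)
  next
    fix a x assume "a \<in> I" "x \<in> carrier R"
    then show "x \<otimes> a \<in> I" "a \<otimes> x \<in> I" using D(4)[of x a] D(1) by (auto simp: m_comm)
  qed
qed

lemma (in cring) ideal_mod_module: "ideal I R \<Longrightarrow> module R (ideal_mod R I)"
  unfolding ideal_mod_def ideal_iff_submodule
  by (rule submodule.submodule_is_module[OF _ self_mod_module])

lemma (in cring) ideal_closedI:
  assumes "I \<subseteq> carrier R" "\<zero> \<in> I" "\<And>x y. x \<in> I \<Longrightarrow> y \<in> I \<Longrightarrow> x \<oplus> y \<in> I"
    and "\<And>r x. r \<in> carrier R \<Longrightarrow> x \<in> I \<Longrightarrow> r \<otimes> x \<in> I"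
  shows "ideal I R"
  unfolding ideal_iff_submodule
  by (rule module.submodule_closedI[OF self_mod_module]) (use assms in auto)

context module
begin

lemma abelian_subgroup_submodule: "submodule H R M \<Longrightarrow> abelian_subgroup H M"
  by (rule abelian_subgroupI3)
    (auto intro!: additive_subgroup.intro submodule.axioms(1) M.abelian_group_axioms)

lemma coset_eq_iff:
  assumes "submodule H R M" "x \<in> carrier M" "y \<in> carrier M"
  shows "H +>\<^bsub>M\<^esub> x = H +>\<^bsub>M\<^esub> y \<longleftrightarrow> x \<ominus>\<^bsub>M\<^esub> y \<in> H"
proof -
  interpret H: abelian_subgroup H M by (rule abelian_subgroup_submodule[OF assms(1)])
  have "x \<ominus>\<^bsub>M\<^esub> y \<in> H \<longleftrightarrow> x \<in> H +>\<^bsub>M\<^esub> y"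
    using H.a_rcos_module[OF assms(3,2)] by (simp add: a_minus_def)
  also have "\<dots> \<longleftrightarrow> H +>\<^bsub>M\<^esub> x = H +>\<^bsub>M\<^esub> y"
    using H.a_repr_independence'[OF _ assms(3), of x] H.a_rcos_self[OF assms(2)] by auto
  finally show ?thesis by simp
qed

lemma coset_self: "submodule H R M \<Longrightarrow> x \<in> carrier M \<Longrightarrow> x \<in> H +>\<^bsub>M\<^esub> x"
  using abelian_subgroup.a_rcos_self[OF abelian_subgroup_submodule] .

lemma coset_memD:
  assumes "submodule H R M" "x \<in> carrier M" "y \<in> H +>\<^bsub>M\<^esub> x"
  shows "y \<in> carrier M" "y \<ominus>\<^bsub>M\<^esub> x \<in> H" "H +>\<^bsub>M\<^esub> y = H +>\<^bsub>M\<^esub> x"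
proof -
  interpret H: abelian_subgroup H M by (rule abelian_subgroup_submodule[OF assms(1)])
  show y: "y \<in> carrier M" using assms H.a_elemrcos_carrier by blast
  show eq: "H +>\<^bsub>M\<^esub> y = H +>\<^bsub>M\<^esub> x"
    using H.a_repr_independence'[OF assms(3,2)] by simp
  show "y \<ominus>\<^bsub>M\<^esub> x \<in> H" using coset_eq_iff[OF assms(1) y assms(2)] eq by simp
qed

lemma coset_zero: "submodule H R M \<Longrightarrow> H +>\<^bsub>M\<^esub> \<zero>\<^bsub>M\<^esub> = H"
  using submoduleD(1)[of H R M] by (simp add: M.a_coset_add_zero)

lemma coset_eq_zero_iff:
  assumes "submodule H R M" "x \<in> carrier M"
  shows "H +>\<^bsub>M\<^esub> x = H \<longleftrightarrow> x \<in> H"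
  using coset_eq_iff[OF assms M.zero_closed] assms coset_zero[OF assms(1)]
  by simp

lemma quot_mod_carrier: "carrier (quot_mod M H) = (\<lambda>x. H +>\<^bsub>M\<^esub> x) ` carrier M"
  by (auto simp: quot_mod_def A_RCOSETS_def')

lemma quot_mod_zero [simp]: "\<zero>\<^bsub>quot_mod M H\<^esub> = H"
  by (simp add: quot_mod_def)

lemma quot_mod_add:
  assumes "submodule H R M" "x \<in> carrier M" "y \<in> carrier M"
  shows "(H +>\<^bsub>M\<^esub> x) \<oplus>\<^bsub>quot_mod M H\<^esub> (H +>\<^bsub>M\<^esub> y) = H +>\<^bsub>M\<^esub> (x \<oplus>\<^bsub>M\<^esub> y)"
  using abelian_subgroup.a_rcos_sum[OF abelian_subgroup_submodule] assms by (simp add: quot_mod_def)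

lemma quot_mod_smult:
  assumes H: "submodule H R M" and "r \<in> carrier R" "x \<in> carrier M"
  shows "r \<odot>\<^bsub>quot_mod M H\<^esub> (H +>\<^bsub>M\<^esub> x) = H +>\<^bsub>M\<^esub> (r \<odot>\<^bsub>M\<^esub> x)"
proof -
  have "H +>\<^bsub>M\<^esub> (r \<odot>\<^bsub>M\<^esub> y) = H +>\<^bsub>M\<^esub> (r \<odot>\<^bsub>M\<^esub> x)" if "y \<in> H +>\<^bsub>M\<^esub> x" for y
  proof -
    note y = coset_memD[OF H assms(3) that]
    have "r \<odot>\<^bsub>M\<^esub> y \<ominus>\<^bsub>M\<^esub> r \<odot>\<^bsub>M\<^esub> x = r \<odot>\<^bsub>M\<^esub> (y \<ominus>\<^bsub>M\<^esub> x)"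
      using assms y by (simp add: a_minus_def smult_r_distr smult_r_minus)
    then show ?thesis
      using coset_eq_iff[OF H, of "r \<odot>\<^bsub>M\<^esub> y" "r \<odot>\<^bsub>M\<^esub> x"] submoduleD(4)[OF H] assms y by simp
  qed
  then have "(\<Union>y\<in>H +>\<^bsub>M\<^esub> x. H +>\<^bsub>M\<^esub> (r \<odot>\<^bsub>M\<^esub> y)) = H +>\<^bsub>M\<^esub> (r \<odot>\<^bsub>M\<^esub> x)"
    by (intro UN_constant_eq[OF coset_self[OF H assms(3)]]) simp
  then show ?thesis by (simp add: quot_mod_def)
qed

lemma quot_mod_module:
  assumes "submodule H R M"
  shows "module R (quot_mod M H)"
  by (rule module_image[OF module_axioms quot_mod_carrier])
    (simp_all add: quot_mod_add[OF assms] quot_mod_smult[OF assms] coset_zero[OF assms])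

lemma quot_mod_proj_hom:
  assumes "submodule H R M"
  shows "(\<lambda>x. H +>\<^bsub>M\<^esub> x) \<in> mod_hom R M (quot_mod M H)"
  by (rule mod_homI) (auto simp: quot_mod_add[OF assms] quot_mod_smult[OF assms] quot_mod_carrier)

lemma quot_mod_lift:
  assumes H: "submodule H R M" and N: "module R N" and f: "f \<in> mod_hom R M N"
    and 0: "\<And>x. x \<in> H \<Longrightarrow> f x = \<zero>\<^bsub>N\<^esub>"
  obtains g where "g \<in> mod_hom R (quot_mod M H) N" "\<And>x. x \<in> carrier M \<Longrightarrow> g (H +>\<^bsub>M\<^esub> x) = f x"
proof -
  interpret N: module R N by fact
  \<comment> \<open>Any choice of representative will do, as \<open>f\<close> is constant on cosets.\<close>
  define g where "g X = f (SOME x. x \<in> X)" for X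
  have g: "g (H +>\<^bsub>M\<^esub> x) = f x" if x: "x \<in> carrier M" for x
  proof -
    define y where "y = (SOME y. y \<in> H +>\<^bsub>M\<^esub> x)"
    have "y \<in> H +>\<^bsub>M\<^esub> x" unfolding y_def using coset_self[OF H x] by (rule someI)
    note y = coset_memD[OF H x this]
    have "f y \<ominus>\<^bsub>N\<^esub> f x = \<zero>\<^bsub>N\<^esub>"
      using mod_hom_minus[OF module_axioms N f y(1) x] 0 y by simp
    then show ?thesis
      using N.eq_if_minus_eq_zero mod_hom_closed[OF f] x y(1) by (simp add: g_def flip: y_def)
  qed
  have "g \<in> mod_hom R (quot_mod M H) N"
    using g mod_hom_closed[OF f] mod_hom_add[OF f] mod_hom_smult[OF f]
    by (intro mod_homI) (auto simp: quot_mod_carrier quot_mod_add[OF H] quot_mod_smult[OF H])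
  with g show ?thesis using that by blast
qed

end

text \<open>The module structure transported along an injection \<open>h\<close> of the carrier into another type.\<close>

definition copy_mod :: "('b \<Rightarrow> 'c) \<Rightarrow> ('a, 'b, 'm) module_scheme \<Rightarrow> ('a, 'c) module" where
  "copy_mod h M = \<lparr>carrier = h ` carrier M, mult = undefined, one = undefined, zero = h \<zero>\<^bsub>M\<^esub>,
     add = (\<lambda>x y. h (inv_into (carrier M) h x \<oplus>\<^bsub>M\<^esub> inv_into (carrier M) h y)),
     smult = (\<lambda>r x. h (r \<odot>\<^bsub>M\<^esub> inv_into (carrier M) h x))\<rparr>"

lemma copy_mod:
  assumes M: "module R M" and h: "inj_on h (carrier M)"
  shows "module R (copy_mod h M)" "h \<in> mod_iso R M (copy_mod h M)"
    "inv_into (carrier M) h \<in> mod_hom R (copy_mod h M) M"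
proof -
  interpret M: module R M by fact
  show hom: "h \<in> mod_iso R M (copy_mod h M)"
    using h by (auto simp: mod_iso_def mod_hom_def copy_mod_def bij_betw_def)
  show "module R (copy_mod h M)"
    by (rule module_image[OF M, where q = h]) (use h in \<open>auto simp: copy_mod_def\<close>)
  show "inv_into (carrier M) h \<in> mod_hom R (copy_mod h M) M"
    by (rule mod_homI) (use h in \<open>auto simp: copy_mod_def\<close>)
qed

section \<open>GV-ideals\<close>

context cring
begin

lemma dense_ideal_iff:
  "dense_ideal R I \<longleftrightarrow> ideal I R \<and> (\<forall>r\<in>carrier R. (\<forall>a\<in>I. a \<otimes> r = \<zero>) \<longrightarrow> r = \<zero>)"
  by (auto simp: dense_ideal_def ideal.Icarr)

lemma dense_ideal_cancel:
  assumes "dense_ideal R J" "r \<in> carrier R" "s \<in> carrier R" "\<And>a. a \<in> J \<Longrightarrow> r \<otimes> a = s \<otimes> a"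
  shows "r = s"
proof -
  interpret ideal J R using assms(1) by (simp add: dense_ideal_iff)
  have "a \<otimes> (r \<ominus> s) = \<zero>" if "a \<in> J" for a
    using that assms(2,3) assms(4)[OF that] Icarr[OF that]
    by (simp add: minus_eq r_distr r_minus m_comm[of a] r_neg)
  then have "r \<ominus> s = \<zero>" using assms(1-3) by (simp add: dense_ideal_iff)
  then show ?thesis
    by (intro module.eq_if_minus_eq_zero[OF self_mod_module, of r s])
      (simp_all add: self_mod_minus assms)
qed

lemma dense_ideal_mono: "dense_ideal R J \<Longrightarrow> ideal I R \<Longrightarrow> J \<subseteq> I \<Longrightarrow> dense_ideal R I"
  by (auto simp: dense_ideal_iff)

lemma Q_ideals_iff: "I \<in> Q_ideals R \<longleftrightarrow> fg_ideal R I \<and> dense_ideal R I"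
  unfolding Q_ideals_def semi_regular_ideal_def
  by (auto intro: dense_ideal_mono simp: dense_ideal_iff)

lemma Q_idealsD:
  assumes "I \<in> Q_ideals R"
  shows "fg_ideal R I" "dense_ideal R I" "ideal I R" "I \<subseteq> carrier R"
  using assms by (auto simp: Q_ideals_iff fg_ideal_def ideal.Icarr)

text \<open>Injectivity of \<open>R \<rightarrow> Hom(J, R)\<close> is density of \<open>J\<close>, and surjectivity says that every homomorphism
  \<open>J \<rightarrow> R\<close> is a multiplication.\<close>

lemma GV_iff:
  "J \<in> GV R \<longleftrightarrow> fg_ideal R J \<and> dense_ideal R J \<and>
     (\<forall>g\<in>mod_hom R (ideal_mod R J) (self_mod R). \<exists>r\<in>carrier R. \<forall>x\<in>J. g x = r \<otimes> x)"
proof (cases "fg_ideal R J")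
  case True
  then interpret J: ideal J R by (simp add: fg_ideal_def)
  define h where "h = (\<lambda>r\<in>carrier R. \<lambda>x\<in>J. r \<otimes> x)"
  have h: "h r x = r \<otimes> x" if "r \<in> carrier R" "x \<in> J" for r x
    using that by (simp add: h_def)
  have hom: "h \<in> mod_hom R (self_mod R) (hom_mod R (ideal_mod R J) (self_mod R))"
    by (rule mod_homI)
      (auto simp: h_def hom_mod_def mod_hom_def J.Icarr J.I_l_closed r_distr l_distr m_ac fun_eq_iff)
  have target: "f \<in> carrier (hom_mod R (ideal_mod R J) (self_mod R)) \<longleftrightarrow>
      f \<in> mod_hom R (ideal_mod R J) (self_mod R) \<and> f \<in> extensional J" for f
    by (simp add: hom_mod_def)
  have inj: "inj_on h (carrier R) \<longleftrightarrow> dense_ideal R J"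
  proof
    assume inj: "inj_on h (carrier R)"
    have "r = \<zero>" if "r \<in> carrier R" "\<forall>a\<in>J. a \<otimes> r = \<zero>" for r
    proof (rule inj_onD[OF inj])
      show "h r = h \<zero>" using that by (auto simp: h_def J.Icarr m_comm intro!: restrict_ext)
    qed (use that in auto)
    then show "dense_ideal R J" by (simp add: dense_ideal_iff J.is_ideal)
  next
    assume d: "dense_ideal R J"
    show "inj_on h (carrier R)"
    proof (rule inj_onI)
      fix r s assume rs: "r \<in> carrier R" "s \<in> carrier R" "h r = h s"
      show "r = s"
        by (rule dense_ideal_cancel[OF d rs(1,2)]) (use rs h in metis)
    qed
  qed
  have surj: "carrier (hom_mod R (ideal_mod R J) (self_mod R)) \<subseteq> h ` carrier R \<longleftrightarrow>
      (\<forall>g\<in>mod_hom R (ideal_mod R J) (self_mod R). \<exists>r\<in>carrier R. \<forall>x\<in>J. g x = r \<otimes> x)"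
  proof (intro iffI ballI subsetI)
    fix g assume sub: "carrier (hom_mod R (ideal_mod R J) (self_mod R)) \<subseteq> h ` carrier R"
      and "g \<in> mod_hom R (ideal_mod R J) (self_mod R)"
    then have "restrict g J \<in> carrier (hom_mod R (ideal_mod R J) (self_mod R))"
      by (auto simp: target mod_hom_def J.I_l_closed)
    then obtain r where "r \<in> carrier R" "restrict g J = h r" using sub by auto
    then show "\<exists>r\<in>carrier R. \<forall>x\<in>J. g x = r \<otimes> x" using h by (metis restrict_apply')
  next
    fix f assume *: "\<forall>g\<in>mod_hom R (ideal_mod R J) (self_mod R). \<exists>r\<in>carrier R. \<forall>x\<in>J. g x = r \<otimes> x"
      and f: "f \<in> carrier (hom_mod R (ideal_mod R J) (self_mod R))"
    then obtain r where r: "r \<in> carrier R" "\<forall>x\<in>J. f x = r \<otimes> x" unfolding target by blast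
    have "f = h r"
      by (rule extensionalityI[of f J]) (use f r in \<open>auto simp: target h_def\<close>)
    then show "f \<in> h ` carrier R" using r by blast
  qed
  have "J \<in> GV R \<longleftrightarrow> bij_betw h (carrier R) (carrier (hom_mod R (ideal_mod R J) (self_mod R)))"
    using True hom by (simp add: GV_def mod_iso_def h_def)
  also have "\<dots> \<longleftrightarrow> inj_on h (carrier R) \<and>
      carrier (hom_mod R (ideal_mod R J) (self_mod R)) \<subseteq> h ` carrier R"
    using mod_hom_closed[OF hom] by (auto simp: bij_betw_def)
  finally show ?thesis using True inj surj by simp
qed (simp add: GV_def)

lemma GV_D:
  assumes "J \<in> GV R"
  shows "fg_ideal R J" "dense_ideal R J" "ideal J R" "J \<subseteq> carrier R" "J \<in> Q_ideals R"
  using assms by (auto simp: GV_iff fg_ideal_def ideal.Icarr Q_ideals_iff)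

lemma GV_extend:
  assumes "J \<in> GV R" "g \<in> mod_hom R (ideal_mod R J) (self_mod R)"
  shows "\<exists>r\<in>carrier R. \<forall>x\<in>J. g x = r \<otimes> x"
  using assms by (auto simp: GV_iff)

lemma carrier_GV: "carrier R \<in> GV R"
  unfolding GV_iff dense_ideal_iff
proof (intro conjI ballI impI)
  show "fg_ideal R (carrier R)"
    unfolding fg_ideal_def using genideal_one oneideal
    by (intro conjI exI[of _ "{\<one>}"]) auto
next
  fix g assume g: "g \<in> mod_hom R (ideal_mod R (carrier R)) (self_mod R)"
  have g1: "g \<one> \<in> carrier R" using mod_hom_closed[OF g, of \<one>] by simp
  have "g x = g \<one> \<otimes> x" if "x \<in> carrier R" for x
    using mod_hom_smult[OF g, of x \<one>] g1 that by (simp add: m_comm)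
  with g1 show "\<exists>r\<in>carrier R. \<forall>x\<in>carrier R. g x = r \<otimes> x" by blast
qed (auto simp: oneideal dest: bspec[of _ _ \<one>])

lemma colon_ideal:
  assumes "ideal K R" "A \<subseteq> carrier R"
  shows "ideal {r \<in> carrier R. \<forall>a\<in>A. a \<otimes> r \<in> K} R"
proof -
  interpret ideal K R by fact
  show ?thesis
  proof (rule ideal_closedI)
    fix r x assume "r \<in> carrier R" "x \<in> {r \<in> carrier R. \<forall>a\<in>A. a \<otimes> r \<in> K}"
    then show "r \<otimes> x \<in> {r \<in> carrier R. \<forall>a\<in>A. a \<otimes> r \<in> K}"
      using assms(2) by (auto simp: m_lcomm[of _ r] I_l_closed subset_iff)
  qed (use assms(2) in \<open>auto simp: r_distr subset_iff\<close>)
qed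

text \<open>Divide out one factor at a time: \<open>{r. \<forall>x\<in>X. x \<otimes> r \<in> K}\<close> is an ideal containing \<open>Y\<close>, hence \<open>Idl Y\<close>,
  and then the same argument applies with the roles exchanged.\<close>

lemma ideal_prod_subset:
  assumes K: "ideal K R" and "X \<subseteq> carrier R" "Y \<subseteq> carrier R"
    and XY: "\<And>x y. x \<in> X \<Longrightarrow> y \<in> Y \<Longrightarrow> x \<otimes> y \<in> K"
  shows "(Idl X) \<cdot> (Idl Y) \<subseteq> K"
proof -
  interpret K: ideal K R by fact
  have "Idl Y \<subseteq> {r \<in> carrier R. \<forall>x\<in>X. x \<otimes> r \<in> K}"
    by (rule genideal_minimal[OF colon_ideal[OF K assms(2)]]) (use assms in auto)
  then have Y: "\<And>x y. x \<in> X \<Longrightarrow> y \<in> Idl Y \<Longrightarrow> y \<in> carrier R \<and> y \<otimes> x \<in> K"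
    using assms(2) m_comm by (auto simp: subset_iff)
  have "Idl Y \<subseteq> carrier R" using ideal.Icarr[OF genideal_ideal[OF assms(3)]] by blast
  then have "Idl X \<subseteq> {r \<in> carrier R. \<forall>y\<in>Idl Y. y \<otimes> r \<in> K}"
    by (intro genideal_minimal[OF colon_ideal[OF K]]) (use Y assms(2) in auto)
  then have XY: "x \<in> Idl X \<Longrightarrow> y \<in> Idl Y \<Longrightarrow> x \<otimes> y \<in> K" for x y
    using \<open>Idl Y \<subseteq> carrier R\<close> m_comm[of x y] by (auto simp: subset_iff)
  show ?thesis
  proof
    fix z assume "z \<in> (Idl X) \<cdot> (Idl Y)"
    then show "z \<in> K" by induction (auto intro: XY)
  qed
qed

lemma fg_ideal_prod:
  assumes "fg_ideal R I" "fg_ideal R J"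
  shows "fg_ideal R (I \<cdot> J)"
proof -
  obtain X Y where X: "finite X" "X \<subseteq> carrier R" "I = Idl X"
    and Y: "finite Y" "Y \<subseteq> carrier R" "J = Idl Y"
    using assms by (auto simp: fg_ideal_def)
  define Z where "Z = (\<lambda>(x, y). x \<otimes> y) ` (X \<times> Y)"
  have Z: "Z \<subseteq> carrier R" using X Y by (auto simp: Z_def)
  have IJ: "ideal (I \<cdot> J) R" using assms by (simp add: fg_ideal_def ideal_prod_is_ideal)
  have "I \<cdot> J \<subseteq> Idl Z" unfolding X Y
    by (rule ideal_prod_subset[OF genideal_ideal[OF Z]])
      (use X Y genideal_self[OF Z] in \<open>auto simp: Z_def\<close>)
  moreover have "Idl Z \<subseteq> I \<cdot> J"
    by (rule genideal_minimal[OF IJ])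
      (use X Y genideal_self in \<open>auto simp: Z_def intro!: ideal_prod.prod\<close>)
  ultimately have "I \<cdot> J = Idl Z" by simp
  moreover have "finite Z" using X Y by (simp add: Z_def)
  ultimately show ?thesis using IJ Z by (auto simp: fg_ideal_def)
qed

text \<open>Let \<open>g : I J \<rightarrow> R\<close>.  For fixed \<open>a \<in> I\<close> the map \<open>b \<mapsto> g (a b)\<close> is multiplication by some \<open>\<rho> a\<close>, since
  \<open>J\<close> is a GV-ideal.  As \<open>J\<close> is dense, \<open>\<rho> a\<close> is unique and so depends linearly on \<open>a\<close>; since \<open>I\<close> is a
  GV-ideal, \<open>\<rho>\<close> is multiplication by an element, and so is \<open>g\<close>.\<close>

lemma GV_prod:
  assumes I: "I \<in> GV R" and J: "J \<in> GV R"
  shows "I \<cdot> J \<in> GV R"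
  unfolding GV_iff
proof (intro conjI ballI)
  note DI = GV_D[OF I] and DJ = GV_D[OF J]
  interpret I: ideal I R by (rule DI)
  interpret J: ideal J R by (rule DJ)
  show "fg_ideal R (I \<cdot> J)" by (rule fg_ideal_prod[OF DI(1) DJ(1)])
  show "dense_ideal R (I \<cdot> J)"
    unfolding dense_ideal_iff
  proof (intro conjI ballI impI)
    show "ideal (I \<cdot> J) R" by (rule ideal_prod_is_ideal[OF DI(3) DJ(3)])
    fix r assume r: "r \<in> carrier R" and 0: "\<forall>a\<in>I \<cdot> J. a \<otimes> r = \<zero>"
    have "b \<otimes> r = \<zero>" if b: "b \<in> J" for b
    proof -
      have "a \<otimes> (b \<otimes> r) = \<zero>" if a: "a \<in> I" for a
        using 0 a b r ideal_prod.prod[OF a b, of R] I.Icarr[OF a] J.Icarr[OF b]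
        by (metis m_assoc)
      then show ?thesis
        using DI(2) J.Icarr[OF b] r by (simp add: dense_ideal_iff)
    qed
    then show "r = \<zero>" using DJ(2) r by (simp add: dense_ideal_iff)
  qed
  fix g assume g: "g \<in> mod_hom R (ideal_mod R (I \<cdot> J)) (self_mod R)"
  note gD = mod_hom_closed[OF g, simplified] mod_hom_add[OF g, simplified]
    mod_hom_smult[OF g, simplified]
  have ab: "a \<otimes> b \<in> I \<cdot> J" if "a \<in> I" "b \<in> J" for a b
    using that by (rule ideal_prod.prod)
  have "\<exists>r\<in>carrier R. \<forall>b\<in>J. g (a \<otimes> b) = r \<otimes> b" if a: "a \<in> I" for a
  proof -
    have "(\<lambda>b. g (a \<otimes> b)) \<in> mod_hom R (ideal_mod R J) (self_mod R)"
      using I.Icarr[OF a] ab[OF a] gD J.Icarr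
      by (intro mod_homI) (auto simp: r_distr m_lcomm[of a])
    from GV_extend[OF J this] show ?thesis .
  qed
  then obtain \<rho> where \<rho>: "\<And>a. a \<in> I \<Longrightarrow> \<rho> a \<in> carrier R"
    "\<And>a b. a \<in> I \<Longrightarrow> b \<in> J \<Longrightarrow> g (a \<otimes> b) = \<rho> a \<otimes> b" by metis
  have "\<rho> \<in> mod_hom R (ideal_mod R I) (self_mod R)"
  proof (rule mod_homI; simp)
    fix x y assume xy: "x \<in> I" "y \<in> I"
    have "\<rho> (x \<oplus> y) \<otimes> b = (\<rho> x \<oplus> \<rho> y) \<otimes> b" if b: "b \<in> J" for b
      using xy b \<rho> gD(2)[OF ab[OF xy(1) b] ab[OF xy(2) b]]
      by (simp flip: \<rho>(2) add: l_distr I.Icarr J.Icarr)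
    then show "\<rho> (x \<oplus> y) = \<rho> x \<oplus> \<rho> y"
      using xy \<rho>(1) by - (rule dense_ideal_cancel[OF DJ(2)], auto)
  next
    fix r x assume rx: "r \<in> carrier R" "x \<in> I"
    have "\<rho> (r \<otimes> x) \<otimes> b = (r \<otimes> \<rho> x) \<otimes> b" if b: "b \<in> J" for b
    proof -
      have "\<rho> (r \<otimes> x) \<otimes> b = g (r \<otimes> (x \<otimes> b))"
        using \<rho>(2)[OF I.I_l_closed[OF rx(2,1)] b] rx b by (simp add: m_assoc I.Icarr J.Icarr)
      also have "\<dots> = r \<otimes> (\<rho> x \<otimes> b)"
        using gD(3)[OF rx(1) ab[OF rx(2) b]] \<rho>(2)[OF rx(2) b] by simp
      finally show ?thesis using rx b \<rho>(1) by (simp add: m_assoc J.Icarr)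
    qed
    then show "\<rho> (r \<otimes> x) = r \<otimes> \<rho> x"
      using rx \<rho>(1) I.I_l_closed[OF rx(2,1)] by - (rule dense_ideal_cancel[OF DJ(2)], auto)
  qed (rule \<rho>(1))
  then obtain r where r: "r \<in> carrier R" "\<And>x. x \<in> I \<Longrightarrow> \<rho> x = r \<otimes> x"
    using GV_extend[OF I] by blast
  have "g x = r \<otimes> x" if "x \<in> I \<cdot> J" for x
    using that
  proof induction
    case (prod i j)
    then show ?case using \<rho> r I.Icarr J.Icarr by (simp add: m_assoc)
  next
    case (sum x y)
    then show ?case
      using gD r ideal_prod_in_carrier[OF DI(3) DJ(3)] by (auto simp: r_distr subset_iff)
  qed
  then show "\<exists>r\<in>carrier R. \<forall>x\<in>I \<cdot> J. g x = r \<otimes> x" using r by blast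
qed

text \<open>If \<open>g : I \<rightarrow> R\<close> is multiplication by \<open>r\<close> on \<open>J\<close>, then \<open>a g(x) = g(a x) = x g(a) = r a x\<close> for \<open>a \<in> J\<close>
  and \<open>x \<in> I\<close>, and \<open>a\<close> can be cancelled because \<open>J\<close> is dense.\<close>

lemma GV_superset:
  assumes J: "J \<in> GV R" and I: "fg_ideal R I" "J \<subseteq> I"
  shows "I \<in> GV R"
  unfolding GV_iff
proof (intro conjI ballI)
  interpret I: ideal I R using I by (simp add: fg_ideal_def)
  show "dense_ideal R I" by (rule dense_ideal_mono[OF GV_D(2)[OF J] I.is_ideal I(2)])
  fix g assume g: "g \<in> mod_hom R (ideal_mod R I) (self_mod R)"
  then have "g \<in> mod_hom R (ideal_mod R J) (self_mod R)"
    using I(2) by (auto simp: mod_hom_def subset_iff)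
  then obtain r where r: "r \<in> carrier R" "\<And>x. x \<in> J \<Longrightarrow> g x = r \<otimes> x"
    using GV_extend[OF J] by blast
  have "g x = r \<otimes> x" if x: "x \<in> I" for x
  proof (rule dense_ideal_cancel[OF GV_D(2)[OF J]])
    fix a assume a: "a \<in> J"
    then have aI: "a \<in> I" "a \<in> carrier R" using I(2) I.Icarr by auto
    have "g x \<otimes> a = g (a \<otimes> x)"
      using mod_hom_smult[OF g] mod_hom_closed[OF g] aI x by (simp add: m_comm)
    also have "\<dots> = x \<otimes> g a"
      using mod_hom_smult[OF g, of x a] aI x I.Icarr[OF x] by (simp add: m_comm)
    finally show "g x \<otimes> a = r \<otimes> x \<otimes> a" using r a aI I.Icarr[OF x] by (simp add: m_ac)
  qed (use mod_hom_closed[OF g] x r I.Icarr in auto)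
  then show "\<exists>r\<in>carrier R. \<forall>x\<in>I. g x = r \<otimes> x" using r by blast
qed (fact I(1))

section \<open>Primes that contain no GV-ideal\<close>

definition contains_GV :: "'a set \<Rightarrow> bool" where
  "contains_GV I \<longleftrightarrow> (\<exists>J\<in>GV R. J \<subseteq> I)"

definition max_GV_free :: "'a set \<Rightarrow> bool" where
  "max_GV_free P \<longleftrightarrow> ideal P R \<and> \<not> contains_GV P \<and>
     (\<forall>K. ideal K R \<and> P \<subseteq> K \<and> \<not> contains_GV K \<longrightarrow> K = P)"

text \<open>A GV-ideal is finitely generated; if it is contained in the union of a chain of ideals, it is
  contained in one of them.  So Zorn's lemma applies.\<close>

lemma GV_free_subset_max:
  assumes I: "ideal I R" "\<not> contains_GV I"
  obtains P where "max_GV_free P" "I \<subseteq> P"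
proof -
  define \<A> where "\<A> = {K. ideal K R \<and> I \<subseteq> K \<and> \<not> contains_GV K}"
  have "\<exists>P\<in>\<A>. \<forall>K\<in>\<A>. P \<subseteq> K \<longrightarrow> K = P"
  proof (rule subset_Zorn_nonempty)
    show "\<A> \<noteq> {}" using I by (auto simp: \<A>_def)
    fix \<C> assume ne: "\<C> \<noteq> {}" and chain: "subset.chain \<A> \<C>"
    then have sub: "\<C> \<subseteq> \<A>" and total: "\<And>X Y. X \<in> \<C> \<Longrightarrow> Y \<in> \<C> \<Longrightarrow> X \<subseteq> Y \<or> Y \<subseteq> X"
      by (auto simp: subset_chain_def)
    have idl: "ideal K R" "I \<subseteq> K" "\<not> contains_GV K" if "K \<in> \<C>" for K
      using that sub by (auto simp: \<A>_def)
    obtain K\<^sub>0 where K\<^sub>0: "K\<^sub>0 \<in> \<C>" using ne by auto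
    have U: "ideal (\<Union>\<C>) R"
    proof (rule ideal_closedI)
      show "\<zero> \<in> \<Union>\<C>"
        using K\<^sub>0 additive_subgroup.zero_closed[OF ideal.axioms(1)[OF idl(1)[OF K\<^sub>0]]] by blast
      show "\<Union>\<C> \<subseteq> carrier R" by (auto intro: ideal.Icarr[OF idl(1)])
    next
      fix x y assume "x \<in> \<Union>\<C>" "y \<in> \<Union>\<C>"
      then obtain K where K: "K \<in> \<C>" "x \<in> K" "y \<in> K" using total by blast
      then show "x \<oplus> y \<in> \<Union>\<C>"
        using additive_subgroup.a_closed[OF ideal.axioms(1)[OF idl(1)[OF K(1)]]] by blast
    qed (auto intro: ideal.I_l_closed[OF idl(1)])
    have "\<not> contains_GV (\<Union>\<C>)"
    proof
      assume "contains_GV (\<Union>\<C>)"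
      then obtain J where J: "J \<in> GV R" "J \<subseteq> \<Union>\<C>" by (auto simp: contains_GV_def)
      then obtain X where X: "finite X" "X \<subseteq> carrier R" "J = Idl X"
        using GV_D(1) by (auto simp: fg_ideal_def)
      then have "X \<subseteq> \<Union>\<C>" using J genideal_self by blast
      then obtain K where "K \<in> \<C>" "X \<subseteq> K"
        using finite_subset_Union_chain[OF X(1) _ ne chain] by blast
      then show False
        using idl X genideal_minimal J(1) unfolding contains_GV_def by metis
    qed
    then show "\<Union>\<C> \<in> \<A>" using U K\<^sub>0 idl by (auto simp: \<A>_def)
  qed
  then obtain P where "P \<in> \<A>" "\<forall>K\<in>\<A>. P \<subseteq> K \<longrightarrow> K = P" by blast
  then show ?thesis using that[of P] by (auto simp: \<A>_def max_GV_free_def)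
qed

text \<open>If \<open>a b \<in> P\<close> with \<open>a, b \<notin> P\<close>, then \<open>P + (a)\<close> and \<open>P + (b)\<close> contain GV-ideals, whose product is a
  GV-ideal inside \<open>P\<close>.\<close>

lemma max_GV_free_prime:
  assumes P: "max_GV_free P"
  shows "primeideal P R"
proof (rule primeidealI)
  show idl: "ideal P R" using P by (simp add: max_GV_free_def)
  interpret P: ideal P R by (rule idl)
  show "cring R" by (rule is_cring)
  show "carrier R \<noteq> P" using P carrier_GV by (auto simp: max_GV_free_def contains_GV_def)
  have extend: "\<exists>J\<in>GV R. J \<subseteq> Idl (insert a P)" if a: "a \<in> carrier R" "a \<notin> P" for a
  proof -
    have aP: "insert a P \<subseteq> carrier R" using a P.a_subset by auto
    have "P \<subseteq> Idl (insert a P)" "a \<in> Idl (insert a P)" using genideal_self[OF aP] by auto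
    then show ?thesis
      using P genideal_ideal[OF aP] a unfolding max_GV_free_def contains_GV_def by metis
  qed
  fix a b assume ab: "a \<in> carrier R" "b \<in> carrier R" "a \<otimes> b \<in> P"
  show "a \<in> P \<or> b \<in> P"
  proof (rule ccontr)
    assume "\<not> (a \<in> P \<or> b \<in> P)"
    then obtain I J where I: "I \<in> GV R" "I \<subseteq> Idl (insert a P)"
      and J: "J \<in> GV R" "J \<subseteq> Idl (insert b P)" using extend ab by metis
    have "I \<cdot> J \<subseteq> (Idl (insert a P)) \<cdot> (Idl (insert b P))"
    proof
      fix z assume "z \<in> I \<cdot> J"
      then show "z \<in> (Idl (insert a P)) \<cdot> (Idl (insert b P))"
        by induction (use I J in \<open>auto intro: ideal_prod.intros\<close>)
    qed
    also have "\<dots> \<subseteq> P"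
      by (rule ideal_prod_subset[OF idl])
        (use ab P.a_subset in \<open>auto intro: P.I_l_closed P.I_r_closed\<close>)
    finally show False using GV_prod[OF I(1) J(1)] P by (auto simp: max_GV_free_def contains_GV_def)
  qed
qed

lemma max_GV_freeD:
  assumes "max_GV_free P"
  shows "primeideal P R" "ideal P R" "\<And>J. J \<in> GV R \<Longrightarrow> \<not> J \<subseteq> P"
  using max_GV_free_prime[OF assms] assms by (auto simp: max_GV_free_def contains_GV_def)

lemma Idl_insert_subset:
  assumes N: "ideal N R" and y: "y \<in> carrier R" and x: "x \<in> Idl (insert y N)"
  obtains n r where "n \<in> N" "r \<in> carrier R" "x = n \<oplus> r \<otimes> y"
proof -
  interpret N: ideal N R by fact
  define T where "T = {n \<oplus> r \<otimes> y | n r. n \<in> N \<and> r \<in> carrier R}"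
  have TI: "n \<oplus> r \<otimes> y \<in> T" if "n \<in> N" "r \<in> carrier R" for n r using that by (auto simp: T_def)
  have "ideal T R"
  proof (rule ideal_closedI)
    show "T \<subseteq> carrier R" using y by (auto simp: T_def N.Icarr)
    show "\<zero> \<in> T" using TI[of \<zero> \<zero>] y by simp
  next
    fix u v assume "u \<in> T" "v \<in> T"
    then obtain n r m s where *: "u = n \<oplus> r \<otimes> y" "v = m \<oplus> s \<otimes> y" "n \<in> N" "m \<in> N"
      "r \<in> carrier R" "s \<in> carrier R" by (auto simp: T_def)
    then have "u \<oplus> v = (n \<oplus> m) \<oplus> (r \<oplus> s) \<otimes> y"
      using y by (simp add: N.Icarr l_distr a_ac)
    then show "u \<oplus> v \<in> T" using * by (auto intro: TI)
  next
    fix c u assume "c \<in> carrier R" "u \<in> T"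
    then obtain n r where *: "c \<in> carrier R" "u = n \<oplus> r \<otimes> y" "n \<in> N" "r \<in> carrier R"
      by (auto simp: T_def)
    then have "c \<otimes> u = (c \<otimes> n) \<oplus> (c \<otimes> r) \<otimes> y" using y by (simp add: N.Icarr r_distr m_assoc)
    then show "c \<otimes> u \<in> T" using * by (auto intro: TI N.I_l_closed)
  qed
  moreover have "insert y N \<subseteq> T"
    using TI[of \<zero> \<one>] TI[of _ \<zero>] y by (auto simp: N.Icarr)
  ultimately have "x \<in> T" using genideal_minimal x by blast
  then show ?thesis using that by (auto simp: T_def)
qed

text \<open>Nakayama's lemma at the prime \<open>P\<close>, in terms of elements of \<open>R\<close> only: if the module \<open>(N + (X)) / N\<close>
  is, locally at \<open>P\<close>, equal to \<open>P\<close> times itself, then it is locally zero.  The induction removes one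
  generator \<open>y\<close> from \<open>X\<close> and adjoins it to \<open>N\<close>.  The induction hypothesis gives \<open>c \<notin> P\<close> with
  \<open>c X \<subseteq> N + (y)\<close>.  Multiplying the relation for \<open>y\<close> by \<open>c\<close> turns it into \<open>c s y \<in> N + P y\<close>, that is
  \<open>(c s - p) y \<in> N\<close> with \<open>p \<in> P\<close>; and \<open>d = c s - p\<close> is not in \<open>P\<close>.\<close>

lemma prime_nakayama:
  assumes P: "primeideal P R" and "finite X" "X \<subseteq> carrier R" "ideal N R"
    and "\<And>x. x \<in> X \<Longrightarrow>
      \<exists>s\<in>carrier R - P. s \<otimes> x \<in> Idl (N \<union> {p \<otimes> z | p z. p \<in> P \<and> z \<in> X})"
  shows "\<exists>s\<in>carrier R - P. \<forall>x\<in>X. s \<otimes> x \<in> N"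
  using assms(2-)
proof (induction X arbitrary: N rule: finite_induct)
  case empty
  interpret P: primeideal P R by fact
  have "\<one> \<notin> P" using P.I_notcarr P.one_imp_carrier by blast
  then show ?case by auto
next
  case (insert y X)
  interpret P: primeideal P R by fact
  interpret N: ideal N R by fact
  have y: "y \<in> carrier R" and X: "X \<subseteq> carrier R" using insert.prems by auto
  define N' where "N' = Idl (insert y N)"
  have yN: "insert y N \<subseteq> carrier R" using y N.a_subset by auto
  interpret N': ideal N' R unfolding N'_def by (rule genideal_ideal[OF yN])
  have N': "N \<subseteq> N'" "y \<in> N'" using genideal_self[OF yN] by (auto simp: N'_def)
  have "\<exists>s\<in>carrier R - P. \<forall>x\<in>X. s \<otimes> x \<in> N'"
  proof (rule insert.IH[OF X N'.is_ideal])
    fix x assume "x \<in> X"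
    then obtain s where s: "s \<in> carrier R - P"
      "s \<otimes> x \<in> Idl (N \<union> {p \<otimes> z |p z. p \<in> P \<and> z \<in> insert y X})"
      using insert.prems(3)[of x] by auto
    have sub: "N' \<union> {p \<otimes> z |p z. p \<in> P \<and> z \<in> X} \<subseteq> carrier R"
      using X by (auto simp: N'.Icarr P.Icarr subset_iff)
    let ?G = "Idl (N' \<union> {p \<otimes> z |p z. p \<in> P \<and> z \<in> X})"
    have G: "N' \<union> {p \<otimes> z |p z. p \<in> P \<and> z \<in> X} \<subseteq> ?G" by (rule genideal_self[OF sub])
    have "Idl (N \<union> {p \<otimes> z |p z. p \<in> P \<and> z \<in> insert y X}) \<subseteq> ?G"
    proof (rule genideal_minimal[OF genideal_ideal[OF sub]])
      have "p \<otimes> y \<in> ?G" if "p \<in> P" for p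
        using G N'(2) ideal.I_l_closed[OF genideal_ideal[OF sub], of y p] P.Icarr[OF that] by blast
      then show "N \<union> {p \<otimes> z |p z. p \<in> P \<and> z \<in> insert y X} \<subseteq> ?G"
        using G N'(1) by blast
    qed
    then show "\<exists>s\<in>carrier R - P. s \<otimes> x \<in> ?G" using s by blast
  qed
  then obtain c where c: "c \<in> carrier R" "c \<notin> P" "\<And>x. x \<in> X \<Longrightarrow> c \<otimes> x \<in> N'" by auto
  \<comment> \<open>The elements which \<open>c\<close> multiplies into \<open>N + P y\<close>; they include all the generators above.\<close>
  define T where "T = {g \<in> carrier R. \<exists>n\<in>N. \<exists>p\<in>P. c \<otimes> g = n \<oplus> p \<otimes> y}"
  have TI: "g \<in> T" if "g \<in> carrier R" "n \<in> N" "p \<in> P" "c \<otimes> g = n \<oplus> p \<otimes> y" for g n p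
    using that by (auto simp: T_def)
  have T: "ideal T R"
  proof (rule ideal_closedI)
    show "\<zero> \<in> T" using c y by (auto simp: T_def intro!: bexI[of _ \<zero>])
  next
    fix u v assume "u \<in> T" "v \<in> T"
    then obtain n m p q where *: "u \<in> carrier R" "v \<in> carrier R" "n \<in> N" "m \<in> N" "p \<in> P" "q \<in> P"
      "c \<otimes> u = n \<oplus> p \<otimes> y" "c \<otimes> v = m \<oplus> q \<otimes> y" by (auto simp: T_def)
    then have "c \<otimes> (u \<oplus> v) = (n \<oplus> m) \<oplus> (p \<oplus> q) \<otimes> y"
      using y c by (simp add: N.Icarr P.Icarr l_distr r_distr a_ac)
    then show "u \<oplus> v \<in> T" using * by (auto simp: T_def)
  next
    fix r u assume r: "r \<in> carrier R" and "u \<in> T"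
    then obtain n p where *: "u \<in> carrier R" "n \<in> N" "p \<in> P" "c \<otimes> u = n \<oplus> p \<otimes> y"
      by (auto simp: T_def)
    then have "c \<otimes> (r \<otimes> u) = (r \<otimes> n) \<oplus> (r \<otimes> p) \<otimes> y"
      using y c r by (simp add: N.Icarr P.Icarr r_distr m_assoc m_lcomm[of c r])
    then show "r \<otimes> u \<in> T" using * r by (auto simp: T_def intro!: N.I_l_closed P.I_l_closed)
  qed (auto simp: T_def)
  have "N \<union> {p \<otimes> z |p z. p \<in> P \<and> z \<in> insert y X} \<subseteq> T"
  proof -
    have "n \<in> T" if n: "n \<in> N" for n
      by (rule TI[of n "c \<otimes> n" \<zero>]) (use n c y N.Icarr[OF n] N.I_l_closed[OF n c(1)] in auto)
    moreover have "p \<otimes> y \<in> T" if p: "p \<in> P" for p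
      by (rule TI[of _ \<zero> "c \<otimes> p"])
        (use p c y P.Icarr[OF p] P.I_l_closed[OF p c(1)] in \<open>auto simp: m_assoc\<close>)
    moreover have "p \<otimes> z \<in> T" if p: "p \<in> P" and z: "z \<in> X" for p z
    proof -
      obtain n r where nr: "n \<in> N" "r \<in> carrier R" "c \<otimes> z = n \<oplus> r \<otimes> y"
        using Idl_insert_subset[OF N.is_ideal y] c(3)[OF z] unfolding N'_def by metis
      have zR: "z \<in> carrier R" using z X by auto
      have "c \<otimes> (p \<otimes> z) = p \<otimes> (c \<otimes> z)" using c(1) P.Icarr[OF p] zR by (simp add: m_lcomm)
      also have "\<dots> = p \<otimes> n \<oplus> (p \<otimes> r) \<otimes> y"
        using nr P.Icarr[OF p] N.Icarr y by (simp add: r_distr m_assoc)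
      finally show ?thesis
        using nr p zR P.Icarr[OF p] N.I_l_closed[of n p] P.I_r_closed[of p r] by (auto simp: T_def)
    qed
    ultimately show ?thesis by auto
  qed
  then have "Idl (N \<union> {p \<otimes> z |p z. p \<in> P \<and> z \<in> insert y X}) \<subseteq> T" by (rule genideal_minimal[OF T])
  then obtain s where s: "s \<in> carrier R" "s \<notin> P" "s \<otimes> y \<in> T" using insert.prems(3)[of y] by auto
  then obtain n p where np: "n \<in> N" "p \<in> P" "c \<otimes> (s \<otimes> y) = n \<oplus> p \<otimes> y" by (auto simp: T_def)
  define d where "d = c \<otimes> s \<ominus> p"
  have d: "d \<in> carrier R" using c s np P.Icarr by (simp add: d_def)
  have "c \<otimes> s = d \<oplus> p"
    using c s np P.Icarr by (simp add: d_def minus_eq a_assoc l_neg)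
  then have "d \<notin> P" using P.I_prime[of c s] c s np P.a_closed by metis
  have dy: "d \<otimes> y \<in> N"
  proof -
    have "d \<otimes> y = c \<otimes> (s \<otimes> y) \<ominus> p \<otimes> y"
      using c s np P.Icarr y by (simp add: d_def minus_eq l_distr l_minus m_assoc)
    also have "\<dots> = n"
      unfolding np(3) using np P.Icarr N.Icarr y by (simp add: minus_eq a_assoc r_neg)
    finally show ?thesis using np by simp
  qed
  have dN': "d \<otimes> x \<in> N" if x: "x \<in> N'" for x
  proof -
    obtain m r where mr: "m \<in> N" "r \<in> carrier R" "x = m \<oplus> r \<otimes> y"
      using Idl_insert_subset[OF N.is_ideal y] x unfolding N'_def by metis
    then have "d \<otimes> x = d \<otimes> m \<oplus> r \<otimes> (d \<otimes> y)"
      using d y N.Icarr by (simp add: r_distr m_lcomm)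
    then show ?thesis using mr dy d N.I_l_closed by auto
  qed
  have "d \<otimes> c \<in> carrier R - P" using \<open>d \<notin> P\<close> c d P.I_prime by blast
  moreover have "d \<otimes> c \<otimes> x \<in> N" if "x \<in> X" for x
    using dN'[OF c(3)[OF that]] that X c d by (auto simp: m_assoc)
  moreover have "d \<otimes> c \<otimes> y \<in> N"
    using N.I_l_closed[OF dy c(1)] c d y by (simp add: m_assoc m_lcomm)
  ultimately show ?case by (intro bexI[of _ "d \<otimes> c"]) auto
qed

text \<open>Otherwise \<open>I\<close> is contained in some \<open>P\<close>, and Nakayama's lemma, applied to the finitely many
  generators of \<open>I\<close> with \<open>N = 0\<close>, yields \<open>s \<notin> P\<close> with \<open>s I = 0\<close>.  This contradicts density.\<close>

lemma GV_if_locally_idempotent: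
  assumes I: "I \<in> Q_ideals R"
    and loc: "\<And>P a. max_GV_free P \<Longrightarrow> I \<subseteq> P \<Longrightarrow> a \<in> I \<Longrightarrow> \<exists>s\<in>carrier R - P. s \<otimes> a \<in> I \<cdot> I"
  shows "I \<in> GV R"
proof (rule ccontr)
  note D = Q_idealsD[OF I]
  interpret I: ideal I R by (rule D)
  assume "I \<notin> GV R"
  then have "\<not> contains_GV I" using GV_superset[OF _ D(1)] by (auto simp: contains_GV_def)
  then obtain P where P: "max_GV_free P" "I \<subseteq> P" using GV_free_subset_max[OF D(3)] by metis
  interpret P: primeideal P R by (rule max_GV_free_prime[OF P(1)])
  obtain X where X: "finite X" "X \<subseteq> carrier R" "I = Idl X" using D(1) by (auto simp: fg_ideal_def)
  have XI: "X \<subseteq> I" using X genideal_self by simp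
  let ?G = "{\<zero>} \<union> {p \<otimes> z |p z. p \<in> P \<and> z \<in> X}"
  have G: "?G \<subseteq> carrier R" using X by (auto simp: P.Icarr subset_iff)
  have "I \<cdot> I \<subseteq> Idl ?G"
    unfolding X(3)
    by (rule ideal_prod_subset[OF genideal_ideal[OF G] X(2) X(2)])
      (use genideal_self[OF G] XI P(2) in blast)
  then have "\<exists>s\<in>carrier R - P. s \<otimes> x \<in> Idl ?G" if "x \<in> X" for x
    using loc[OF P, of x] that XI by blast
  then obtain s where s: "s \<in> carrier R" "s \<notin> P" "\<And>x. x \<in> X \<Longrightarrow> s \<otimes> x = \<zero>"
    using prime_nakayama[OF P.primeideal X(1,2) zeroideal] by auto
  have "I \<subseteq> {r \<in> carrier R. \<forall>a\<in>{s}. a \<otimes> r \<in> {\<zero>}}"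
    unfolding X(3) by (rule genideal_minimal[OF colon_ideal[OF zeroideal]]) (use s X in auto)
  then have "\<forall>a\<in>I. a \<otimes> s = \<zero>" using s(1) by (auto simp: m_comm)
  then have "s = \<zero>" using D(2) s(1) by (simp add: dense_ideal_iff)
  then show False using s(2) by simp
qed

end

section \<open>Free modules and tensor products\<close>

lemma mod_hom_cong:
  "module R M \<Longrightarrow> f \<in> mod_hom R M N \<Longrightarrow> (\<And>x. x \<in> carrier M \<Longrightarrow> g x = f x) \<Longrightarrow> g \<in> mod_hom R M N"
  by (intro mod_homI)
    (simp_all add: mod_hom_closed mod_hom_add mod_hom_smult module.smult_closed
      abelian_monoid.a_closed[OF abelian_group.axioms(1)[OF module.axioms(2)]])

lemma submodule_equalizer:
  assumes "module R M" "module R N" "f \<in> mod_hom R M N" "g \<in> mod_hom R M N"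
  shows "submodule {x \<in> carrier M. f x = g x} R M"
proof -
  interpret M: module R M by fact
  show ?thesis
    by (rule M.submodule_closedI)
      (auto simp: mod_hom_zero[OF assms(1,2)] mod_hom_add[OF assms(3)] mod_hom_add[OF assms(4)]
        mod_hom_smult[OF assms(3)] mod_hom_smult[OF assms(4)] assms)
qed

context module
begin

lemma mod_span_submodule:
  assumes "X \<subseteq> carrier M"
  shows "submodule (mod_span R M X) R M"
proof (rule submodule_closedI)
  show "mod_span R M X \<subseteq> carrier M"
    using carrier_is_submodule assms by (auto simp: mod_span_def)
qed (auto simp: mod_span_def dest: submoduleD)

lemma mod_span_superset: "X \<subseteq> mod_span R M X"
  by (auto simp: mod_span_def)

lemma mod_span_minimal: "submodule H R M \<Longrightarrow> X \<subseteq> H \<Longrightarrow> mod_span R M X \<subseteq> H"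
  by (auto simp: mod_span_def)

end

context cring
begin

lemma free_mod_carrier_iff:
  "g \<in> carrier (free_mod R X) \<longleftrightarrow>
     (\<forall>x. g x \<in> carrier R) \<and> finite {x. g x \<noteq> \<zero>} \<and> {x. g x \<noteq> \<zero>} \<subseteq> X"
  by (simp add: free_mod_def)

lemma free_mod_simps [simp]:
  "zero (free_mod R X) = (\<lambda>x. \<zero>)" "add (free_mod R X) = (\<lambda>g h x. g x \<oplus> h x)"
  "smult (free_mod R X) = (\<lambda>r g x. r \<otimes> g x)"
  by (simp_all add: free_mod_def)

lemma free_mod_module: "module R (free_mod R X)"
proof -
  let ?F = "free_mod R X"
  have supp: "g \<in> carrier ?F" if "\<And>x. g x \<in> carrier R" "finite S" "S \<subseteq> X" "\<And>x. x \<notin> S \<Longrightarrow> g x = \<zero>"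
    for g S
  proof -
    have "{x. g x \<noteq> \<zero>} \<subseteq> S" using that(4) by blast
    then show ?thesis using that by (auto simp: free_mod_carrier_iff intro: finite_subset)
  qed
  have val: "g x \<in> carrier R" if "g \<in> carrier ?F" for g x
    using that by (simp add: free_mod_carrier_iff)
  have "abelian_group ?F"
  proof (rule abelian_groupI)
    fix g h assume gh: "g \<in> carrier ?F" "h \<in> carrier ?F"
    show "g \<oplus>\<^bsub>?F\<^esub> h \<in> carrier ?F"
      by (rule supp[where S = "{x. g x \<noteq> \<zero>} \<union> {x. h x \<noteq> \<zero>}"])
        (use gh in \<open>auto simp: free_mod_carrier_iff\<close>)
    show "g \<oplus>\<^bsub>?F\<^esub> h = h \<oplus>\<^bsub>?F\<^esub> g"
      using gh by (simp add: fun_eq_iff val a_comm)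
  next
    fix g assume g: "g \<in> carrier ?F"
    have "(\<lambda>x. \<ominus> g x) \<in> carrier ?F"
      by (rule supp[where S = "{x. g x \<noteq> \<zero>}"]) (use g in \<open>auto simp: free_mod_carrier_iff\<close>)
    then show "\<exists>h\<in>carrier ?F. h \<oplus>\<^bsub>?F\<^esub> g = \<zero>\<^bsub>?F\<^esub>"
      using g by (intro bexI[of _ "\<lambda>x. \<ominus> g x"]) (simp_all add: fun_eq_iff val l_neg)
  next
    show "\<zero>\<^bsub>?F\<^esub> \<in> carrier ?F" by (simp add: free_mod_carrier_iff)
  qed (auto simp: fun_eq_iff val a_assoc)
  moreover have "r \<odot>\<^bsub>?F\<^esub> g \<in> carrier ?F" if "r \<in> carrier R" "g \<in> carrier ?F" for r g
    by (rule supp[where S = "{x. g x \<noteq> \<zero>}"]) (use that in \<open>auto simp: free_mod_carrier_iff\<close>)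
  ultimately show ?thesis
    by (intro moduleI) (auto simp: is_cring fun_eq_iff val l_distr r_distr m_assoc)
qed

lemma free_gen_closed: "x \<in> X \<Longrightarrow> free_gen R x \<in> carrier (free_mod R X)"
  by (auto simp: free_mod_carrier_iff free_gen_def)

text \<open>A free module has no proper submodule that contains the basis: an element is reduced to \<open>0\<close> by
  deleting the coordinates of its finite support one after another.\<close>

lemma free_mod_induct:
  fixes X :: "'x set"
  assumes H: "submodule H R (free_mod R X)" and gen: "\<And>x. x \<in> X \<Longrightarrow> free_gen R x \<in> H"
    and g: "g \<in> carrier (free_mod R X)"
  shows "g \<in> H"
proof -
  note HD = submoduleD[OF H, simplified]
  have "\<forall>g :: 'x \<Rightarrow> 'a. (\<forall>x. g x \<in> carrier R) \<and> {x. g x \<noteq> \<zero>} \<subseteq> S \<longrightarrow> g \<in> H" if "finite S" "S \<subseteq> X" for S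
    using that
  proof (induction S rule: finite_induct)
    case empty
    show ?case
    proof (intro allI impI)
      fix g :: "'x \<Rightarrow> 'a" assume "(\<forall>x. g x \<in> carrier R) \<and> {x. g x \<noteq> \<zero>} \<subseteq> {}"
      then have "g = (\<lambda>x. \<zero>)" by auto
      then show "g \<in> H" using HD(2) by simp
    qed
  next
    case (insert y S)
    show ?case
    proof (intro allI impI)
      fix g :: "'x \<Rightarrow> 'a" assume g: "(\<forall>x. g x \<in> carrier R) \<and> {x. g x \<noteq> \<zero>} \<subseteq> insert y S"
      have "{x. (g(y := \<zero>)) x \<noteq> \<zero>} \<subseteq> S" using g by (auto split: if_splits)
      then have "g(y := \<zero>) \<in> H"
        using insert.IH[THEN spec, of "g(y := \<zero>)"] insert.prems g by (auto simp: fun_upd_def)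
      moreover have "(\<lambda>x. g y \<otimes> free_gen R y x) \<in> H"
        using insert.prems g by (intro HD(4)[of "g y"] gen) auto
      ultimately have "(\<lambda>x. (g(y := \<zero>)) x \<oplus> g y \<otimes> free_gen R y x) \<in> H" by (rule HD(3))
      moreover have "(\<lambda>x. (g(y := \<zero>)) x \<oplus> g y \<otimes> free_gen R y x) = g"
        using g by (auto simp: free_gen_def)
      ultimately show "g \<in> H" by simp
    qed
  qed
  then show ?thesis using g unfolding free_mod_carrier_iff by blast
qed

lemma free_mod_hom_eq:
  assumes "module R N" "f \<in> mod_hom R (free_mod R X) N" "g \<in> mod_hom R (free_mod R X) N"
    and "\<And>x. x \<in> X \<Longrightarrow> f (free_gen R x) = g (free_gen R x)" and "t \<in> carrier (free_mod R X)"
  shows "f t = g t"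
proof -
  have "t \<in> {x \<in> carrier (free_mod R X). f x = g x}"
    by (rule free_mod_induct[OF submodule_equalizer[OF free_mod_module assms(1-3)] _ assms(5)])
      (simp add: assms(4) free_gen_closed)
  then show ?thesis by simp
qed

text \<open>In the definition the sum runs over the support, which varies with \<open>g\<close>; a common larger index
  set is what makes \<open>free_lift\<close> visibly linear.\<close>

lemma free_lift_superset:
  assumes N: "module R N" and \<phi>: "\<And>x. x \<in> X \<Longrightarrow> \<phi> x \<in> carrier N"
    and g: "\<And>x. g x \<in> carrier R" and S: "finite S" "S \<subseteq> X" "{x. g x \<noteq> \<zero>} \<subseteq> S"
  shows "free_lift R N \<phi> g = (\<Oplus>\<^bsub>N\<^esub>x\<in>S. g x \<odot>\<^bsub>N\<^esub> \<phi> x)"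
proof -
  interpret N: module R N by fact
  show ?thesis unfolding free_lift_def
    by (rule N.M.add.finprod_mono_neutral_cong_left[OF S(1,3)]) (use g \<phi> S in auto)
qed

lemma free_lift_hom:
  assumes N: "module R N" and \<phi>: "\<And>x. x \<in> X \<Longrightarrow> \<phi> x \<in> carrier N"
  shows "free_lift R N \<phi> \<in> mod_hom R (free_mod R X) N"
proof -
  interpret N: module R N by fact
  interpret F: module R "free_mod R X" by (rule free_mod_module)
  note sup = free_lift_superset[OF N \<phi>]
  show ?thesis
  proof (rule mod_homI)
    fix g assume g: "g \<in> carrier (free_mod R X)"
    then show "free_lift R N \<phi> g \<in> carrier N"
      unfolding free_lift_def free_mod_carrier_iff
      by (intro N.M.finsum_closed) (auto intro!: N.smult_closed \<phi>)
    fix h assume h: "h \<in> carrier (free_mod R X)"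
    define S where "S = {x. g x \<noteq> \<zero>} \<union> {x. h x \<noteq> \<zero>}"
    have S: "finite S" "S \<subseteq> X" and val: "\<And>x. g x \<in> carrier R" "\<And>x. h x \<in> carrier R"
      using g h by (auto simp: S_def free_mod_carrier_iff)
    have *: "{x. g x \<noteq> \<zero>} \<subseteq> S" "{x. h x \<noteq> \<zero>} \<subseteq> S" "{x. g x \<oplus> h x \<noteq> \<zero>} \<subseteq> S"
      by (auto simp: S_def)
    have "free_lift R N \<phi> (\<lambda>x. g x \<oplus> h x) = (\<Oplus>\<^bsub>N\<^esub>x\<in>S. (g x \<oplus> h x) \<odot>\<^bsub>N\<^esub> \<phi> x)"
      by (rule sup) (use S * val in auto)
    also have "\<dots> = (\<Oplus>\<^bsub>N\<^esub>x\<in>S. g x \<odot>\<^bsub>N\<^esub> \<phi> x \<oplus>\<^bsub>N\<^esub> h x \<odot>\<^bsub>N\<^esub> \<phi> x)"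
      using S val \<phi> by (intro N.M.finsum_cong') (auto simp: N.smult_l_distr subset_iff)
    also have "\<dots> = (\<Oplus>\<^bsub>N\<^esub>x\<in>S. g x \<odot>\<^bsub>N\<^esub> \<phi> x) \<oplus>\<^bsub>N\<^esub> (\<Oplus>\<^bsub>N\<^esub>x\<in>S. h x \<odot>\<^bsub>N\<^esub> \<phi> x)"
      using S val \<phi> by (intro N.M.finsum_addf) auto
    also have "\<dots> = free_lift R N \<phi> g \<oplus>\<^bsub>N\<^esub> free_lift R N \<phi> h"
      using sup[where g = g and S = S] sup[where g = h and S = S] S * val by simp
    finally show "free_lift R N \<phi> (g \<oplus>\<^bsub>free_mod R X\<^esub> h) = free_lift R N \<phi> g \<oplus>\<^bsub>N\<^esub> free_lift R N \<phi> h"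
      by simp
  next
    fix r g assume r: "r \<in> carrier R" and g: "g \<in> carrier (free_mod R X)"
    define S where "S = {x. g x \<noteq> \<zero>}"
    have S: "finite S" "S \<subseteq> X" and val: "\<And>x. g x \<in> carrier R"
      using g by (auto simp: S_def free_mod_carrier_iff)
    have *: "{x. r \<otimes> g x \<noteq> \<zero>} \<subseteq> S" using r by (auto simp: S_def)
    have "free_lift R N \<phi> (\<lambda>x. r \<otimes> g x) = (\<Oplus>\<^bsub>N\<^esub>x\<in>S. (r \<otimes> g x) \<odot>\<^bsub>N\<^esub> \<phi> x)"
      by (rule sup) (use r S * val in auto)
    also have "\<dots> = (\<Oplus>\<^bsub>N\<^esub>x\<in>S. r \<odot>\<^bsub>N\<^esub> (g x \<odot>\<^bsub>N\<^esub> \<phi> x))"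
      using S val \<phi> r by (intro N.M.finsum_cong') (auto simp: N.smult_assoc1 subset_iff)
    also have "\<dots> = r \<odot>\<^bsub>N\<^esub> (\<Oplus>\<^bsub>N\<^esub>x\<in>S. g x \<odot>\<^bsub>N\<^esub> \<phi> x)"
      using S val \<phi> r by (intro N.finsum_smult_ldistr[symmetric]) auto
    finally show "free_lift R N \<phi> (r \<odot>\<^bsub>free_mod R X\<^esub> g) = r \<odot>\<^bsub>N\<^esub> free_lift R N \<phi> g"
      by (simp add: free_lift_def S_def)
  qed
qed

lemma free_lift_gen:
  assumes N: "module R N" and "\<phi> x \<in> carrier N"
  shows "free_lift R N \<phi> (free_gen R x) = \<phi> x"
proof -
  interpret N: module R N by fact
  have "free_lift R N \<phi> (free_gen R x) = (\<Oplus>\<^bsub>N\<^esub>y\<in>{x}. free_gen R x y \<odot>\<^bsub>N\<^esub> \<phi> y)"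
    by (rule free_lift_superset[OF N, where X = "{x}"]) (use assms in \<open>auto simp: free_gen_def\<close>)
  then show ?thesis using assms by (simp add: free_gen_def)
qed

text \<open>The pure tensor \<open>x \<otimes> y\<close>.\<close>

definition tens ::
  "('a, 'm, 'p) module_scheme \<Rightarrow> ('a, 'n, 'q) module_scheme \<Rightarrow> 'm \<Rightarrow> 'n \<Rightarrow> ('m \<times> 'n \<Rightarrow> 'a) set" where
  "tens M N x y = tensor_rel R M N +>\<^bsub>free_mod R (carrier M \<times> carrier N)\<^esub> free_gen R (x, y)"

definition bilinear ::
  "('a, 'm, 'p) module_scheme \<Rightarrow> ('a, 'n, 'q) module_scheme \<Rightarrow> ('a, 'k, 's) module_scheme
    \<Rightarrow> ('m \<Rightarrow> 'n \<Rightarrow> 'k) \<Rightarrow> bool" where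
  "bilinear M N K \<beta> \<longleftrightarrow>
     (\<forall>x\<in>carrier M. \<beta> x \<in> mod_hom R N K) \<and> (\<forall>y\<in>carrier N. (\<lambda>x. \<beta> x y) \<in> mod_hom R M K)"

end

locale tensor_product = cring R + M: module R M + N: module R N
  for R :: "('a, 'r) ring_scheme" (structure)
    and M :: "('a, 'm, 'p) module_scheme" and N :: "('a, 'n, 'q) module_scheme"
begin

abbreviation "pairs \<equiv> free_mod R (carrier M \<times> carrier N)"

sublocale F: module R pairs by (rule free_mod_module)

abbreviation gen :: "'m \<Rightarrow> 'n \<Rightarrow> 'm \<times> 'n \<Rightarrow> 'a" where "gen x y \<equiv> free_gen R (x, y)"

lemma gen_closed: "x \<in> carrier M \<Longrightarrow> y \<in> carrier N \<Longrightarrow> gen x y \<in> carrier pairs"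
  by (simp add: free_gen_closed)

definition relators :: "('m \<times> 'n \<Rightarrow> 'a) set" where
  "relators =
      {gen (x \<oplus>\<^bsub>M\<^esub> x') y \<ominus>\<^bsub>pairs\<^esub> (gen x y \<oplus>\<^bsub>pairs\<^esub> gen x' y) | x x' y.
           x \<in> carrier M \<and> x' \<in> carrier M \<and> y \<in> carrier N} \<union>
       {gen x (y \<oplus>\<^bsub>N\<^esub> y') \<ominus>\<^bsub>pairs\<^esub> (gen x y \<oplus>\<^bsub>pairs\<^esub> gen x y') | x y y'.
           x \<in> carrier M \<and> y \<in> carrier N \<and> y' \<in> carrier N} \<union>
       {gen (r \<odot>\<^bsub>M\<^esub> x) y \<ominus>\<^bsub>pairs\<^esub> r \<odot>\<^bsub>pairs\<^esub> gen x y | r x y.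
           r \<in> carrier R \<and> x \<in> carrier M \<and> y \<in> carrier N} \<union>
       {gen x (r \<odot>\<^bsub>N\<^esub> y) \<ominus>\<^bsub>pairs\<^esub> r \<odot>\<^bsub>pairs\<^esub> gen x y | r x y.
           r \<in> carrier R \<and> x \<in> carrier M \<and> y \<in> carrier N}"

lemma tensor_rel_span: "tensor_rel R M N = mod_span R pairs relators"
  by (simp add: tensor_rel_def relators_def Let_def)

lemma relators_closed: "relators \<subseteq> carrier pairs"
  unfolding relators_def
  by (auto simp del: free_mod_simps intro!: F.M.minus_closed F.M.a_closed F.smult_closed gen_closed)

lemma tensor_rel_submodule: "submodule (tensor_rel R M N) R pairs"
  unfolding tensor_rel_span by (rule F.mod_span_submodule[OF relators_closed])

lemma tensor_module: "module R (tensor R M N)"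
  unfolding tensor_def by (rule F.quot_mod_module[OF tensor_rel_submodule])

lemma tensor_proj_hom: "(\<lambda>t. tensor_rel R M N +>\<^bsub>pairs\<^esub> t) \<in> mod_hom R pairs (tensor R M N)"
  unfolding tensor_def by (rule F.quot_mod_proj_hom[OF tensor_rel_submodule])

lemma tens_closed: "x \<in> carrier M \<Longrightarrow> y \<in> carrier N \<Longrightarrow> tens M N x y \<in> carrier (tensor R M N)"
  unfolding tens_def by (rule mod_hom_closed[OF tensor_proj_hom gen_closed])

lemma tens_eqI:
  assumes "s \<ominus>\<^bsub>pairs\<^esub> t \<in> relators" "s \<in> carrier pairs" "t \<in> carrier pairs"
  shows "tensor_rel R M N +>\<^bsub>pairs\<^esub> s = tensor_rel R M N +>\<^bsub>pairs\<^esub> t"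
  using F.coset_eq_iff[OF tensor_rel_submodule assms(2,3)] assms(1) F.mod_span_superset
  unfolding tensor_rel_span by blast

lemma bilinear_tens: "bilinear M N (tensor R M N) (tens M N)"
proof -
  note hom = mod_hom_add[OF tensor_proj_hom gen_closed gen_closed, symmetric]
    mod_hom_smult[OF tensor_proj_hom _ gen_closed, symmetric]
  have 1: "gen (x \<oplus>\<^bsub>M\<^esub> x') y \<ominus>\<^bsub>pairs\<^esub> (gen x y \<oplus>\<^bsub>pairs\<^esub> gen x' y) \<in> relators"
    if "x \<in> carrier M" "x' \<in> carrier M" "y \<in> carrier N" for x x' y
    using that unfolding relators_def by blast
  have 2: "gen x (y \<oplus>\<^bsub>N\<^esub> y') \<ominus>\<^bsub>pairs\<^esub> (gen x y \<oplus>\<^bsub>pairs\<^esub> gen x y') \<in> relators"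
    if "x \<in> carrier M" "y \<in> carrier N" "y' \<in> carrier N" for x y y'
    using that unfolding relators_def by blast
  have 3: "gen (r \<odot>\<^bsub>M\<^esub> x) y \<ominus>\<^bsub>pairs\<^esub> r \<odot>\<^bsub>pairs\<^esub> gen x y \<in> relators"
    if "r \<in> carrier R" "x \<in> carrier M" "y \<in> carrier N" for r x y
    using that unfolding relators_def by blast
  have 4: "gen x (r \<odot>\<^bsub>N\<^esub> y) \<ominus>\<^bsub>pairs\<^esub> r \<odot>\<^bsub>pairs\<^esub> gen x y \<in> relators"
    if "r \<in> carrier R" "x \<in> carrier M" "y \<in> carrier N" for r x y
    using that unfolding relators_def by blast
  have "tens M N (x \<oplus>\<^bsub>M\<^esub> x') y = tens M N x y \<oplus>\<^bsub>tensor R M N\<^esub> tens M N x' y"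
    if "x \<in> carrier M" "x' \<in> carrier M" "y \<in> carrier N" for x x' y
    unfolding tens_def hom(1)[OF that(1,3,2,3)]
    by (rule tens_eqI[OF 1[OF that]]) (intro gen_closed F.M.a_closed M.M.a_closed that)+
  moreover have "tens M N x (y \<oplus>\<^bsub>N\<^esub> y') = tens M N x y \<oplus>\<^bsub>tensor R M N\<^esub> tens M N x y'"
    if "x \<in> carrier M" "y \<in> carrier N" "y' \<in> carrier N" for x y y'
    unfolding tens_def hom(1)[OF that(1,2,1,3)]
    by (rule tens_eqI[OF 2[OF that]]) (intro gen_closed F.M.a_closed N.M.a_closed that)+
  moreover have "tens M N (r \<odot>\<^bsub>M\<^esub> x) y = r \<odot>\<^bsub>tensor R M N\<^esub> tens M N x y"
    if "r \<in> carrier R" "x \<in> carrier M" "y \<in> carrier N" for r x y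
    unfolding tens_def hom(2)[OF that]
    by (rule tens_eqI[OF 3[OF that]]) (intro gen_closed F.smult_closed M.smult_closed that)+
  moreover have "tens M N x (r \<odot>\<^bsub>N\<^esub> y) = r \<odot>\<^bsub>tensor R M N\<^esub> tens M N x y"
    if "r \<in> carrier R" "x \<in> carrier M" "y \<in> carrier N" for r x y
    unfolding tens_def hom(2)[OF that]
    by (rule tens_eqI[OF 4[OF that]]) (intro gen_closed F.smult_closed N.smult_closed that)+
  ultimately show ?thesis
    unfolding bilinear_def by (auto intro!: mod_homI tens_closed)
qed

lemma tensor_rel_kernel:
  assumes K: "module R K" and h: "h \<in> mod_hom R pairs K"
    and \<beta>: "bilinear M N K (\<lambda>x y. h (gen x y))" and t: "t \<in> tensor_rel R M N"
  shows "h t = \<zero>\<^bsub>K\<^esub>"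
proof -
  interpret K: module R K by fact
  have b: "(\<lambda>x. h (gen x y)) \<in> mod_hom R M K" if "y \<in> carrier N" for y
    using \<beta> that by (simp add: bilinear_def)
  have b': "(\<lambda>y. h (gen x y)) \<in> mod_hom R N K" if "x \<in> carrier M" for x
    using \<beta> that by (simp add: bilinear_def)
  have diff: "s \<ominus>\<^bsub>pairs\<^esub> u \<in> a_kernel pairs K h"
    if "s \<in> carrier pairs" "u \<in> carrier pairs" "h s = h u" for s u
    using that mod_hom_minus[OF F.module_axioms K h that(1,2)] mod_hom_closed[OF h]
    by (simp add: a_kernel_def' K.M.r_neg K.M.minus_eq del: free_mod_simps)
  have "relators \<subseteq> a_kernel pairs K h"
    unfolding relators_def
    by (auto simp del: free_mod_simps intro!: diff F.M.a_closed F.smult_closed gen_closed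
        simp: mod_hom_add[OF h] mod_hom_smult[OF h] gen_closed
        mod_hom_add[OF b] mod_hom_add[OF b'] mod_hom_smult[OF b] mod_hom_smult[OF b'])
  then have "tensor_rel R M N \<subseteq> a_kernel pairs K h"
    unfolding tensor_rel_span
    by (rule F.mod_span_minimal[OF submodule_kernel[OF F.module_axioms K h]])
  then show ?thesis using t by (auto simp: a_kernel_def')
qed

text \<open>The universal property of the tensor product; uniqueness is \<open>tensor_hom_eq\<close>.\<close>

lemma tensor_hom_exists:
  assumes K: "module R K" and \<beta>: "bilinear M N K \<beta>"
  obtains h where "h \<in> mod_hom R (tensor R M N) K"
    "\<And>x y. x \<in> carrier M \<Longrightarrow> y \<in> carrier N \<Longrightarrow> h (tens M N x y) = \<beta> x y"
proof -
  have \<beta>_closed: "\<beta> x y \<in> carrier K" if "x \<in> carrier M" "y \<in> carrier N" for x y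
    using \<beta> that by (auto simp: bilinear_def intro: mod_hom_closed)
  define l where "l = free_lift R K (\<lambda>(x, y). \<beta> x y)"
  have l: "l \<in> mod_hom R pairs K"
    unfolding l_def by (rule free_lift_hom[OF K]) (auto intro: \<beta>_closed)
  have lg: "l (gen x y) = \<beta> x y" if "x \<in> carrier M" "y \<in> carrier N" for x y
    unfolding l_def using free_lift_gen[OF K, of "\<lambda>(x, y). \<beta> x y" "(x, y)"] \<beta>_closed that by simp
  have "bilinear M N K (\<lambda>x y. l (gen x y))"
    using \<beta> unfolding bilinear_def
    by (auto intro: mod_hom_cong[OF N.module_axioms] mod_hom_cong[OF M.module_axioms] simp: lg)
  from F.quot_mod_lift[OF tensor_rel_submodule K l tensor_rel_kernel[OF K l this]]
  obtain h where "h \<in> mod_hom R (tensor R M N) K"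
    "\<And>t. t \<in> carrier pairs \<Longrightarrow> h (tensor_rel R M N +>\<^bsub>pairs\<^esub> t) = l t"
    unfolding tensor_def by metis
  then show ?thesis using that[of h] by (simp add: tens_def gen_closed lg)
qed

lemma tensor_hom_eq:
  assumes K: "module R K" and f: "f \<in> mod_hom R (tensor R M N) K" and g: "g \<in> mod_hom R (tensor R M N) K"
    and eq: "\<And>x y. x \<in> carrier M \<Longrightarrow> y \<in> carrier N \<Longrightarrow> f (tens M N x y) = g (tens M N x y)"
    and z: "z \<in> carrier (tensor R M N)"
  shows "f z = g z"
proof -
  obtain t where t: "t \<in> carrier pairs" "z = tensor_rel R M N +>\<^bsub>pairs\<^esub> t"
    using z unfolding tensor_def F.quot_mod_carrier by auto
  have "f (tensor_rel R M N +>\<^bsub>pairs\<^esub> t) = g (tensor_rel R M N +>\<^bsub>pairs\<^esub> t)"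
    by (rule free_mod_hom_eq[OF K mod_hom_comp[OF tensor_proj_hom f]
        mod_hom_comp[OF tensor_proj_hom g] _ t(1)])
      (use eq in \<open>auto simp: tens_def\<close>)
  then show ?thesis using t by simp
qed

end

context cring
begin

lemma tensor_productI: "module R M \<Longrightarrow> module R N \<Longrightarrow> tensor_product R M N"
  by (simp add: tensor_product_def is_cring)

text \<open>The map on free modules induced by \<open>f\<close> sends the relations of \<open>A \<otimes> M\<close> to those of \<open>B \<otimes> M\<close>, because
  \<open>(x, y) \<mapsto> f x \<otimes> y\<close> is bilinear.  Hence all terms of the union that defines \<open>tensor_map\<close> coincide.\<close>

lemma tensor_map:
  assumes A: "module R A" and B: "module R B" and M: "module R M" and f: "f \<in> mod_hom R A B"
  shows "tensor_map R A M f B \<in> mod_hom R (tensor R A M) (tensor R B M)"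
    and "x \<in> carrier A \<Longrightarrow> y \<in> carrier M \<Longrightarrow> tensor_map R A M f B (tens A M x y) = tens B M (f x) y"
proof -
  interpret A: tensor_product R A M by (rule tensor_productI[OF A M])
  interpret B: tensor_product R B M by (rule tensor_productI[OF B M])
  define l where "l = free_lift R B.pairs (\<lambda>(x, y). free_gen R (f x, y))"
  define q where "q t = tensor_rel R B M +>\<^bsub>B.pairs\<^esub> l t" for t
  have fc: "f x \<in> carrier B" if "x \<in> carrier A" for x using mod_hom_closed[OF f that] .
  have l: "l \<in> mod_hom R A.pairs B.pairs"
    unfolding l_def by (rule free_lift_hom[OF B.F.module_axioms]) (auto intro!: B.gen_closed fc)
  have lg: "l (free_gen R (x, y)) = free_gen R (f x, y)" if "x \<in> carrier A" "y \<in> carrier M" for x y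
    unfolding l_def
    using free_lift_gen[OF B.F.module_axioms, of "\<lambda>(x, y). free_gen R (f x, y)" "(x, y)"]
      B.gen_closed[OF fc] that by simp
  have q: "q \<in> mod_hom R A.pairs (tensor R B M)"
    unfolding q_def by (rule mod_hom_comp[OF l B.tensor_proj_hom])
  have qg: "q (free_gen R (x, y)) = tens B M (f x) y" if "x \<in> carrier A" "y \<in> carrier M" for x y
    using that by (simp add: q_def lg tens_def)
  have t1: "(\<lambda>y. tens B M x y) \<in> mod_hom R M (tensor R B M)" if "x \<in> carrier B" for x
    using B.bilinear_tens that by (simp add: bilinear_def)
  have t2: "(\<lambda>x. tens B M x y) \<in> mod_hom R B (tensor R B M)" if "y \<in> carrier M" for y
    using B.bilinear_tens that by (simp add: bilinear_def)
  have "bilinear A M (tensor R B M) (\<lambda>x y. q (free_gen R (x, y)))"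
    unfolding bilinear_def
    by (auto intro: mod_hom_cong[OF M t1[OF fc]] mod_hom_cong[OF A mod_hom_comp[OF f t2]] simp: qg)
  note ker = A.tensor_rel_kernel[OF B.tensor_module q this]
  from A.F.quot_mod_lift[OF A.tensor_rel_submodule B.tensor_module q ker]
  obtain h where h: "h \<in> mod_hom R (tensor R A M) (tensor R B M)"
    "\<And>t. t \<in> carrier A.pairs \<Longrightarrow> h (tensor_rel R A M +>\<^bsub>A.pairs\<^esub> t) = q t"
    unfolding tensor_def by metis
  have eq: "tensor_map R A M f B T = h T" if "T \<in> carrier (tensor R A M)" for T
  proof -
    obtain t where t: "t \<in> carrier A.pairs" "T = tensor_rel R A M +>\<^bsub>A.pairs\<^esub> t"
      using \<open>T \<in> carrier (tensor R A M)\<close> unfolding tensor_def A.F.quot_mod_carrier by auto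
    have "t \<in> T" using A.F.coset_self[OF A.tensor_rel_submodule] t by simp
    moreover have "q s = h T" if "s \<in> T" for s
      using A.F.coset_memD[OF A.tensor_rel_submodule t(1), of s] that t h(2) by metis
    ultimately have "(\<Union>s\<in>T. q s) = h T" by (intro UN_constant_eq) auto
    then show ?thesis by (simp add: tensor_map_def Let_def q_def l_def)
  qed
  show "tensor_map R A M f B \<in> mod_hom R (tensor R A M) (tensor R B M)"
    by (rule mod_hom_cong[OF A.tensor_module h(1) eq])
  assume xy: "x \<in> carrier A" "y \<in> carrier M"
  show "tensor_map R A M f B (tens A M x y) = tens B M (f x) y"
    using eq[OF A.tens_closed[OF xy]] h(2)[OF A.gen_closed[OF xy]] qg[OF xy] by (simp add: tens_def)
qed

end

section \<open>Tor and Ext in degree one\<close>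

lemma module_carrier_update:
  "module R M \<Longrightarrow> submodule H R M \<Longrightarrow> module R (M\<lparr>carrier := H\<rparr>)"
  by (rule submodule.submodule_is_module)

definition homology_class ::
  "('a, 'b, 'm) module_scheme \<Rightarrow> ('b \<Rightarrow> 'c) \<Rightarrow> ('a, 'c) module \<Rightarrow> ('c \<Rightarrow> 'd)
    \<Rightarrow> ('a, 'd, 'n) module_scheme \<Rightarrow> 'c \<Rightarrow> 'c set" where
  "homology_class A f B g C z = f ` carrier A +>\<^bsub>B\<lparr>carrier := a_kernel B C g\<rparr>\<^esub> z"

lemma homology:
  assumes A: "module R A" and B: "module R B" and C: "module R C"
    and f: "f \<in> mod_hom R A B" and g: "g \<in> mod_hom R B C"
    and gf: "\<And>x. x \<in> carrier A \<Longrightarrow> g (f x) = \<zero>\<^bsub>C\<^esub>"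
  shows "carrier (homology A f B g C) = homology_class A f B g C ` a_kernel B C g"
    and "\<lbrakk>a \<in> carrier R; z \<in> carrier B; g z = \<zero>\<^bsub>C\<^esub>\<rbrakk> \<Longrightarrow>
      a \<odot>\<^bsub>homology A f B g C\<^esub> homology_class A f B g C z = \<zero>\<^bsub>homology A f B g C\<^esub>
        \<longleftrightarrow> a \<odot>\<^bsub>B\<^esub> z \<in> f ` carrier A"
    and "carrier (homology A f B g C) = {\<zero>\<^bsub>homology A f B g C\<^esub>} \<longleftrightarrow>
      (\<forall>z\<in>carrier B. g z = \<zero>\<^bsub>C\<^esub> \<longrightarrow> z \<in> f ` carrier A)"
proof -
  let ?B = "B\<lparr>carrier := a_kernel B C g\<rparr>"
  interpret B: module R B by fact
  interpret Z: module R ?B by (rule module_carrier_update[OF B submodule_kernel[OF B C g]])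
  have f': "f \<in> mod_hom R A ?B"
    using gf by (intro mod_homI)
      (auto simp: a_kernel_def' mod_hom_closed[OF f] mod_hom_add[OF f] mod_hom_smult[OF f])
  note H = submodule_image[OF A Z.module_axioms f']
  note eq0 = Z.coset_eq_zero_iff[OF H]
  show carr: "carrier (homology A f B g C) = homology_class A f B g C ` a_kernel B C g"
    unfolding homology_def Z.quot_mod_carrier by (auto simp: homology_class_def)
  show "a \<odot>\<^bsub>homology A f B g C\<^esub> homology_class A f B g C z = \<zero>\<^bsub>homology A f B g C\<^esub>
        \<longleftrightarrow> a \<odot>\<^bsub>B\<^esub> z \<in> f ` carrier A"
    if "a \<in> carrier R" "z \<in> carrier B" "g z = \<zero>\<^bsub>C\<^esub>"
  proof -
    have z: "z \<in> carrier ?B" using that by (simp add: a_kernel_def')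
    then have "a \<odot>\<^bsub>?B\<^esub> z \<in> carrier ?B" using that(1) by (rule Z.smult_closed[rotated])
    from eq0[OF this] Z.quot_mod_smult[OF H that(1) z] show ?thesis
      by (simp add: homology_def homology_class_def)
  qed
  show "carrier (homology A f B g C) = {\<zero>\<^bsub>homology A f B g C\<^esub>} \<longleftrightarrow>
      (\<forall>z\<in>carrier B. g z = \<zero>\<^bsub>C\<^esub> \<longrightarrow> z \<in> f ` carrier A)"
  proof -
    have zero: "\<zero>\<^bsub>homology A f B g C\<^esub> = f ` carrier A" by (simp add: homology_def)
    have cls: "homology_class A f B g C z = f ` carrier A \<longleftrightarrow> z \<in> f ` carrier A"
      if "z \<in> a_kernel B C g" for z
      using eq0[of z] that by (simp add: homology_class_def)
    have "a_kernel B C g \<noteq> {}" using Z.M.zero_closed by auto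
    then have "carrier (homology A f B g C) = {f ` carrier A} \<longleftrightarrow>
        (\<forall>z\<in>a_kernel B C g. homology_class A f B g C z = f ` carrier A)"
      unfolding carr by blast
    then show ?thesis using cls by (auto simp: zero a_kernel_def')
  qed
qed

lemma mod_hom_sum:
  assumes M: "module R M" and N: "module R N" and f: "f \<in> mod_hom R M N" and g: "g \<in> mod_hom R M N"
  shows "(\<lambda>x. f x \<oplus>\<^bsub>N\<^esub> g x) \<in> mod_hom R M N"
proof -
  interpret N: module R N by fact
  show ?thesis
    by (rule mod_homI)
      (auto simp: mod_hom_closed[OF f] mod_hom_closed[OF g] mod_hom_add[OF f] mod_hom_add[OF g]
        mod_hom_smult[OF f] mod_hom_smult[OF g] N.smult_r_distr N.M.a_ac)
qed

lemma (in module) mod_hom_scalar: "a \<in> carrier R \<Longrightarrow> (\<lambda>x. a \<odot>\<^bsub>M\<^esub> x) \<in> mod_hom R M M"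
  by (rule mod_homI) (simp_all add: smult_r_distr m_comm flip: smult_assoc1)

lemma hom_mod_simps [simp]:
  "carrier (hom_mod R M N) = mod_hom R M N \<inter> extensional (carrier M)"
  "zero (hom_mod R M N) = (\<lambda>x\<in>carrier M. \<zero>\<^bsub>N\<^esub>)"
  "add (hom_mod R M N) = (\<lambda>f g. \<lambda>x\<in>carrier M. f x \<oplus>\<^bsub>N\<^esub> g x)"
  "smult (hom_mod R M N) = (\<lambda>r f. \<lambda>x\<in>carrier M. r \<odot>\<^bsub>N\<^esub> f x)"
  by (simp_all add: hom_mod_def)

lemma restrict_mod_hom:
  "module R M \<Longrightarrow> f \<in> mod_hom R M N \<Longrightarrow> restrict f (carrier M) \<in> carrier (hom_mod R M N)"
  using mod_hom_cong[of R M f N "restrict f (carrier M)"] by simp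

lemma hom_mod_module:
  assumes M: "module R M" and N: "module R N"
  shows "module R (hom_mod R M N)"
proof -
  interpret M: module R M by fact
  interpret N: module R N by fact
  note closed = restrict_mod_hom[OF M, simplified]
  have ext: "f = g" if "f \<in> extensional (carrier M)" "g \<in> extensional (carrier M)"
    "\<And>x. x \<in> carrier M \<Longrightarrow> f x = g x" for f g
    using that by (rule extensionalityI)
  have scalar: "(\<lambda>x. r \<odot>\<^bsub>N\<^esub> f x) \<in> mod_hom R M N" if "r \<in> carrier R" "f \<in> mod_hom R M N" for r f
    by (rule mod_hom_comp[OF that(2) N.mod_hom_scalar[OF that(1)]])
  have zero: "(\<lambda>x. \<zero>\<^bsub>N\<^esub>) \<in> mod_hom R M N" by (rule mod_homI) auto
  have "abelian_group (hom_mod R M N)"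
  proof (rule abelian_groupI)
    fix f assume f: "f \<in> carrier (hom_mod R M N)"
    have "(\<lambda>x\<in>carrier M. (\<ominus>\<^bsub>R\<^esub> \<one>\<^bsub>R\<^esub>) \<odot>\<^bsub>N\<^esub> f x) \<in> carrier (hom_mod R M N)"
      using f by (auto intro!: closed scalar)
    then show "\<exists>g\<in>carrier (hom_mod R M N). g \<oplus>\<^bsub>hom_mod R M N\<^esub> f = \<zero>\<^bsub>hom_mod R M N\<^esub>"
      using f by (intro bexI[of _ "\<lambda>x\<in>carrier M. (\<ominus>\<^bsub>R\<^esub> \<one>\<^bsub>R\<^esub>) \<odot>\<^bsub>N\<^esub> f x"])
        (auto simp: N.smult_minus_one mod_hom_closed N.M.l_neg intro!: ext)
  qed (auto intro!: closed[OF mod_hom_sum[OF M N], simplified] closed[OF zero, simplified] ext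
      simp: mod_hom_closed N.M.a_ac)
  then show ?thesis
  proof (rule moduleI[OF M.is_cring])
    fix a f assume "a \<in> carrier R" "f \<in> carrier (hom_mod R M N)"
    then show "a \<odot>\<^bsub>hom_mod R M N\<^esub> f \<in> carrier (hom_mod R M N)"
      using closed[OF scalar] by simp
  next
    fix f assume "f \<in> carrier (hom_mod R M N)"
    then show "\<one>\<^bsub>R\<^esub> \<odot>\<^bsub>hom_mod R M N\<^esub> f = f"
      by (auto simp: mod_hom_closed intro!: ext)
  qed (simp, rule restrict_ext,
      auto simp: mod_hom_closed N.smult_l_distr N.smult_r_distr N.smult_assoc1)+
qed

lemma compose_hom:
  assumes A: "module R A" and B: "module R B" and M: "module R M" and d: "d \<in> mod_hom R A B"
  shows "(\<lambda>h. compose (carrier A) h d) \<in> mod_hom R (hom_mod R B M) (hom_mod R A M)"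
proof (rule mod_homI)
  fix h assume "h \<in> carrier (hom_mod R B M)"
  then show "compose (carrier A) h d \<in> carrier (hom_mod R A M)"
    using restrict_mod_hom[OF A mod_hom_comp[OF d]] by (auto simp: compose_def)
qed (auto simp: compose_def mod_hom_closed[OF d] fun_eq_iff)

context cring
begin

lemma cover_module: "module R (cover R N)"
  by (simp add: cover_def free_mod_module)

lemma cover_gen_closed: "n \<in> carrier N \<Longrightarrow> free_gen R n \<in> carrier (cover R N)"
  by (simp add: cover_def free_gen_closed)

lemma cover_map_hom: "module R N \<Longrightarrow> cover_map R N \<in> mod_hom R (cover R N) N"
  unfolding cover_def cover_map_def by (rule free_lift_hom)

lemma cover_map_gen: "module R N \<Longrightarrow> n \<in> carrier N \<Longrightarrow> cover_map R N (free_gen R n) = n"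
  unfolding cover_map_def by (simp add: free_lift_gen)

lemma cover_hom_eq:
  assumes "module R K" "f \<in> mod_hom R (cover R N) K" "g \<in> mod_hom R (cover R N) K"
    and "\<And>n. n \<in> carrier N \<Longrightarrow> f (free_gen R n) = g (free_gen R n)" "x \<in> carrier (cover R N)"
  shows "f x = g x"
  by (rule free_mod_hom_eq[OF assms(1) assms(2,3)[unfolded cover_def] _ assms(5)[unfolded cover_def]])
    (rule assms(4))

lemma cover_hom_exists:
  assumes "module R K" "\<And>n. n \<in> carrier N \<Longrightarrow> \<phi> n \<in> carrier K"
  obtains f where "f \<in> mod_hom R (cover R N) K"
    "\<And>n. n \<in> carrier N \<Longrightarrow> f (free_gen R n) = \<phi> n"
proof (rule that)
  show "free_lift R K \<phi> \<in> mod_hom R (cover R N) K"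
    unfolding cover_def by (rule free_lift_hom[OF assms])
qed (simp add: free_lift_gen assms)

lemma syzygy_simps [simp]:
  "carrier (syzygy R N) = {x \<in> carrier (cover R N). cover_map R N x = \<zero>\<^bsub>N\<^esub>}"
  "zero (syzygy R N) = zero (cover R N)" "add (syzygy R N) = add (cover R N)"
  "smult (syzygy R N) = smult (cover R N)"
  by (auto simp: syzygy_def a_kernel_def')

lemma syzygy_module: "module R N \<Longrightarrow> module R (syzygy R N)"
  unfolding syzygy_def
  by (rule module_carrier_update[OF cover_module submodule_kernel[OF cover_module _ cover_map_hom]])

lemma syzygy_cover_map_hom:
  "module R N \<Longrightarrow> cover_map R (syzygy R N) \<in> mod_hom R (cover R (syzygy R N)) (cover R N)"
  using cover_map_hom[OF syzygy_module, of N] by (auto simp: mod_hom_def)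

lemma syzygy_cover_map_kernel:
  "module R N \<Longrightarrow> y \<in> carrier (cover R (syzygy R N)) \<Longrightarrow>
    cover_map R N (cover_map R (syzygy R N) y) = \<zero>\<^bsub>N\<^esub>"
  using mod_hom_closed[OF cover_map_hom[OF syzygy_module, of N], of y] by simp

end

text \<open>The beginning \<open>F\<^sub>2 \<rightarrow> F\<^sub>1 \<rightarrow> F\<^sub>0 \<rightarrow> N\<close> of the standard resolution, with differentials \<open>d2\<close>, \<open>d1\<close> and
  augmentation \<open>d0\<close>.  Each free module has the kernel to its right (\<open>N\<close>, \<open>K\<close>, \<open>L\<close>) as its basis;
  so a map out of it is given by arbitrary values on that kernel, and exactness is witnessed by the
  basis elements themselves.\<close>

locale standard_resolution = cring R + N: module R N
  for R :: "('a, 'r) ring_scheme" (structure) and N :: "('a, 'n, 'p) module_scheme"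
begin

definition "K = syzygy R N"
definition "L = syzygy R K"
definition "F0 = cover R N"
definition "F1 = cover R K"
definition "F2 = cover R L"
definition "d0 = cover_map R N"
definition "d1 = cover_map R K"
definition "d2 = cover_map R L"

lemma K_module: "module R K" unfolding K_def by (rule syzygy_module[OF N.module_axioms])
lemma L_module: "module R L" unfolding L_def by (rule syzygy_module[OF K_module])
lemma F0_module: "module R F0" unfolding F0_def by (rule cover_module)
lemma F1_module: "module R F1" unfolding F1_def by (rule cover_module)
lemma F2_module: "module R F2" unfolding F2_def by (rule cover_module)

sublocale F0: module R F0 by (rule F0_module)
sublocale F1: module R F1 by (rule F1_module)

lemma K_iff: "x \<in> carrier K \<longleftrightarrow> x \<in> carrier F0 \<and> d0 x = \<zero>\<^bsub>N\<^esub>"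
  by (simp add: K_def F0_def d0_def)

lemma K_ops: "add K = add F0" "smult K = smult F0" "zero K = zero F0"
  by (simp_all add: K_def F0_def)

lemma L_iff: "y \<in> carrier L \<longleftrightarrow> y \<in> carrier F1 \<and> d1 y = \<zero>\<^bsub>F0\<^esub>"
  by (simp add: L_def F1_def d1_def K_def F0_def)

lemma d0_hom: "d0 \<in> mod_hom R F0 N"
  using cover_map_hom[OF N.module_axioms] by (simp add: d0_def F0_def)

lemma d1_hom_K: "d1 \<in> mod_hom R F1 K"
  using cover_map_hom[OF K_module] by (simp add: d1_def F1_def)

lemma d1_hom: "d1 \<in> mod_hom R F1 F0"
  using syzygy_cover_map_hom[OF N.module_axioms] by (simp add: d1_def F1_def F0_def K_def)

lemma d2_hom: "d2 \<in> mod_hom R F2 F1"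
  using syzygy_cover_map_hom[OF K_module] by (simp add: d2_def F2_def F1_def L_def)

lemma d1_d2: "x \<in> carrier F2 \<Longrightarrow> d1 (d2 x) = \<zero>\<^bsub>F0\<^esub>"
  using syzygy_cover_map_kernel[OF K_module, of x] by (simp add: d1_def d2_def F2_def L_def K_def F0_def)

lemma d0_gen:
  assumes "n \<in> carrier N"
  shows "d0 (free_gen R n) = n" "free_gen R n \<in> carrier F0"
  using cover_map_gen[OF N.module_axioms assms] cover_gen_closed[OF assms]
  by (simp_all add: d0_def F0_def)

lemma d1_gen:
  assumes "k \<in> carrier K"
  shows "d1 (free_gen R k) = k" "free_gen R k \<in> carrier F1"
  using cover_map_gen[OF K_module assms] cover_gen_closed[OF assms] by (simp_all add: d1_def F1_def)

lemma d2_gen: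
  assumes "l \<in> carrier L"
  shows "d2 (free_gen R l) = l" "free_gen R l \<in> carrier F2"
  using cover_map_gen[OF L_module assms] cover_gen_closed[OF assms] by (simp_all add: d2_def F2_def)

end

locale tor_resolution = standard_resolution R N + M: module R M
  for R :: "('a, 'r) ring_scheme" (structure) and N :: "('a, 'n, 'p) module_scheme"
    and M :: "('a, 'm, 'q) module_scheme"
begin

sublocale T0: tensor_product R F0 M by (rule tensor_productI[OF F0_module M.module_axioms])
sublocale T1: tensor_product R F1 M by (rule tensor_productI[OF F1_module M.module_axioms])
sublocale T2: tensor_product R F2 M by (rule tensor_productI[OF F2_module M.module_axioms])

abbreviation "T0 \<equiv> tensor R F0 M"
abbreviation "T1 \<equiv> tensor R F1 M"
abbreviation "T2 \<equiv> tensor R F2 M"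

definition "D1 = tensor_map R F1 M d1 F0"
definition "D2 = tensor_map R F2 M d2 F1"

lemmas D1_hom = tensor_map(1)[OF F1_module F0_module M.module_axioms d1_hom, folded D1_def]
  and D1_tens = tensor_map(2)[OF F1_module F0_module M.module_axioms d1_hom, folded D1_def]
lemmas D2_hom = tensor_map(1)[OF F2_module F1_module M.module_axioms d2_hom, folded D2_def]
  and D2_tens = tensor_map(2)[OF F2_module F1_module M.module_axioms d2_hom, folded D2_def]

lemma vanish_on_boundary:
  assumes Q: "module R Q" and H: "H \<in> mod_hom R T1 Q" and w: "w \<in> carrier T2"
    and H0: "\<And>x m. x \<in> carrier F2 \<Longrightarrow> m \<in> carrier M \<Longrightarrow> H (tens F1 M (d2 x) m) = \<zero>\<^bsub>Q\<^esub>"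
  shows "H (D2 w) = \<zero>\<^bsub>Q\<^esub>"
proof (rule T2.tensor_hom_eq[OF Q mod_hom_comp[OF D2_hom H] _ _ w])
  interpret Q: module R Q by fact
  show "(\<lambda>_. \<zero>\<^bsub>Q\<^esub>) \<in> mod_hom R T2 Q" by (rule mod_homI) auto
qed (simp add: D2_tens H0)

lemma D1_D2: "w \<in> carrier T2 \<Longrightarrow> D1 (D2 w) = \<zero>\<^bsub>T0\<^esub>"
proof (rule vanish_on_boundary[OF T0.tensor_module D1_hom])
  fix x m assume x: "x \<in> carrier F2" and m: "m \<in> carrier M"
  have "(\<lambda>x. tens F0 M x m) \<in> mod_hom R F0 T0"
    using T0.bilinear_tens m by (simp add: bilinear_def)
  from mod_hom_zero[OF F0_module T0.tensor_module this]
  show "D1 (tens F1 M (d2 x) m) = \<zero>\<^bsub>T0\<^esub>"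
    using D1_tens[OF mod_hom_closed[OF d2_hom x] m] d1_d2[OF x] by simp
qed

definition "cycle_class = homology_class T2 D2 T1 D1 T0"

lemma Tor1_eq: "Tor1 R N M = homology T2 D2 T1 D1 T0"
  by (simp add: Tor1_def Let_def D1_def D2_def d1_def d2_def F0_def F1_def F2_def L_def K_def)

lemma Tor1_carrier: "carrier (Tor1 R N M) = cycle_class ` {z \<in> carrier T1. D1 z = \<zero>\<^bsub>T0\<^esub>}"
  unfolding Tor1_eq cycle_class_def a_kernel_def'[symmetric]
  by (rule homology(1)[OF T2.tensor_module T1.tensor_module T0.tensor_module D2_hom D1_hom])
    (rule D1_D2)

lemma Tor1_smult_eq_zero_iff:
  assumes "a \<in> carrier R" "z \<in> carrier T1" "D1 z = \<zero>\<^bsub>T0\<^esub>"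
  shows "a \<odot>\<^bsub>Tor1 R N M\<^esub> cycle_class z = \<zero>\<^bsub>Tor1 R N M\<^esub> \<longleftrightarrow> a \<odot>\<^bsub>T1\<^esub> z \<in> D2 ` carrier T2"
  unfolding Tor1_eq cycle_class_def
  by (rule homology(2)[OF T2.tensor_module T1.tensor_module T0.tensor_module D2_hom D1_hom _ assms])
    (rule D1_D2)

text \<open>Multiplication by \<open>a\<close> lifts the zero map of \<open>N\<close>, so it is null-homotopic: there are
  \<open>s0 : F\<^sub>0 \<rightarrow> F\<^sub>1\<close> and \<open>s1 : F\<^sub>1 \<rightarrow> F\<^sub>2\<close> with \<open>d1 s0 = a\<close> and \<open>d2 s1 + s0 d1 = a\<close>.  After tensoring with
  \<open>M\<close>, the second equation exhibits \<open>a\<close> times a cycle as a boundary.\<close>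

lemma Tor1_annihilated:
  assumes a: "a \<in> carrier R" and aN: "\<And>n. n \<in> carrier N \<Longrightarrow> a \<odot>\<^bsub>N\<^esub> n = \<zero>\<^bsub>N\<^esub>"
    and X: "X \<in> carrier (Tor1 R N M)"
  shows "a \<odot>\<^bsub>Tor1 R N M\<^esub> X = \<zero>\<^bsub>Tor1 R N M\<^esub>"
proof -
  have aK: "a \<odot>\<^bsub>F0\<^esub> free_gen R n \<in> carrier K" if n: "n \<in> carrier N" for n
    using F0.smult_closed[OF a] mod_hom_smult[OF d0_hom a] d0_gen[OF n] aN[OF n] by (simp add: K_iff)
  obtain s0 where s0: "s0 \<in> mod_hom R F0 F1"
    "\<And>n. n \<in> carrier N \<Longrightarrow> s0 (free_gen R n) = free_gen R (a \<odot>\<^bsub>F0\<^esub> free_gen R n)"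
    using cover_hom_exists[OF F1_module, of N "\<lambda>n. free_gen R (a \<odot>\<^bsub>F0\<^esub> free_gen R n)"]
      d1_gen(2)[OF aK] unfolding F0_def by metis
  have d1s0: "d1 (s0 x) = a \<odot>\<^bsub>F0\<^esub> x" if "x \<in> carrier F0" for x
  proof (rule cover_hom_eq[OF F0_module _ _ _ that[unfolded F0_def]])
    show "(\<lambda>x. d1 (s0 x)) \<in> mod_hom R (cover R N) F0"
      using mod_hom_comp[OF s0(1) d1_hom] by (simp add: F0_def)
    show "(\<lambda>x. a \<odot>\<^bsub>F0\<^esub> x) \<in> mod_hom R (cover R N) F0"
      using F0.mod_hom_scalar[OF a] by (simp add: F0_def)
  qed (simp add: s0 d1_gen aK)
  have sL: "a \<odot>\<^bsub>F1\<^esub> free_gen R k \<ominus>\<^bsub>F1\<^esub> s0 k \<in> carrier L" if k: "k \<in> carrier K" for k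
  proof -
    note g = d1_gen(2)[OF k]
    have k0: "k \<in> carrier F0" using k by (simp add: K_iff)
    note c = F1.smult_closed[OF a g] mod_hom_closed[OF s0(1) k0]
    have "d1 (a \<odot>\<^bsub>F1\<^esub> free_gen R k \<ominus>\<^bsub>F1\<^esub> s0 k) = a \<odot>\<^bsub>F0\<^esub> k \<ominus>\<^bsub>F0\<^esub> a \<odot>\<^bsub>F0\<^esub> k"
      using mod_hom_minus[OF F1_module F0_module d1_hom c] mod_hom_smult[OF d1_hom a g]
        d1_gen(1)[OF k] d1s0[OF k0] by simp
    also have "\<dots> = \<zero>\<^bsub>F0\<^esub>" using a k0 by (simp add: F0.M.minus_eq F0.M.r_neg)
    finally show ?thesis
      using F1.M.minus_closed[OF c] by (simp add: L_iff)
  qed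
  obtain s1 where s1: "s1 \<in> mod_hom R F1 F2"
    "\<And>k. k \<in> carrier K \<Longrightarrow> s1 (free_gen R k) = free_gen R (a \<odot>\<^bsub>F1\<^esub> free_gen R k \<ominus>\<^bsub>F1\<^esub> s0 k)"
    using cover_hom_exists[OF F2_module, of K "\<lambda>k. free_gen R (a \<odot>\<^bsub>F1\<^esub> free_gen R k \<ominus>\<^bsub>F1\<^esub> s0 k)"]
      d2_gen(2)[OF sL] unfolding F1_def by metis
  have htpy: "d2 (s1 y) \<oplus>\<^bsub>F1\<^esub> s0 (d1 y) = a \<odot>\<^bsub>F1\<^esub> y" if "y \<in> carrier F1" for y
  proof (rule cover_hom_eq[OF F1_module _ _ _ that[unfolded F1_def]])
    show "(\<lambda>y. d2 (s1 y) \<oplus>\<^bsub>F1\<^esub> s0 (d1 y)) \<in> mod_hom R (cover R K) F1"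
      using mod_hom_sum[OF F1_module F1_module mod_hom_comp[OF s1(1) d2_hom] mod_hom_comp[OF d1_hom s0(1)]]
      by (simp add: F1_def)
    show "(\<lambda>y. a \<odot>\<^bsub>F1\<^esub> y) \<in> mod_hom R (cover R K) F1"
      using F1.mod_hom_scalar[OF a] by (simp add: F1_def)
    fix k assume k: "k \<in> carrier K"
    then have "free_gen R k \<in> carrier F1" "s0 k \<in> carrier F1"
      using d1_gen(2)[OF k] mod_hom_closed[OF s0(1), of k] by (simp_all add: K_iff)
    then show "d2 (s1 (free_gen R k)) \<oplus>\<^bsub>F1\<^esub> s0 (d1 (free_gen R k)) = a \<odot>\<^bsub>F1\<^esub> free_gen R k"
      unfolding s1(2)[OF k] d2_gen(1)[OF sL[OF k]] d1_gen(1)[OF k]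
      using a by (simp add: F1.M.minus_eq F1.M.a_assoc F1.M.l_neg)
  qed
  define S0 where "S0 = tensor_map R F0 M s0 F1"
  define S1 where "S1 = tensor_map R F1 M s1 F2"
  note S0 = tensor_map[OF F0_module F1_module M.module_axioms s0(1), folded S0_def]
  note S1 = tensor_map[OF F1_module F2_module M.module_axioms s1(1), folded S1_def]
  interpret T: module R T1 by (rule T1.tensor_module)
  have Htpy: "D2 (S1 z) \<oplus>\<^bsub>T1\<^esub> S0 (D1 z) = a \<odot>\<^bsub>T1\<^esub> z"
    if z: "z \<in> carrier (T1)" for z
  proof (rule T1.tensor_hom_eq[OF T.module_axioms mod_hom_sum[OF T.module_axioms T.module_axioms
        mod_hom_comp[OF S1(1) D2_hom] mod_hom_comp[OF D1_hom S0(1)]] T.mod_hom_scalar[OF a] _ z])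
    fix y m assume y: "y \<in> carrier F1" and m: "m \<in> carrier M"
    have t: "(\<lambda>x. tens F1 M x m) \<in> mod_hom R F1 (T1)"
      using T1.bilinear_tens m by (simp add: bilinear_def)
    note s1y = mod_hom_closed[OF s1(1) y] and d1y = mod_hom_closed[OF d1_hom y]
    have "D2 (S1 (tens F1 M y m)) \<oplus>\<^bsub>T1\<^esub> S0 (D1 (tens F1 M y m)) =
        tens F1 M (d2 (s1 y)) m \<oplus>\<^bsub>T1\<^esub> tens F1 M (s0 (d1 y)) m"
      by (simp only: S1(2)[OF y m] D2_tens[OF s1y m] D1_tens[OF y m] S0(2)[OF d1y m])
    also have "\<dots> = tens F1 M (d2 (s1 y) \<oplus>\<^bsub>F1\<^esub> s0 (d1 y)) m"
      by (rule mod_hom_add[OF t mod_hom_closed[OF d2_hom s1y] mod_hom_closed[OF s0(1) d1y], symmetric])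
    also have "\<dots> = a \<odot>\<^bsub>T1\<^esub> tens F1 M y m"
      unfolding htpy[OF y] by (rule mod_hom_smult[OF t a y])
    finally show "D2 (S1 (tens F1 M y m)) \<oplus>\<^bsub>T1\<^esub> S0 (D1 (tens F1 M y m)) =
        a \<odot>\<^bsub>T1\<^esub> tens F1 M y m" .
  qed
  obtain z where z: "z \<in> carrier T1" "D1 z = \<zero>\<^bsub>T0\<^esub>" "X = cycle_class z"
    using X unfolding Tor1_carrier by blast
  have c: "D2 (S1 z) \<in> carrier (T1)"
    by (rule mod_hom_closed[OF D2_hom mod_hom_closed[OF S1(1) z(1)]])
  have "a \<odot>\<^bsub>T1\<^esub> z = D2 (S1 z)"
    using Htpy[OF z(1)] mod_hom_zero[OF T0.tensor_module T1.tensor_module S0(1)] z(2) c by simp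
  then have "a \<odot>\<^bsub>T1\<^esub> z \<in> D2 ` carrier (T2)"
    using mod_hom_closed[OF S1(1) z(1)] by simp
  then show ?thesis unfolding z(3) Tor1_smult_eq_zero_iff[OF a z(1,2)] .
qed

end

context cring
begin

lemma standard_resolutionI: "module R N \<Longrightarrow> standard_resolution R N"
  by (simp add: standard_resolution_def is_cring)

lemma tor_resolutionI: "module R N \<Longrightarrow> module R M \<Longrightarrow> tor_resolution R N M"
  by (simp add: tor_resolution_def standard_resolutionI)

lemma quot_by_ideal_module: "ideal I R \<Longrightarrow> module R (quot_by_ideal R I)"
  unfolding ideal_iff_submodule by (rule module.quot_mod_module[OF self_mod_module])

abbreviation residue :: "'a set \<Rightarrow> 'a \<Rightarrow> 'a set" where
  "residue I x \<equiv> I +>\<^bsub>self_mod R\<^esub> x"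

lemma quot_by_ideal_carrier: "carrier (quot_by_ideal R I) = residue I ` carrier R"
  using module.quot_mod_carrier[OF self_mod_module] by simp

lemma residue_hom: "ideal I R \<Longrightarrow> residue I \<in> mod_hom R (self_mod R) (quot_by_ideal R I)"
  unfolding ideal_iff_submodule by (rule module.quot_mod_proj_hom[OF self_mod_module])

lemma residue_closed: "x \<in> carrier R \<Longrightarrow> residue I x \<in> carrier (quot_by_ideal R I)"
  by (simp add: quot_by_ideal_carrier)

lemma residue_eq_iff:
  "ideal I R \<Longrightarrow> x \<in> carrier R \<Longrightarrow> y \<in> carrier R \<Longrightarrow> residue I x = residue I y \<longleftrightarrow> x \<ominus> y \<in> I"
  unfolding ideal_iff_submodule
  using module.coset_eq_iff[OF self_mod_module, of I x y] by (simp add: self_mod_minus)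

lemma residue_eq_zero_iff: "ideal I R \<Longrightarrow> x \<in> carrier R \<Longrightarrow> residue I x = I \<longleftrightarrow> x \<in> I"
  unfolding ideal_iff_submodule
  using module.coset_eq_zero_iff[OF self_mod_module, of I x] by simp

lemma quot_by_ideal_zero: "\<zero>\<^bsub>quot_by_ideal R I\<^esub> = I"
  using module.quot_mod_zero[OF self_mod_module] by simp

lemma residue_smult:
  "ideal I R \<Longrightarrow> a \<in> carrier R \<Longrightarrow> x \<in> carrier R \<Longrightarrow>
    a \<odot>\<^bsub>quot_by_ideal R I\<^esub> residue I x = residue I (a \<otimes> x)"
  using mod_hom_smult[OF residue_hom, of I a x] by simp

lemma quot_by_ideal_annihilated:
  assumes I: "ideal I R" and a: "a \<in> I" and n: "n \<in> carrier (quot_by_ideal R I)"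
  shows "a \<odot>\<^bsub>quot_by_ideal R I\<^esub> n = \<zero>\<^bsub>quot_by_ideal R I\<^esub>"
proof -
  interpret ideal I R by fact
  obtain x where x: "x \<in> carrier R" "n = residue I x" using n by (auto simp: quot_by_ideal_carrier)
  then have "residue I (a \<otimes> x) = I"
    using residue_eq_zero_iff[OF I, of "a \<otimes> x"] I_r_closed[OF a] Icarr[OF a] by simp
  then show ?thesis using residue_smult[OF I Icarr[OF a] x(1)] x(2) by (simp add: quot_by_ideal_zero)
qed

lemma bilinear_comp:
  assumes "module R M'" "module R N'" "bilinear M N K \<beta>" "f \<in> mod_hom R M' M" "g \<in> mod_hom R N' N"
  shows "bilinear M' N' K (\<lambda>x y. \<beta> (f x) (g y))"
proof -
  have "(\<lambda>y. \<beta> (f x) (g y)) \<in> mod_hom R N' K" if "x \<in> carrier M'" for x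
    using assms(3) mod_hom_closed[OF assms(4) that]
    by (intro mod_hom_comp[OF assms(5)]) (simp add: bilinear_def)
  moreover have "(\<lambda>x. \<beta> (f x) (g y)) \<in> mod_hom R M' K" if "y \<in> carrier N'" for y
    using assms(3) mod_hom_closed[OF assms(5) that]
    by (intro mod_hom_comp[OF assms(4), of "\<lambda>x. \<beta> x (g y)"]) (simp add: bilinear_def)
  ultimately show ?thesis by (simp add: bilinear_def)
qed

text \<open>The multiplication \<open>I \<times> R/I \<rightarrow> R/I\<^sup>2\<close>.  It detects whether an element of \<open>I \<otimes> R/I\<close>, or of
  \<open>Tor\<^sub>1(R/I, R/I)\<close>, is zero: both are \<open>I/I\<^sup>2\<close>.\<close>

lemma conormal_pairing:
  assumes I: "ideal I R"
  obtains \<mu> where "bilinear (ideal_mod R I) (quot_by_ideal R I) (quot_by_ideal R (I \<cdot> I)) \<mu>"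
    "\<And>b r. b \<in> I \<Longrightarrow> r \<in> carrier R \<Longrightarrow> \<mu> b (residue I r) = residue (I \<cdot> I) (b \<otimes> r)"
proof -
  interpret I: ideal I R by fact
  have II: "ideal (I \<cdot> I) R" by (rule ideal_prod_is_ideal[OF I I])
  let ?N = "quot_by_ideal R I" and ?Q = "quot_by_ideal R (I \<cdot> I)"
  note Q = quot_by_ideal_module[OF II] and N = quot_by_ideal_module[OF I]
  have "\<exists>g. g \<in> mod_hom R ?N ?Q \<and> (\<forall>r\<in>carrier R. g (residue I r) = residue (I \<cdot> I) (b \<otimes> r))"
    if b: "b \<in> I" for b
  proof -
    have hom: "(\<lambda>r. residue (I \<cdot> I) (b \<otimes> r)) \<in> mod_hom R (self_mod R) ?Q"
      by (rule mod_hom_comp[OF _ residue_hom[OF II]])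
        (use module.mod_hom_scalar[OF self_mod_module I.Icarr[OF b]] in simp)
    have "residue (I \<cdot> I) (b \<otimes> r) = \<zero>\<^bsub>?Q\<^esub>" if "r \<in> I" for r
      using ideal_prod.prod[OF b that] residue_eq_zero_iff[OF II, of "b \<otimes> r"] I.Icarr b that
      by (simp add: quot_by_ideal_zero)
    from module.quot_mod_lift[OF self_mod_module I[unfolded ideal_iff_submodule] Q hom this]
    obtain g where "g \<in> mod_hom R ?N ?Q"
      "\<And>r. r \<in> carrier (self_mod R) \<Longrightarrow> g (residue I r) = residue (I \<cdot> I) (b \<otimes> r)" by metis
    then show ?thesis by (intro exI[of _ g]) simp
  qed
  then obtain \<mu> where \<mu>: "\<And>b. b \<in> I \<Longrightarrow> \<mu> b \<in> mod_hom R ?N ?Q"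
    "\<And>b r. b \<in> I \<Longrightarrow> r \<in> carrier R \<Longrightarrow> \<mu> b (residue I r) = residue (I \<cdot> I) (b \<otimes> r)" by metis
  have "(\<lambda>b. \<mu> b n) \<in> mod_hom R (ideal_mod R I) ?Q" if n: "n \<in> carrier ?N" for n
  proof -
    obtain r where r: "r \<in> carrier R" "n = residue I r" using n by (auto simp: quot_by_ideal_carrier)
    have hom: "(\<lambda>b. residue (I \<cdot> I) (r \<otimes> b)) \<in> mod_hom R (self_mod R) ?Q"
      by (rule mod_hom_comp[OF _ residue_hom[OF II]])
        (use module.mod_hom_scalar[OF self_mod_module r(1)] in simp)
    then have "(\<lambda>b. residue (I \<cdot> I) (r \<otimes> b)) \<in> mod_hom R (ideal_mod R I) ?Q"
      by (auto simp: mod_hom_def I.Icarr)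
    then show ?thesis
      by (rule mod_hom_cong[OF ideal_mod_module[OF I]]) (simp add: r \<mu>(2) m_comm[of r] I.Icarr)
  qed
  then have "bilinear (ideal_mod R I) ?N ?Q \<mu>" using \<mu>(1) by (simp add: bilinear_def)
  then show ?thesis using \<mu>(2) by (rule that)
qed

text \<open>A choice of representatives of the residue classes lifts the augmentation \<open>F\<^sub>0 \<rightarrow> R/I\<close> to a
  homomorphism \<open>\<psi> : F\<^sub>0 \<rightarrow> R\<close>, which carries the syzygies of \<open>R/I\<close> into \<open>I\<close>.  Representatives are
  arbitrary, and so the class of \<open>1\<close> is only known to be lifted to an element of \<open>1 + I\<close>.\<close>

lemma cover_quot_lift:
  assumes I: "ideal I R"
  obtains \<psi> where "\<psi> \<in> mod_hom R (cover R (quot_by_ideal R I)) (self_mod R)"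
    "\<And>x. x \<in> carrier (cover R (quot_by_ideal R I)) \<Longrightarrow>
      residue I (\<psi> x) = cover_map R (quot_by_ideal R I) x"
    "\<And>x. x \<in> carrier (syzygy R (quot_by_ideal R I)) \<Longrightarrow> \<psi> x \<in> I"
proof -
  let ?N = "quot_by_ideal R I"
  note N = quot_by_ideal_module[OF I]
  obtain \<sigma> where \<sigma>: "\<sigma> n \<in> carrier R" "residue I (\<sigma> n) = n" if "n \<in> carrier ?N" for n
    unfolding quot_by_ideal_carrier by (metis (mono_tags, lifting) image_iff)
  obtain \<psi> where \<psi>: "\<psi> \<in> mod_hom R (cover R ?N) (self_mod R)"
    "\<And>n. n \<in> carrier ?N \<Longrightarrow> \<psi> (free_gen R n) = \<sigma> n"
    using cover_hom_exists[OF self_mod_module, of ?N \<sigma>] \<sigma> by auto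
  have res: "residue I (\<psi> x) = cover_map R ?N x" if x: "x \<in> carrier (cover R ?N)" for x
    by (rule cover_hom_eq[OF N mod_hom_comp[OF \<psi>(1) residue_hom[OF I]] cover_map_hom[OF N] _ x])
      (simp add: \<psi>(2) \<sigma> cover_map_gen[OF N])
  moreover have "\<psi> x \<in> I" if "x \<in> carrier (syzygy R ?N)" for x
    using res[of x] that mod_hom_closed[OF \<psi>(1), of x] residue_eq_zero_iff[OF I, of "\<psi> x"]
    by (simp add: quot_by_ideal_zero)
  ultimately show ?thesis using \<psi>(1) that by blast
qed

text \<open>With \<open>M\<close> a copy of \<open>R/I\<close> and \<open>m\<close> its element \<open>1\<close>, this is one half of \<open>Tor\<^sub>1(R/I, R/I) = I/I\<^sup>2\<close>.  Let
  \<open>e \<in> F\<^sub>0\<close> be the basis element of the class of \<open>1\<close>, so that \<open>a e\<close> is a syzygy for \<open>a \<in> I\<close>.  Then \<open>z\<close>,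
  the basis element of \<open>a e\<close> tensored with \<open>m\<close>, is a cycle as \<open>a e \<otimes> m = e \<otimes> a m = 0\<close>.  The map \<open>H\<close>
  from \<open>F\<^sub>1 \<otimes> M\<close> to \<open>R/I\<^sup>2\<close> induced by the pairing vanishes on boundaries and sends \<open>z\<close> to the class of
  \<open>a\<close>; if \<open>j\<close> annihilates the class of \<open>z\<close> in \<open>Tor\<^sub>1\<close>, then \<open>j a \<in> I\<^sup>2\<close>.\<close>

lemma Tor1_torsion_imp_idempotent:
  assumes I: "ideal I R" and M: "module R M"
    and p: "p \<in> mod_hom R M (quot_by_ideal R I)"
    and m: "m \<in> carrier M" "p m = residue I \<one>" and Im: "\<And>a. a \<in> I \<Longrightarrow> a \<odot>\<^bsub>M\<^esub> m = \<zero>\<^bsub>M\<^esub>"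
    and tors: "GV_torsion R (Tor1 R (quot_by_ideal R I) M)" and a: "a \<in> I"
  shows "\<exists>J\<in>GV R. \<forall>j\<in>J. j \<otimes> a \<in> I \<cdot> I"
proof -
  interpret I: ideal I R by fact
  have aR: "a \<in> carrier R" using a I.Icarr by simp
  have II: "ideal (I \<cdot> I) R" by (rule ideal_prod_is_ideal[OF I I])
  define N where "N = quot_by_ideal R I"
  have N: "module R N" using quot_by_ideal_module[OF I] by (simp add: N_def)
  interpret tor_resolution R N M by (rule tor_resolutionI[OF N M])
  have t0: "(\<lambda>x. tens F0 M x y) \<in> mod_hom R F0 (T0)" if "y \<in> carrier M" for y
    using T0.bilinear_tens that by (simp add: bilinear_def)
  have t0': "(\<lambda>y. tens F0 M x y) \<in> mod_hom R M (T0)" if "x \<in> carrier F0" for x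
    using T0.bilinear_tens that by (simp add: bilinear_def)
  obtain \<psi> where \<psi>: "\<psi> \<in> mod_hom R F0 (self_mod R)"
    "\<And>x. x \<in> carrier F0 \<Longrightarrow> residue I (\<psi> x) = d0 x" "\<And>x. x \<in> carrier K \<Longrightarrow> \<psi> x \<in> I"
    using cover_quot_lift[OF I, folded N_def] unfolding F0_def K_def d0_def by metis
  obtain \<mu> where \<mu>: "bilinear (ideal_mod R I) N (quot_by_ideal R (I \<cdot> I)) \<mu>"
    "\<And>b r. b \<in> I \<Longrightarrow> r \<in> carrier R \<Longrightarrow> \<mu> b (residue I r) = residue (I \<cdot> I) (b \<otimes> r)"
    using conormal_pairing[OF I] unfolding N_def by metis
  let ?Q = "quot_by_ideal R (I \<cdot> I)"
  note Q = quot_by_ideal_module[OF II]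
  have \<psi>d1: "(\<lambda>y. \<psi> (d1 y)) \<in> mod_hom R F1 (ideal_mod R I)"
    using \<psi>(3) mod_hom_closed[OF d1_hom_K] mod_hom_comp[OF d1_hom \<psi>(1)] by (auto simp: mod_hom_def)
  obtain H where H: "H \<in> mod_hom R (T1) ?Q"
    "\<And>y n. y \<in> carrier F1 \<Longrightarrow> n \<in> carrier M \<Longrightarrow> H (tens F1 M y n) = \<mu> (\<psi> (d1 y)) (p n)"
    using T1.tensor_hom_exists[OF Q bilinear_comp[OF F1_module M \<mu>(1) \<psi>d1 p[folded N_def]]] by metis
  have HD2: "H (D2 w) = \<zero>\<^bsub>?Q\<^esub>" if w: "w \<in> carrier (T2)" for w
  proof (rule vanish_on_boundary[OF Q H(1) w])
    fix x n assume xn: "x \<in> carrier F2" "n \<in> carrier M"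
    have "(\<lambda>b. \<mu> b (p n)) \<in> mod_hom R (ideal_mod R I) ?Q"
      using \<mu>(1) mod_hom_closed[OF p xn(2)] by (simp add: bilinear_def N_def)
    from mod_hom_zero[OF ideal_mod_module[OF I] Q this]
    show "H (tens F1 M (d2 x) n) = \<zero>\<^bsub>?Q\<^esub>"
      using H(2)[OF mod_hom_closed[OF d2_hom xn(1)] xn(2)] d1_d2[OF xn(1)]
        mod_hom_zero[OF F0_module self_mod_module \<psi>(1)] by simp
  qed
  define e where "e = free_gen R (residue I \<one>)"
  have N1: "residue I \<one> \<in> carrier N" by (simp add: N_def residue_closed)
  have e: "e \<in> carrier F0" "d0 e = residue I \<one>" using d0_gen[OF N1] by (simp_all add: e_def)
  define k where "k = a \<odot>\<^bsub>F0\<^esub> e"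
  have kF: "k \<in> carrier F0" using F0.smult_closed[OF aR e(1)] by (simp add: k_def)
  have "d0 k = a \<odot>\<^bsub>N\<^esub> residue I \<one>"
    using mod_hom_smult[OF d0_hom aR e(1)] e(2) by (simp add: k_def)
  also have "\<dots> = \<zero>\<^bsub>N\<^esub>"
    using quot_by_ideal_annihilated[OF I a] N1 by (simp add: N_def)
  finally have kK: "k \<in> carrier K" using kF by (simp add: K_iff)
  define z where "z = tens F1 M (free_gen R k) m"
  note d1k = d1_gen(1)[OF kK] and gk = d1_gen(2)[OF kK]
  have z: "z \<in> carrier (T1)" unfolding z_def by (rule T1.tens_closed[OF gk m(1)])
  have "D1 z = tens F0 M (a \<odot>\<^bsub>F0\<^esub> e) m"
    unfolding z_def using D1_tens[OF gk m(1)] d1k by (simp add: k_def)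
  also have "\<dots> = tens F0 M e (a \<odot>\<^bsub>M\<^esub> m)"
    using mod_hom_smult[OF t0[OF m(1)] aR e(1)] mod_hom_smult[OF t0'[OF e(1)] aR m(1)] by simp
  also have "\<dots> = \<zero>\<^bsub>T0\<^esub>"
    using Im[OF a] mod_hom_zero[OF M T0.tensor_module t0'[OF e(1)]] by simp
  finally have D1z: "D1 z = \<zero>\<^bsub>T0\<^esub>" .
  have "cycle_class z \<in> carrier (Tor1 R N M)" unfolding Tor1_carrier using z D1z by blast
  then obtain J where J: "J \<in> GV R"
    "\<And>j. j \<in> J \<Longrightarrow> j \<odot>\<^bsub>Tor1 R N M\<^esub> cycle_class z = \<zero>\<^bsub>Tor1 R N M\<^esub>"
    using tors unfolding GV_torsion_def tor_GV_def N_def by blast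
  have "j \<otimes> a \<in> I \<cdot> I" if j: "j \<in> J" for j
  proof -
    have jR: "j \<in> carrier R" using GV_D(4)[OF J(1)] j by auto
    obtain w where w: "w \<in> carrier T2" "j \<odot>\<^bsub>T1\<^esub> z = D2 w"
      using J(2)[OF j] unfolding Tor1_smult_eq_zero_iff[OF jR z D1z] by auto
    have ja: "j \<otimes> a \<in> I" using a jR by (rule I.I_l_closed)
    have \<psi>e: "\<psi> e \<in> carrier R" using mod_hom_closed[OF \<psi>(1) e(1)] by simp
    have "residue I (\<psi> e) = residue I \<one>"
      using \<psi>(2)[OF e(1)] e(2) by simp
    have "j \<odot>\<^bsub>?Q\<^esub> H z = \<zero>\<^bsub>?Q\<^esub>"
      using mod_hom_smult[OF H(1) jR z] HD2[OF w(1)] w(2) by simp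
    moreover have "H z = residue (I \<cdot> I) a"
    proof -
      have "H z = \<mu> (a \<otimes> \<psi> e) (residue I \<one>)"
        using H(2)[OF gk m(1)] d1k mod_hom_smult[OF \<psi>(1) aR e(1)] m(2) by (simp add: z_def k_def)
      also have "\<dots> = residue (I \<cdot> I) (a \<otimes> \<psi> e)"
        using \<mu>(2)[OF I.I_r_closed[OF a \<psi>e], of \<one>] aR \<psi>e by simp
      \<comment> \<open>Moving \<open>\<psi> e\<close> across the pairing absorbs its difference from \<open>1\<close>, which lies in \<open>I\<close>.\<close>
      also have "\<dots> = \<mu> a (residue I (\<psi> e))" using \<mu>(2)[OF a \<psi>e] by simp
      also have "\<dots> = residue (I \<cdot> I) a"
        using \<mu>(2)[OF a, of \<one>] aR \<open>residue I (\<psi> e) = residue I \<one>\<close> by simp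
      finally show ?thesis .
    qed
    ultimately have "residue (I \<cdot> I) (j \<otimes> a) = I \<cdot> I"
      using residue_smult[OF II jR aR] by (simp add: quot_by_ideal_zero)
    then show ?thesis using residue_eq_zero_iff[OF II, of "j \<otimes> a"] jR aR by simp
  qed
  then show ?thesis using J(1) by blast
qed

lemma GV_torsion_freeD:
  assumes "GV_torsion_free R M" "J \<in> GV R" "x \<in> carrier M" "\<And>a. a \<in> J \<Longrightarrow> a \<odot>\<^bsub>M\<^esub> x = \<zero>\<^bsub>M\<^esub>"
  shows "x = \<zero>\<^bsub>M\<^esub>"
  using assms by (auto simp: GV_torsion_free_def tor_GV_def)

lemma GV_torsion_freeI:
  assumes M: "module R M"
    and "\<And>J x. J \<in> GV R \<Longrightarrow> x \<in> carrier M \<Longrightarrow> (\<And>a. a \<in> J \<Longrightarrow> a \<odot>\<^bsub>M\<^esub> x = \<zero>\<^bsub>M\<^esub>) \<Longrightarrow> x = \<zero>\<^bsub>M\<^esub>"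
  shows "GV_torsion_free R M"
proof -
  interpret M: module R M by fact
  have "\<zero>\<^bsub>M\<^esub> \<in> tor_GV R M" using carrier_GV by (auto simp: tor_GV_def intro!: bexI[of _ "carrier R"])
  then show ?thesis using assms(2) by (auto simp: GV_torsion_free_def tor_GV_def)
qed

end

context standard_resolution
begin

text \<open>A cocycle \<open>u : F\<^sub>1 \<rightarrow> M\<close> vanishes on \<open>L\<close>, since \<open>d2\<close> maps the basis of \<open>F\<^sub>2\<close> onto \<open>L\<close>.  So it is the same
  thing as a homomorphism \<open>h\<close> on \<open>K \<cong> F\<^sub>1/L\<close>, and it is a coboundary if and only if \<open>h\<close> extends to
  \<open>F\<^sub>0\<close>.\<close>

lemma Ext1_trivial_iff:
  fixes M :: "('a, 'y, 'q) module_scheme"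
  assumes M: "module R M"
  shows "carrier (Ext1 R N M) = {\<zero>\<^bsub>Ext1 R N M\<^esub>} \<longleftrightarrow>
    (\<forall>h\<in>mod_hom R K M. \<exists>g\<in>mod_hom R F0 M. \<forall>k\<in>carrier K. g k = h k)"
proof -
  interpret M: module R M by fact
  interpret K: module R K by (rule K_module)
  define d1' where "d1' = (\<lambda>h. compose (carrier F1) h d1 :: (('n \<Rightarrow> 'a) \<Rightarrow> 'a) \<Rightarrow> 'y)"
  define d2' where "d2' = (\<lambda>h. compose (carrier F2) h d2 :: ((('n \<Rightarrow> 'a) \<Rightarrow> 'a) \<Rightarrow> 'a) \<Rightarrow> 'y)"
  note d1' = compose_hom[OF F1_module F0_module M d1_hom, folded d1'_def]
  note d2' = compose_hom[OF F2_module F1_module M d2_hom, folded d2'_def]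
  have dd: "d2' (d1' h) = \<zero>\<^bsub>hom_mod R F2 M\<^esub>" if "h \<in> carrier (hom_mod R F0 M)" for h
    using mod_hom_zero[OF F0_module M, of h] that
    by (auto simp: d1'_def d2'_def compose_def d1_d2 mod_hom_closed[OF d2_hom] fun_eq_iff)
  have Ext: "Ext1 R N M = homology (hom_mod R F0 M) d1' (hom_mod R F1 M) d2' (hom_mod R F2 M)"
    by (simp add: Ext1_def Let_def d1'_def d2'_def d1_def d2_def F0_def F1_def F2_def L_def K_def)
  have 1: "carrier (Ext1 R N M) = {\<zero>\<^bsub>Ext1 R N M\<^esub>} \<longleftrightarrow>
      (\<forall>h\<in>carrier (hom_mod R F1 M). d2' h = \<zero>\<^bsub>hom_mod R F2 M\<^esub> \<longrightarrow>
        h \<in> d1' ` carrier (hom_mod R F0 M))"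
    unfolding Ext
    by (rule homology(3)[OF hom_mod_module[OF F0_module M] hom_mod_module[OF F1_module M]
        hom_mod_module[OF F2_module M]
        d1' d2']) (rule dd)
  also have "\<dots> \<longleftrightarrow> (\<forall>h\<in>mod_hom R K M. \<exists>g\<in>mod_hom R F0 M. \<forall>k\<in>carrier K. g k = h k)"
  proof (intro iffI ballI impI)
    fix h assume exact: "\<forall>h\<in>carrier (hom_mod R F1 M). d2' h = \<zero>\<^bsub>hom_mod R F2 M\<^esub> \<longrightarrow>
        h \<in> d1' ` carrier (hom_mod R F0 M)" and h: "h \<in> mod_hom R K M"
    define u where "u = (\<lambda>y\<in>carrier F1. h (d1 y))"
    have "u \<in> carrier (hom_mod R F1 M)"
      unfolding u_def by (rule restrict_mod_hom[OF F1_module mod_hom_comp[OF d1_hom_K h]])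
    moreover have "d2' u = \<zero>\<^bsub>hom_mod R F2 M\<^esub>"
      using mod_hom_zero[OF K_module M h]
      by (auto simp: d2'_def u_def compose_def mod_hom_closed[OF d2_hom] d1_d2 K_ops fun_eq_iff)
    ultimately obtain g where g: "g \<in> mod_hom R F0 M" "u = d1' g" using exact by auto
    have "g k = h k" if "k \<in> carrier K" for k
      using fun_cong[OF g(2), of "free_gen R k"] d1_gen[OF that]
      by (simp add: u_def d1'_def compose_def)
    then show "\<exists>g\<in>mod_hom R F0 M. \<forall>k\<in>carrier K. g k = h k" using g by blast
  next
    fix u assume extend: "\<forall>h\<in>mod_hom R K M. \<exists>g\<in>mod_hom R F0 M. \<forall>k\<in>carrier K. g k = h k"
      and u: "u \<in> carrier (hom_mod R F1 M)" and u0: "d2' u = \<zero>\<^bsub>hom_mod R F2 M\<^esub>"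
    have uh: "u \<in> mod_hom R F1 M" using u by simp
    define h where "h k = u (free_gen R k)" for k
    have uL: "u y = \<zero>\<^bsub>M\<^esub>" if "y \<in> carrier L" for y
      using fun_cong[OF u0, of "free_gen R y"] d2_gen[OF that] by (simp add: d2'_def compose_def)
    have hd1: "u y = h k" if y: "y \<in> carrier F1" and k: "k \<in> carrier K" "d1 y = k" for y k
    proof -
      note g = d1_gen[OF k(1)]
      have "d1 (y \<ominus>\<^bsub>F1\<^esub> free_gen R k) = k \<ominus>\<^bsub>F0\<^esub> k"
        using mod_hom_minus[OF F1_module F0_module d1_hom y g(2)] g(1) k(2) by simp
      also have "\<dots> = \<zero>\<^bsub>F0\<^esub>" using k(1) K_iff by (simp add: F0.M.minus_eq F0.M.r_neg)
      finally have "u (y \<ominus>\<^bsub>F1\<^esub> free_gen R k) = \<zero>\<^bsub>M\<^esub>"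
        using uL L_iff F1.M.minus_closed[OF y g(2)] by simp
      then show ?thesis
        unfolding h_def using mod_hom_minus[OF F1_module M uh y g(2)] mod_hom_closed[OF uh] y g(2)
        by - (rule M.eq_if_minus_eq_zero, auto)
    qed
    have "h \<in> mod_hom R K M"
    proof (rule mod_homI)
      fix k assume k: "k \<in> carrier K"
      show "h k \<in> carrier M" unfolding h_def by (rule mod_hom_closed[OF uh d1_gen(2)[OF k]])
      fix l assume l: "l \<in> carrier K"
      note kl = d1_gen[OF k] d1_gen[OF l]
      have "u (free_gen R k \<oplus>\<^bsub>F1\<^esub> free_gen R l) = h (k \<oplus>\<^bsub>K\<^esub> l)"
        by (rule hd1) (use k l kl mod_hom_add[OF d1_hom_K kl(2,4)] in auto)
      then show "h (k \<oplus>\<^bsub>K\<^esub> l) = h k \<oplus>\<^bsub>M\<^esub> h l"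
        using mod_hom_add[OF uh kl(2,4)] by (simp add: h_def)
    next
      fix r k assume r: "r \<in> carrier R" and k: "k \<in> carrier K"
      note k' = d1_gen[OF k]
      have "u (r \<odot>\<^bsub>F1\<^esub> free_gen R k) = h (r \<odot>\<^bsub>K\<^esub> k)"
        by (rule hd1) (use r k k' mod_hom_smult[OF d1_hom_K r k'(2)] in auto)
      then show "h (r \<odot>\<^bsub>K\<^esub> k) = r \<odot>\<^bsub>M\<^esub> h k"
        using mod_hom_smult[OF uh r k'(2)] by (simp add: h_def)
    qed
    then obtain g where g: "g \<in> mod_hom R F0 M" "\<And>k. k \<in> carrier K \<Longrightarrow> g k = h k"
      using extend by blast
    have "u = d1' (restrict g (carrier F0))"
    proof (rule extensionalityI[of _ "carrier F1"])
      fix y assume y: "y \<in> carrier F1"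
      then show "u y = d1' (restrict g (carrier F0)) y"
        using hd1[OF y mod_hom_closed[OF d1_hom_K y] refl] g(2)[OF mod_hom_closed[OF d1_hom_K y]]
          mod_hom_closed[OF d1_hom y]
        by (simp add: d1'_def compose_def)
    qed (use u in \<open>auto simp: d1'_def\<close>)
    then show "u \<in> d1' ` carrier (hom_mod R F0 M)"
      using restrict_mod_hom[OF F0_module g(1)] by blast
  qed
  finally show ?thesis .
qed

end

context cring
begin

text \<open>For GV-torsion-free \<open>M\<close> the condition \<open>Ext\<^sup>1(R/J, M) = 0\<close> amounts to extending homomorphisms from
  \<open>J\<close> to \<open>R\<close>.  Given \<open>g : J \<rightarrow> M\<close>, extend \<open>g \<circ> \<psi>\<close> from \<open>K\<close> to \<open>F\<^sub>0\<close> and evaluate at the basis element \<open>e\<close> of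
  the class of \<open>1\<close>; as \<open>\<psi> e = 1 + i\<close> with \<open>i \<in> J\<close>, the value has to be corrected by \<open>g i\<close>.
  Conversely let \<open>h : K \<rightarrow> M\<close>.  Since \<open>J F\<^sub>0 \<subseteq> K\<close>, for each \<open>x \<in> F\<^sub>0\<close> there is the homomorphism
  \<open>j \<mapsto> h (j x)\<close> on \<open>J\<close>.  It is multiplication by an element of \<open>M\<close>, which is unique because \<open>M\<close> is
  GV-torsion-free; so it depends linearly on \<open>x\<close>, and it extends \<open>h\<close>.\<close>

lemma w_module_iff:
  assumes M: "module R M"
  shows "w_module R M \<longleftrightarrow> GV_torsion_free R M \<and>
    (\<forall>J\<in>GV R. \<forall>g\<in>mod_hom R (ideal_mod R J) M. \<exists>m\<in>carrier M. \<forall>j\<in>J. g j = j \<odot>\<^bsub>M\<^esub> m)"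
proof -
  interpret M: module R M by fact
  have "carrier (Ext1 R (quot_by_ideal R J) M) = {\<zero>\<^bsub>Ext1 R (quot_by_ideal R J) M\<^esub>} \<longleftrightarrow>
      (\<forall>g\<in>mod_hom R (ideal_mod R J) M. \<exists>m\<in>carrier M. \<forall>j\<in>J. g j = j \<odot>\<^bsub>M\<^esub> m)"
    if tf: "GV_torsion_free R M" and J: "J \<in> GV R" for J
  proof -
    note JD = GV_D[OF J]
    interpret J: ideal J R by (rule JD)
    define N where "N = quot_by_ideal R J"
    have N: "module R N" using quot_by_ideal_module[OF JD(3)] by (simp add: N_def)
    interpret standard_resolution R N by (rule standard_resolutionI[OF N])
    have JK: "j \<odot>\<^bsub>F0\<^esub> x \<in> carrier K" if "j \<in> J" "x \<in> carrier F0" for j x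
      using mod_hom_smult[OF d0_hom J.Icarr[OF that(1)] that(2)] mod_hom_closed[OF d0_hom that(2)]
        quot_by_ideal_annihilated[OF JD(3) that(1), folded N_def] F0.smult_closed[OF J.Icarr[OF that(1)] that(2)]
      by (simp add: K_iff)
    show ?thesis
      unfolding N_def[symmetric] Ext1_trivial_iff[OF M]
    proof (intro iffI ballI)
      fix g assume ext: "\<forall>h\<in>mod_hom R K M. \<exists>g\<in>mod_hom R F0 M. \<forall>k\<in>carrier K. g k = h k"
        and g: "g \<in> mod_hom R (ideal_mod R J) M"
      obtain \<psi> where \<psi>: "\<psi> \<in> mod_hom R F0 (self_mod R)"
        "\<And>x. x \<in> carrier F0 \<Longrightarrow> residue J (\<psi> x) = d0 x" "\<And>x. x \<in> carrier K \<Longrightarrow> \<psi> x \<in> J"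
        using cover_quot_lift[OF JD(3), folded N_def] unfolding F0_def K_def d0_def by metis
      have "\<psi> \<in> mod_hom R K (ideal_mod R J)"
        using \<psi>(1,3) K_iff by (auto simp: mod_hom_def K_ops)
      from bspec[OF ext mod_hom_comp[OF this g]]
      obtain G where G: "G \<in> mod_hom R F0 M" "\<And>k. k \<in> carrier K \<Longrightarrow> G k = g (\<psi> k)" by blast
      define e where "e = free_gen R (residue J \<one>)"
      have N1: "residue J \<one> \<in> carrier N" by (simp add: N_def residue_closed)
      have e: "e \<in> carrier F0" "d0 e = residue J \<one>" using d0_gen[OF N1] by (simp_all add: e_def)
      have \<psi>e: "\<psi> e \<in> carrier R" using mod_hom_closed[OF \<psi>(1) e(1)] by simp
      define i where "i = \<psi> e \<ominus> \<one>"
      have "residue J (\<psi> e) = residue J \<one>"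
        using \<psi>(2)[OF e(1)] e(2) by simp
      then have i: "i \<in> J" using residue_eq_iff[OF JD(3) \<psi>e one_closed] by (simp add: i_def)
      have e_eq: "\<psi> e = \<one> \<oplus> i"
        using \<psi>e a_lcomm[of \<one> "\<psi> e" "\<ominus> \<one>"] by (simp add: i_def minus_eq r_neg)
      define m where "m = G e \<ominus>\<^bsub>M\<^esub> g i"
      have gi: "g i \<in> carrier M" and Ge: "G e \<in> carrier M"
        using mod_hom_closed[OF g] i mod_hom_closed[OF G(1) e(1)] by auto
      have "g j = j \<odot>\<^bsub>M\<^esub> m" if j: "j \<in> J" for j
      proof -
        have jR: "j \<in> carrier R" and iR: "i \<in> carrier R" using j i J.Icarr by auto
        have gj: "g j \<in> carrier M" using mod_hom_closed[OF g] j by simp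
        have "j \<odot>\<^bsub>M\<^esub> G e = g (\<psi> (j \<odot>\<^bsub>F0\<^esub> e))"
          using mod_hom_smult[OF G(1) jR e(1)] G(2)[OF JK[OF j e(1)]] by simp
        also have "\<psi> (j \<odot>\<^bsub>F0\<^esub> e) = j \<oplus> j \<otimes> i"
          using mod_hom_smult[OF \<psi>(1) jR e(1)] jR iR by (simp add: e_eq r_distr)
        also have "g (j \<oplus> j \<otimes> i) = g j \<oplus>\<^bsub>M\<^esub> j \<odot>\<^bsub>M\<^esub> g i"
          using mod_hom_add[OF g, of j "j \<otimes> i"] mod_hom_smult[OF g jR, of i] i j jR
          by (simp add: J.I_l_closed)
        finally have "j \<odot>\<^bsub>M\<^esub> m = (g j \<oplus>\<^bsub>M\<^esub> j \<odot>\<^bsub>M\<^esub> g i) \<oplus>\<^bsub>M\<^esub> \<ominus>\<^bsub>M\<^esub> (j \<odot>\<^bsub>M\<^esub> g i)"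
          using jR gi Ge by (simp add: m_def M.M.minus_eq M.smult_r_distr M.smult_r_minus)
        also have "\<dots> = g j" using gj gi jR by (simp add: M.M.a_assoc M.M.r_neg)
        finally show ?thesis by simp
      qed
      then show "\<exists>m\<in>carrier M. \<forall>j\<in>J. g j = j \<odot>\<^bsub>M\<^esub> m"
        using M.M.minus_closed[OF Ge gi] by (auto simp: m_def)
    next
      fix h assume ext: "\<forall>g\<in>mod_hom R (ideal_mod R J) M. \<exists>m\<in>carrier M. \<forall>j\<in>J. g j = j \<odot>\<^bsub>M\<^esub> m"
        and h: "h \<in> mod_hom R K M"
      have uniq: "m = m'"
        if "m \<in> carrier M" "m' \<in> carrier M" "\<And>j. j \<in> J \<Longrightarrow> j \<odot>\<^bsub>M\<^esub> m = j \<odot>\<^bsub>M\<^esub> m'" for m m'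
      proof (rule M.eq_if_minus_eq_zero[OF that(1,2)])
        show "m \<ominus>\<^bsub>M\<^esub> m' = \<zero>\<^bsub>M\<^esub>"
        proof (rule GV_torsion_freeD[OF tf J])
          fix j assume j: "j \<in> J"
          then show "j \<odot>\<^bsub>M\<^esub> (m \<ominus>\<^bsub>M\<^esub> m') = \<zero>\<^bsub>M\<^esub>"
            using that J.Icarr[OF j]
            by (simp add: M.M.minus_eq M.smult_r_distr M.smult_r_minus M.M.r_neg)
        qed (use that in simp)
      qed
      have "\<exists>m\<in>carrier M. \<forall>j\<in>J. h (j \<odot>\<^bsub>F0\<^esub> x) = j \<odot>\<^bsub>M\<^esub> m" if x: "x \<in> carrier F0" for x
      proof -
        have "h ((j \<oplus> k) \<odot>\<^bsub>F0\<^esub> x) = h (j \<odot>\<^bsub>F0\<^esub> x) \<oplus>\<^bsub>M\<^esub> h (k \<odot>\<^bsub>F0\<^esub> x)" if "j \<in> J" "k \<in> J" for j k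
          using mod_hom_add[OF h JK[OF that(1) x] JK[OF that(2) x]] that x J.Icarr
          by (simp add: F0.smult_l_distr K_ops)
        moreover have "h ((r \<otimes> j) \<odot>\<^bsub>F0\<^esub> x) = r \<odot>\<^bsub>M\<^esub> h (j \<odot>\<^bsub>F0\<^esub> x)" if "r \<in> carrier R" "j \<in> J" for r j
          using mod_hom_smult[OF h that(1) JK[OF that(2) x]] that x J.Icarr
          by (simp add: F0.smult_assoc1 K_ops)
        ultimately have "(\<lambda>j. h (j \<odot>\<^bsub>F0\<^esub> x)) \<in> mod_hom R (ideal_mod R J) M"
          using mod_hom_closed[OF h JK[OF _ x]] by (intro mod_homI) auto
        from bspec[OF ext this] show ?thesis .
      qed
      then obtain G where G: "\<And>x. x \<in> carrier F0 \<Longrightarrow> G x \<in> carrier M"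
        "\<And>x j. x \<in> carrier F0 \<Longrightarrow> j \<in> J \<Longrightarrow> h (j \<odot>\<^bsub>F0\<^esub> x) = j \<odot>\<^bsub>M\<^esub> G x" by metis
      have "G \<in> mod_hom R F0 M"
      proof (rule mod_homI)
        fix x y assume x: "x \<in> carrier F0" and y: "y \<in> carrier F0"
        show "G (x \<oplus>\<^bsub>F0\<^esub> y) = G x \<oplus>\<^bsub>M\<^esub> G y"
        proof (rule uniq)
          fix j assume j: "j \<in> J"
          have "h (j \<odot>\<^bsub>F0\<^esub> (x \<oplus>\<^bsub>F0\<^esub> y)) = h (j \<odot>\<^bsub>F0\<^esub> x) \<oplus>\<^bsub>M\<^esub> h (j \<odot>\<^bsub>F0\<^esub> y)"
            using mod_hom_add[OF h JK[OF j x] JK[OF j y]] J.Icarr[OF j] x y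
            by (simp add: F0.smult_r_distr K_ops)
          then show "j \<odot>\<^bsub>M\<^esub> G (x \<oplus>\<^bsub>F0\<^esub> y) = j \<odot>\<^bsub>M\<^esub> (G x \<oplus>\<^bsub>M\<^esub> G y)"
            using G J.Icarr[OF j] x y j F0.M.a_closed[OF x y] by (simp add: M.smult_r_distr)
        qed (use G x y in auto)
      next
        fix r x assume r: "r \<in> carrier R" and x: "x \<in> carrier F0"
        show "G (r \<odot>\<^bsub>F0\<^esub> x) = r \<odot>\<^bsub>M\<^esub> G x"
        proof (rule uniq)
          fix j assume j: "j \<in> J"
          have jR: "j \<in> carrier R" using j J.Icarr by simp
          have "j \<odot>\<^bsub>F0\<^esub> (r \<odot>\<^bsub>F0\<^esub> x) = r \<odot>\<^bsub>F0\<^esub> (j \<odot>\<^bsub>F0\<^esub> x)"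
            using jR r x F0.smult_assoc1[OF jR r x] F0.smult_assoc1[OF r jR x] by (simp add: m_comm)
          then have "h (j \<odot>\<^bsub>F0\<^esub> (r \<odot>\<^bsub>F0\<^esub> x)) = r \<odot>\<^bsub>M\<^esub> h (j \<odot>\<^bsub>F0\<^esub> x)"
            using mod_hom_smult[OF h r JK[OF j x]] by (simp add: K_ops)
          then have "j \<odot>\<^bsub>M\<^esub> G (r \<odot>\<^bsub>F0\<^esub> x) = r \<odot>\<^bsub>M\<^esub> (j \<odot>\<^bsub>M\<^esub> G x)"
            using G(2)[OF F0.smult_closed[OF r x] j] G(2)[OF x j] by simp
          then show "j \<odot>\<^bsub>M\<^esub> G (r \<odot>\<^bsub>F0\<^esub> x) = j \<odot>\<^bsub>M\<^esub> (r \<odot>\<^bsub>M\<^esub> G x)"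
            using M.smult_assoc1[OF jR r G(1)[OF x]] M.smult_assoc1[OF r jR G(1)[OF x]] jR r
            by (simp add: m_comm)
        qed (use G r x in auto)
      qed (rule G(1))
      moreover have "G k = h k" if k: "k \<in> carrier K" for k
      proof (rule uniq)
        fix j assume j: "j \<in> J"
        have "k \<in> carrier F0" using k K_iff by simp
        then show "j \<odot>\<^bsub>M\<^esub> G k = j \<odot>\<^bsub>M\<^esub> h k"
          using G(2)[OF _ j, of k] mod_hom_smult[OF h J.Icarr[OF j] k] by (simp add: K_ops)
      qed (use k K_iff G(1) mod_hom_closed[OF h k] in auto)
      ultimately show "\<exists>g\<in>mod_hom R F0 M. \<forall>k\<in>carrier K. g k = h k" by blast
    qed
  qed
  then show ?thesis using M by (auto simp: w_module_def)
qed

end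

section \<open>Maximal w-ideals and localization\<close>

context cring
begin

text \<open>If \<open>J \<subseteq> I\<close> is a GV-ideal, the inclusion \<open>J \<rightarrow> I\<close> is multiplication by some \<open>m \<in> I\<close>, and \<open>m = 1\<close> as \<open>J\<close>
  is dense.\<close>

lemma proper_w_ideal_GV_free:
  assumes "proper_w_ideal R I"
  shows "ideal I R" "\<not> contains_GV I"
proof -
  show I: "ideal I R" using assms by (simp add: proper_w_ideal_def)
  interpret ideal I R by (rule I)
  show "\<not> contains_GV I"
  proof
    assume "contains_GV I"
    then obtain J where J: "J \<in> GV R" "J \<subseteq> I" by (auto simp: contains_GV_def)
    have "(\<lambda>x. x) \<in> mod_hom R (ideal_mod R J) (ideal_mod R I)"
      using J(2) by (auto simp: mod_hom_def)
    then obtain m where m: "m \<in> I" "\<And>j. j \<in> J \<Longrightarrow> j = j \<otimes> m"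
      using assms J(1) w_module_iff[OF ideal_mod_module[OF I]]
      by (fastforce simp: proper_w_ideal_def)
    have "\<one> = m"
      by (rule dense_ideal_cancel[OF GV_D(2)[OF J(1)] one_closed Icarr[OF m(1)]])
        (use m Icarr GV_D(4)[OF J(1)] in \<open>metis l_one m_comm subsetD\<close>)
    then show False using assms m(1) one_imp_carrier by (auto simp: proper_w_ideal_def)
  qed
qed

text \<open>A homomorphism \<open>J \<rightarrow> P\<close> is multiplication by some \<open>r \<in> R\<close>.  Here \<open>r J \<subseteq> P\<close> with \<open>P\<close> prime and \<open>J\<close> not
  contained in \<open>P\<close>, so \<open>r \<in> P\<close>.\<close>

lemma max_GV_free_proper_w_ideal:
  assumes P: "max_GV_free P"
  shows "proper_w_ideal R P"
proof -
  note PD = max_GV_freeD[OF P]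
  interpret P: primeideal P R by (rule PD(1))
  have "w_module R (ideal_mod R P)"
    unfolding w_module_iff[OF ideal_mod_module[OF PD(2)]]
  proof (intro conjI ballI)
    show "GV_torsion_free R (ideal_mod R P)"
    proof (rule GV_torsion_freeI[OF ideal_mod_module[OF PD(2)]])
      fix J x assume "J \<in> GV R" "x \<in> carrier (ideal_mod R P)"
        "\<And>a. a \<in> J \<Longrightarrow> a \<odot>\<^bsub>ideal_mod R P\<^esub> x = \<zero>\<^bsub>ideal_mod R P\<^esub>"
      then show "x = \<zero>\<^bsub>ideal_mod R P\<^esub>"
        using GV_D(2)[of J] P.Icarr by (simp add: dense_ideal_iff)
    qed
  next
    fix J g assume J: "J \<in> GV R" and g: "g \<in> mod_hom R (ideal_mod R J) (ideal_mod R P)"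
    then have "g \<in> mod_hom R (ideal_mod R J) (self_mod R)"
      using P.Icarr by (auto simp: mod_hom_def Pi_def)
    then obtain r where r: "r \<in> carrier R" "\<And>x. x \<in> J \<Longrightarrow> g x = r \<otimes> x"
      using GV_extend[OF J] by blast
    obtain j where j: "j \<in> J" "j \<notin> P" using PD(3)[OF J] by auto
    have "r \<otimes> j \<in> P" using mod_hom_closed[OF g, of j] r(2) j by simp
    then have "r \<in> P" using P.I_prime r(1) j GV_D(4)[OF J] by blast
    moreover have "g x = x \<otimes> r" if "x \<in> J" for x
      using r that GV_D(4)[OF J] by (simp add: m_comm subset_iff)
    ultimately show "\<exists>m\<in>carrier (ideal_mod R P). \<forall>j\<in>J. g j = j \<odot>\<^bsub>ideal_mod R P\<^esub> m" by auto
  qed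
  then show ?thesis using PD(2) P.I_notcarr by (auto simp: proper_w_ideal_def)
qed

lemma w_Max_iff: "P \<in> w_Max R \<longleftrightarrow> max_GV_free P"
proof
  assume P: "P \<in> w_Max R"
  then have PD: "ideal P R" "\<not> contains_GV P"
    using proper_w_ideal_GV_free by (auto simp: w_Max_def)
  have "K = P" if K: "ideal K R" "P \<subseteq> K" "\<not> contains_GV K" for K
  proof -
    obtain Q where Q: "max_GV_free Q" "K \<subseteq> Q" using GV_free_subset_max[OF K(1,3)] by metis
    then have "Q = P" using max_GV_free_proper_w_ideal P K(2) by (auto simp: w_Max_def)
    then show ?thesis using K Q by auto
  qed
  then show "max_GV_free P" using PD by (simp add: max_GV_free_def)
next
  assume P: "max_GV_free P"
  then show "P \<in> w_Max R"
    using max_GV_free_proper_w_ideal[OF P] proper_w_ideal_GV_free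
    by (auto simp: w_Max_def max_GV_free_def)
qed

end

locale localization = module R M for R :: "('a, 'r) ring_scheme" (structure)
    and M :: "('a, 'm, 'p) module_scheme" +
  fixes S :: "'a set"
  assumes S_subset: "S \<subseteq> carrier R" and S_one: "\<one> \<in> S"
    and S_mult: "s \<in> S \<Longrightarrow> t \<in> S \<Longrightarrow> s \<otimes> t \<in> S"
begin

lemma S_carrier: "s \<in> S \<Longrightarrow> s \<in> carrier R"
  using S_subset by auto

lemma loc_frac_mem:
  "(y, t) \<in> loc_frac R S M x s \<longleftrightarrow>
    y \<in> carrier M \<and> t \<in> S \<and> (\<exists>u\<in>S. u \<odot>\<^bsub>M\<^esub> (t \<odot>\<^bsub>M\<^esub> x) = u \<odot>\<^bsub>M\<^esub> (s \<odot>\<^bsub>M\<^esub> y))"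
  by (simp add: loc_frac_def)

lemma loc_frac_self: "x \<in> carrier M \<Longrightarrow> s \<in> S \<Longrightarrow> (x, s) \<in> loc_frac R S M x s"
  using S_one by (auto simp: loc_frac_mem)

lemma loc_frac_subset:
  assumes x: "x \<in> carrier M" and y: "y \<in> carrier M" and s: "s \<in> S" and t: "t \<in> S" and u: "u \<in> S"
    and eq: "u \<odot>\<^bsub>M\<^esub> (t \<odot>\<^bsub>M\<^esub> x) = u \<odot>\<^bsub>M\<^esub> (s \<odot>\<^bsub>M\<^esub> y)"
  shows "loc_frac R S M x s \<subseteq> loc_frac R S M y t"
proof clarify
  fix z r assume "(z, r) \<in> loc_frac R S M x s"
  then obtain v where z: "z \<in> carrier M" and r: "r \<in> S" and v: "v \<in> S"
    "v \<odot>\<^bsub>M\<^esub> (r \<odot>\<^bsub>M\<^esub> x) = v \<odot>\<^bsub>M\<^esub> (s \<odot>\<^bsub>M\<^esub> z)" by (auto simp: loc_frac_mem)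
  note c = S_carrier[OF s] S_carrier[OF t] S_carrier[OF u] S_carrier[OF r] S_carrier[OF v(1)]
  have "(u \<otimes> v \<otimes> s) \<odot>\<^bsub>M\<^esub> (r \<odot>\<^bsub>M\<^esub> y) = (v \<otimes> r) \<odot>\<^bsub>M\<^esub> (u \<odot>\<^bsub>M\<^esub> (s \<odot>\<^bsub>M\<^esub> y))"
    using c y by (simp add: m_ac flip: smult_assoc1)
  also have "\<dots> = (u \<otimes> t) \<odot>\<^bsub>M\<^esub> (v \<odot>\<^bsub>M\<^esub> (r \<odot>\<^bsub>M\<^esub> x))"
    unfolding eq[symmetric] using c x by (simp add: m_ac flip: smult_assoc1)
  also have "\<dots> = (u \<otimes> v \<otimes> s) \<odot>\<^bsub>M\<^esub> (t \<odot>\<^bsub>M\<^esub> z)"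
    unfolding v(2) using c z by (simp add: m_ac flip: smult_assoc1)
  finally show "(z, r) \<in> loc_frac R S M y t"
    using z r u v(1) s S_mult by (auto simp: loc_frac_mem)
qed

lemma loc_frac_eq_iff:
  assumes "x \<in> carrier M" "y \<in> carrier M" "s \<in> S" "t \<in> S"
  shows "loc_frac R S M x s = loc_frac R S M y t \<longleftrightarrow>
    (\<exists>u\<in>S. u \<odot>\<^bsub>M\<^esub> (t \<odot>\<^bsub>M\<^esub> x) = u \<odot>\<^bsub>M\<^esub> (s \<odot>\<^bsub>M\<^esub> y))"
proof
  assume "loc_frac R S M x s = loc_frac R S M y t"
  then have "(y, t) \<in> loc_frac R S M x s" using loc_frac_self assms by simp
  then show "\<exists>u\<in>S. u \<odot>\<^bsub>M\<^esub> (t \<odot>\<^bsub>M\<^esub> x) = u \<odot>\<^bsub>M\<^esub> (s \<odot>\<^bsub>M\<^esub> y)" by (simp add: loc_frac_mem)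
next
  assume "\<exists>u\<in>S. u \<odot>\<^bsub>M\<^esub> (t \<odot>\<^bsub>M\<^esub> x) = u \<odot>\<^bsub>M\<^esub> (s \<odot>\<^bsub>M\<^esub> y)"
  then obtain u where u: "u \<in> S" "u \<odot>\<^bsub>M\<^esub> (t \<odot>\<^bsub>M\<^esub> x) = u \<odot>\<^bsub>M\<^esub> (s \<odot>\<^bsub>M\<^esub> y)" by blast
  show "loc_frac R S M x s = loc_frac R S M y t"
    using loc_frac_subset[OF assms u]
      loc_frac_subset[OF assms(2,1,4,3) u(1) u(2)[symmetric]] by simp
qed

lemma loc_mod_carrier:
  "carrier (loc_mod R S M) = {loc_frac R S M x s | x s. x \<in> carrier M \<and> s \<in> S}"
  by (simp add: loc_mod_def)

lemma loc_frac_closed: "x \<in> carrier M \<Longrightarrow> s \<in> S \<Longrightarrow> loc_frac R S M x s \<in> carrier (loc_mod R S M)"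
  by (auto simp: loc_mod_carrier)

lemma loc_map_frac:
  assumes N: "module R N" and f: "f \<in> mod_hom R M N" and x: "x \<in> carrier M" and s: "s \<in> S"
  shows "loc_map R S N f (loc_frac R S M x s) = loc_frac R S N (f x) s"
proof -
  interpret N: localization R N S
    using N S_subset S_one S_mult by (simp add: localization_def localization_axioms_def)
  have "loc_frac R S N (f y) t = loc_frac R S N (f x) s" if yt: "(y, t) \<in> loc_frac R S M x s" for y t
  proof -
    obtain u where u: "y \<in> carrier M" "t \<in> S" "u \<in> S"
      "u \<odot>\<^bsub>M\<^esub> (t \<odot>\<^bsub>M\<^esub> x) = u \<odot>\<^bsub>M\<^esub> (s \<odot>\<^bsub>M\<^esub> y)" using yt unfolding loc_frac_mem by blast
    have "u \<odot>\<^bsub>N\<^esub> (t \<odot>\<^bsub>N\<^esub> f x) = u \<odot>\<^bsub>N\<^esub> (s \<odot>\<^bsub>N\<^esub> f y)"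
      using arg_cong[OF u(4), of f] u(1-3) S_carrier s x by (simp add: mod_hom_smult[OF f])
    then show ?thesis
      using N.loc_frac_eq_iff[of "f x" "f y" s t] mod_hom_closed[OF f] x s u by auto
  qed
  then have "(\<Union>q\<in>loc_frac R S M x s. case q of (y, t) \<Rightarrow> loc_frac R S N (f y) t) =
      loc_frac R S N (f x) s"
    by (intro UN_constant_eq[OF loc_frac_self[OF x s]]) auto
  then show ?thesis by (simp add: loc_map_def)
qed

lemma loc_map_inj:
  assumes N: "module R N" and f: "f \<in> mod_hom R M N" and inj: "inj_on f (carrier M)"
  shows "inj_on (loc_map R S N f) (carrier (loc_mod R S M))"
proof (rule inj_onI)
  interpret N: localization R N S
    using N S_subset S_one S_mult by (simp add: localization_def localization_axioms_def)
  fix X Y assume "X \<in> carrier (loc_mod R S M)" "Y \<in> carrier (loc_mod R S M)"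
    and eq: "loc_map R S N f X = loc_map R S N f Y"
  then obtain x s y t where X: "x \<in> carrier M" "s \<in> S" "X = loc_frac R S M x s"
    and Y: "y \<in> carrier M" "t \<in> S" "Y = loc_frac R S M y t" by (auto simp: loc_mod_carrier)
  have "loc_frac R S N (f x) s = loc_frac R S N (f y) t"
    using eq X Y by (simp add: loc_map_frac[OF N f])
  then obtain u where u: "u \<in> S" "u \<odot>\<^bsub>N\<^esub> (t \<odot>\<^bsub>N\<^esub> f x) = u \<odot>\<^bsub>N\<^esub> (s \<odot>\<^bsub>N\<^esub> f y)"
    using N.loc_frac_eq_iff mod_hom_closed[OF f] X Y by blast
  have "f (u \<odot>\<^bsub>M\<^esub> (t \<odot>\<^bsub>M\<^esub> x)) = f (u \<odot>\<^bsub>M\<^esub> (s \<odot>\<^bsub>M\<^esub> y))"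
    using u X Y S_carrier by (simp add: mod_hom_smult[OF f])
  then have "u \<odot>\<^bsub>M\<^esub> (t \<odot>\<^bsub>M\<^esub> x) = u \<odot>\<^bsub>M\<^esub> (s \<odot>\<^bsub>M\<^esub> y)"
    using inj_onD[OF inj] u X Y S_carrier by auto
  then show "X = Y" using X Y u(1) loc_frac_eq_iff by auto
qed

lemma loc_mod_smult:
  assumes a: "a \<in> carrier R" and s: "s \<in> S" and x: "x \<in> carrier M" and t: "t \<in> S"
  shows "loc_frac R S (self_mod R) a s \<odot>\<^bsub>loc_mod R S M\<^esub> loc_frac R S M x t =
    loc_frac R S M (a \<odot>\<^bsub>M\<^esub> x) (s \<otimes> t)"
proof -
  interpret R: localization R "self_mod R" S
    using self_mod_module S_subset S_one S_mult by (simp add: localization_def localization_axioms_def)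
  have eq: "loc_frac R S M (a' \<odot>\<^bsub>M\<^esub> x') (s' \<otimes> t') = loc_frac R S M (a \<odot>\<^bsub>M\<^esub> x) (s \<otimes> t)"
    if m: "(a', s') \<in> loc_frac R S (self_mod R) a s" "(x', t') \<in> loc_frac R S M x t" for a' s' x' t'
  proof -
    obtain u where u: "a' \<in> carrier R" "s' \<in> S" "u \<in> S" "u \<otimes> (s' \<otimes> a) = u \<otimes> (s \<otimes> a')"
      using m(1) unfolding R.loc_frac_mem self_mod_simps by blast
    obtain v where v: "x' \<in> carrier M" "t' \<in> S" "v \<in> S"
      "v \<odot>\<^bsub>M\<^esub> (t' \<odot>\<^bsub>M\<^esub> x) = v \<odot>\<^bsub>M\<^esub> (t \<odot>\<^bsub>M\<^esub> x')"
      using m(2) unfolding loc_frac_mem by blast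
    note c = a x S_carrier[OF s] S_carrier[OF t] u(1) v(1) S_carrier[OF u(2)] S_carrier[OF u(3)]
      S_carrier[OF v(2)] S_carrier[OF v(3)]
    have "(u \<otimes> v) \<odot>\<^bsub>M\<^esub> ((s' \<otimes> t') \<odot>\<^bsub>M\<^esub> (a \<odot>\<^bsub>M\<^esub> x)) = (u \<otimes> (s' \<otimes> a)) \<odot>\<^bsub>M\<^esub> (v \<odot>\<^bsub>M\<^esub> (t' \<odot>\<^bsub>M\<^esub> x))"
      using c by (simp add: m_ac flip: smult_assoc1)
    also have "\<dots> = (u \<otimes> v) \<odot>\<^bsub>M\<^esub> ((s \<otimes> t) \<odot>\<^bsub>M\<^esub> (a' \<odot>\<^bsub>M\<^esub> x'))"
      unfolding u(4) v(4) using c by (simp add: m_ac flip: smult_assoc1)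
    finally have "\<exists>w\<in>S. w \<odot>\<^bsub>M\<^esub> ((s' \<otimes> t') \<odot>\<^bsub>M\<^esub> (a \<odot>\<^bsub>M\<^esub> x)) = w \<odot>\<^bsub>M\<^esub> ((s \<otimes> t) \<odot>\<^bsub>M\<^esub> (a' \<odot>\<^bsub>M\<^esub> x'))"
      using S_mult[OF u(3) v(3)] by blast
    then show ?thesis
      using loc_frac_eq_iff[of "a \<odot>\<^bsub>M\<^esub> x" "a' \<odot>\<^bsub>M\<^esub> x'" "s \<otimes> t" "s' \<otimes> t'"] c s t u v S_mult by simp
  qed
  have "(\<Union>q\<in>loc_frac R S M x t. case q of (x', t') \<Rightarrow> loc_frac R S M (a' \<odot>\<^bsub>M\<^esub> x') (s' \<otimes> t')) =
      loc_frac R S M (a \<odot>\<^bsub>M\<^esub> x) (s \<otimes> t)" if "(a', s') \<in> loc_frac R S (self_mod R) a s" for a' s'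
    using eq[OF that] by (intro UN_constant_eq[OF loc_frac_self[OF x t]]) auto
  then have "(\<Union>p\<in>loc_frac R S (self_mod R) a s. case p of (a', s') \<Rightarrow>
      \<Union>q\<in>loc_frac R S M x t. case q of (x', t') \<Rightarrow> loc_frac R S M (a' \<odot>\<^bsub>M\<^esub> x') (s' \<otimes> t')) =
      loc_frac R S M (a \<odot>\<^bsub>M\<^esub> x) (s \<otimes> t)"
    using R.loc_frac_self[of a s] a s by (intro UN_constant_eq[of "(a, s)"]) auto
  then show ?thesis by (simp add: loc_mod_def)
qed

lemma loc_mod_add:
  assumes x: "x \<in> carrier M" and s: "s \<in> S" and y: "y \<in> carrier M" and t: "t \<in> S"
  shows "loc_frac R S M x s \<oplus>\<^bsub>loc_mod R S M\<^esub> loc_frac R S M y t =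
    loc_frac R S M (t \<odot>\<^bsub>M\<^esub> x \<oplus>\<^bsub>M\<^esub> s \<odot>\<^bsub>M\<^esub> y) (s \<otimes> t)"
proof -
  have eq: "loc_frac R S M (t' \<odot>\<^bsub>M\<^esub> x' \<oplus>\<^bsub>M\<^esub> s' \<odot>\<^bsub>M\<^esub> y') (s' \<otimes> t') =
      loc_frac R S M (t \<odot>\<^bsub>M\<^esub> x \<oplus>\<^bsub>M\<^esub> s \<odot>\<^bsub>M\<^esub> y) (s \<otimes> t)"
    if m: "(x', s') \<in> loc_frac R S M x s" "(y', t') \<in> loc_frac R S M y t" for x' s' y' t'
  proof -
    obtain u where u: "x' \<in> carrier M" "s' \<in> S" "u \<in> S"
      "u \<odot>\<^bsub>M\<^esub> (s' \<odot>\<^bsub>M\<^esub> x) = u \<odot>\<^bsub>M\<^esub> (s \<odot>\<^bsub>M\<^esub> x')"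
      using m(1) unfolding loc_frac_mem by blast
    obtain v where v: "y' \<in> carrier M" "t' \<in> S" "v \<in> S"
      "v \<odot>\<^bsub>M\<^esub> (t' \<odot>\<^bsub>M\<^esub> y) = v \<odot>\<^bsub>M\<^esub> (t \<odot>\<^bsub>M\<^esub> y')"
      using m(2) unfolding loc_frac_mem by blast
    note c = y x S_carrier[OF s] S_carrier[OF t] u(1) v(1) S_carrier[OF u(2)] S_carrier[OF u(3)]
      S_carrier[OF v(2)] S_carrier[OF v(3)]
    have "(u \<otimes> v) \<odot>\<^bsub>M\<^esub> ((s' \<otimes> t') \<odot>\<^bsub>M\<^esub> (t \<odot>\<^bsub>M\<^esub> x \<oplus>\<^bsub>M\<^esub> s \<odot>\<^bsub>M\<^esub> y)) =
        (v \<otimes> t \<otimes> t') \<odot>\<^bsub>M\<^esub> (u \<odot>\<^bsub>M\<^esub> (s' \<odot>\<^bsub>M\<^esub> x)) \<oplus>\<^bsub>M\<^esub> (u \<otimes> s \<otimes> s') \<odot>\<^bsub>M\<^esub> (v \<odot>\<^bsub>M\<^esub> (t' \<odot>\<^bsub>M\<^esub> y))"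
      using c by (simp add: m_ac smult_r_distr flip: smult_assoc1)
    also have "\<dots> = (u \<otimes> v) \<odot>\<^bsub>M\<^esub> ((s \<otimes> t) \<odot>\<^bsub>M\<^esub> (t' \<odot>\<^bsub>M\<^esub> x' \<oplus>\<^bsub>M\<^esub> s' \<odot>\<^bsub>M\<^esub> y'))"
      unfolding u(4) v(4) using c by (simp add: m_ac smult_r_distr flip: smult_assoc1)
    finally have "\<exists>w\<in>S. w \<odot>\<^bsub>M\<^esub> ((s' \<otimes> t') \<odot>\<^bsub>M\<^esub> (t \<odot>\<^bsub>M\<^esub> x \<oplus>\<^bsub>M\<^esub> s \<odot>\<^bsub>M\<^esub> y)) =
        w \<odot>\<^bsub>M\<^esub> ((s \<otimes> t) \<odot>\<^bsub>M\<^esub> (t' \<odot>\<^bsub>M\<^esub> x' \<oplus>\<^bsub>M\<^esub> s' \<odot>\<^bsub>M\<^esub> y'))"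
      using S_mult[OF u(3) v(3)] by blast
    then show ?thesis
      using loc_frac_eq_iff[of "t \<odot>\<^bsub>M\<^esub> x \<oplus>\<^bsub>M\<^esub> s \<odot>\<^bsub>M\<^esub> y" "t' \<odot>\<^bsub>M\<^esub> x' \<oplus>\<^bsub>M\<^esub> s' \<odot>\<^bsub>M\<^esub> y'" "s \<otimes> t" "s' \<otimes> t'"]
        c s t u v S_mult by simp
  qed
  have "(\<Union>q\<in>loc_frac R S M y t. case q of (y', t') \<Rightarrow>
      loc_frac R S M (t' \<odot>\<^bsub>M\<^esub> x' \<oplus>\<^bsub>M\<^esub> s' \<odot>\<^bsub>M\<^esub> y') (s' \<otimes> t')) =
      loc_frac R S M (t \<odot>\<^bsub>M\<^esub> x \<oplus>\<^bsub>M\<^esub> s \<odot>\<^bsub>M\<^esub> y) (s \<otimes> t)" if "(x', s') \<in> loc_frac R S M x s" for x' s'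
    using eq[OF that] by (intro UN_constant_eq[OF loc_frac_self[OF y t]]) auto
  then have "(\<Union>p\<in>loc_frac R S M x s. case p of (x', s') \<Rightarrow> \<Union>q\<in>loc_frac R S M y t. case q of (y', t') \<Rightarrow>
      loc_frac R S M (t' \<odot>\<^bsub>M\<^esub> x' \<oplus>\<^bsub>M\<^esub> s' \<odot>\<^bsub>M\<^esub> y') (s' \<otimes> t')) =
      loc_frac R S M (t \<odot>\<^bsub>M\<^esub> x \<oplus>\<^bsub>M\<^esub> s \<odot>\<^bsub>M\<^esub> y) (s \<otimes> t)"
    by (intro UN_constant_eq[OF loc_frac_self[OF x s]]) auto
  then show ?thesis by (simp add: loc_mod_def)
qed

text \<open>\<open>S\<^sup>-\<^sup>1M\<close> as a module over \<open>R\<close> rather than over \<open>S\<^sup>-\<^sup>1R\<close>: the conditions on GV-ideals and \<open>\<Q>\<close> concern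
  \<open>R\<close>-modules.\<close>

definition fraction_mod :: "('a, ('m \<times> 'a) set) module" where
  "fraction_mod = \<lparr>carrier = carrier (loc_mod R S M), mult = undefined, one = undefined,
     zero = loc_frac R S M \<zero>\<^bsub>M\<^esub> \<one>, add = add (loc_mod R S M),
     smult = (\<lambda>r X. loc_frac R S (self_mod R) r \<one> \<odot>\<^bsub>loc_mod R S M\<^esub> X)\<rparr>"

abbreviation fraction :: "'m \<Rightarrow> 'a \<Rightarrow> ('m \<times> 'a) set" where
  "fraction x s \<equiv> loc_frac R S M x s"

lemma fraction_cancel:
  assumes "x \<in> carrier M" "s \<in> S" "t \<in> S"
  shows "fraction (t \<odot>\<^bsub>M\<^esub> x) (t \<otimes> s) = fraction x s"
    and "fraction (t \<odot>\<^bsub>M\<^esub> x) (s \<otimes> t) = fraction x s"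
proof -
  have "\<one> \<odot>\<^bsub>M\<^esub> (s \<odot>\<^bsub>M\<^esub> (t \<odot>\<^bsub>M\<^esub> x)) = \<one> \<odot>\<^bsub>M\<^esub> ((t \<otimes> s) \<odot>\<^bsub>M\<^esub> x)"
    using assms S_carrier by (simp add: m_comm flip: smult_assoc1)
  then show "fraction (t \<odot>\<^bsub>M\<^esub> x) (t \<otimes> s) = fraction x s"
    using loc_frac_eq_iff[of "t \<odot>\<^bsub>M\<^esub> x" x "t \<otimes> s" s] assms S_one S_mult S_carrier by blast
  then show "fraction (t \<odot>\<^bsub>M\<^esub> x) (s \<otimes> t) = fraction x s"
    using m_comm[of s t] assms S_carrier by simp
qed

lemma fraction_mod_smult:
  "r \<in> carrier R \<Longrightarrow> x \<in> carrier M \<Longrightarrow> s \<in> S \<Longrightarrow> r \<odot>\<^bsub>fraction_mod\<^esub> fraction x s = fraction (r \<odot>\<^bsub>M\<^esub> x) s"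
  using loc_mod_smult[of r \<one> x s] S_one S_carrier by (simp add: fraction_mod_def)

lemma fraction_mod_add:
  assumes "x \<in> carrier M" "y \<in> carrier M" "s \<in> S"
  shows "fraction x s \<oplus>\<^bsub>fraction_mod\<^esub> fraction y s = fraction (x \<oplus>\<^bsub>M\<^esub> y) s"
  using loc_mod_add[of x s y s] fraction_cancel[of "x \<oplus>\<^bsub>M\<^esub> y" s s] assms S_carrier
  by (simp add: fraction_mod_def smult_r_distr)

lemma fraction_mod_zero: "s \<in> S \<Longrightarrow> \<zero>\<^bsub>fraction_mod\<^esub> = fraction \<zero>\<^bsub>M\<^esub> s"
  using fraction_cancel[of "\<zero>\<^bsub>M\<^esub>" \<one> s] S_one S_carrier by (simp add: fraction_mod_def)

lemma fraction_mod_carrier: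
  "X \<in> carrier fraction_mod \<longleftrightarrow> (\<exists>x s. x \<in> carrier M \<and> s \<in> S \<and> X = fraction x s)"
  by (auto simp: fraction_mod_def loc_mod_carrier)

lemma common_denominator:
  assumes "X \<in> carrier fraction_mod" "Y \<in> carrier fraction_mod"
  obtains x y s where "x \<in> carrier M" "y \<in> carrier M" "s \<in> S" "X = fraction x s" "Y = fraction y s"
proof -
  obtain x s y t where x: "x \<in> carrier M" "s \<in> S" "X = fraction x s"
    and y: "y \<in> carrier M" "t \<in> S" "Y = fraction y t"
    using assms unfolding fraction_mod_carrier by blast
  show ?thesis
    by (rule that[of "t \<odot>\<^bsub>M\<^esub> x" "s \<odot>\<^bsub>M\<^esub> y" "s \<otimes> t"])
      (use x y S_mult S_carrier fraction_cancel(2)[OF x(1,2) y(2)] fraction_cancel(1)[OF y(1,2) x(2)]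
        in simp_all)
qed

lemma fraction_mod_module: "module R fraction_mod"
proof -
  have "abelian_group fraction_mod"
  proof (rule abelian_groupI)
    fix X Y assume "X \<in> carrier fraction_mod" "Y \<in> carrier fraction_mod"
    then obtain x y s where *: "x \<in> carrier M" "y \<in> carrier M" "s \<in> S" "X = fraction x s" "Y = fraction y s"
      by (rule common_denominator)
    then show "X \<oplus>\<^bsub>fraction_mod\<^esub> Y \<in> carrier fraction_mod"
      "X \<oplus>\<^bsub>fraction_mod\<^esub> Y = Y \<oplus>\<^bsub>fraction_mod\<^esub> X"
      by (auto simp: fraction_mod_add fraction_mod_carrier M.a_comm intro!: M.a_closed)
    fix Z assume "Z \<in> carrier fraction_mod"
    then obtain z t where z: "z \<in> carrier M" "t \<in> S" "Z = fraction z t"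
      unfolding fraction_mod_carrier by blast
    have "X = fraction (t \<odot>\<^bsub>M\<^esub> x) (s \<otimes> t)" "Y = fraction (t \<odot>\<^bsub>M\<^esub> y) (s \<otimes> t)"
      "Z = fraction (s \<odot>\<^bsub>M\<^esub> z) (s \<otimes> t)"
      using fraction_cancel(2)[OF *(1,3) z(2)] fraction_cancel(2)[OF *(2,3) z(2)]
        fraction_cancel(1)[OF z(1,2) *(3)] * z by simp_all
    then show "X \<oplus>\<^bsub>fraction_mod\<^esub> Y \<oplus>\<^bsub>fraction_mod\<^esub> Z = X \<oplus>\<^bsub>fraction_mod\<^esub> (Y \<oplus>\<^bsub>fraction_mod\<^esub> Z)"
      using * z S_carrier S_mult by (simp add: fraction_mod_add M.a_assoc)
  next
    show "\<zero>\<^bsub>fraction_mod\<^esub> \<in> carrier fraction_mod"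
      using fraction_mod_zero[OF S_one] S_one fraction_mod_carrier by blast
  next
    fix X assume "X \<in> carrier fraction_mod"
    then obtain x s where *: "x \<in> carrier M" "s \<in> S" "X = fraction x s"
      unfolding fraction_mod_carrier by blast
    then show "\<zero>\<^bsub>fraction_mod\<^esub> \<oplus>\<^bsub>fraction_mod\<^esub> X = X"
      by (simp add: fraction_mod_zero[OF *(2)] fraction_mod_add)
    show "\<exists>Y\<in>carrier fraction_mod. Y \<oplus>\<^bsub>fraction_mod\<^esub> X = \<zero>\<^bsub>fraction_mod\<^esub>"
      using * by (intro bexI[of _ "fraction (\<ominus>\<^bsub>M\<^esub> x) s"])
        (auto simp: fraction_mod_zero[OF *(2)] fraction_mod_add M.l_neg fraction_mod_carrier)
  qed
  then show ?thesis
  proof (rule moduleI[OF is_cring])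
    fix a X assume a: "a \<in> carrier R" and X: "X \<in> carrier fraction_mod"
    then obtain x s where *: "x \<in> carrier M" "s \<in> S" "X = fraction x s"
      unfolding fraction_mod_carrier by blast
    show "a \<odot>\<^bsub>fraction_mod\<^esub> X \<in> carrier fraction_mod"
      using * a by (auto simp: fraction_mod_smult fraction_mod_carrier)
    fix b assume b: "b \<in> carrier R"
    show "(a \<oplus> b) \<odot>\<^bsub>fraction_mod\<^esub> X = a \<odot>\<^bsub>fraction_mod\<^esub> X \<oplus>\<^bsub>fraction_mod\<^esub> b \<odot>\<^bsub>fraction_mod\<^esub> X"
      "a \<otimes> b \<odot>\<^bsub>fraction_mod\<^esub> X = a \<odot>\<^bsub>fraction_mod\<^esub> (b \<odot>\<^bsub>fraction_mod\<^esub> X)"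
      using * a b by (simp_all add: fraction_mod_smult fraction_mod_add smult_l_distr smult_assoc1)
  next
    fix X assume "X \<in> carrier fraction_mod"
    then show "\<one> \<odot>\<^bsub>fraction_mod\<^esub> X = X"
      unfolding fraction_mod_carrier by (auto simp: fraction_mod_smult)
  next
    fix a X Y assume a: "a \<in> carrier R" and "X \<in> carrier fraction_mod" "Y \<in> carrier fraction_mod"
    from this(2,3) obtain x y s
      where *: "x \<in> carrier M" "y \<in> carrier M" "s \<in> S" "X = fraction x s" "Y = fraction y s"
      by (rule common_denominator)
    then show "a \<odot>\<^bsub>fraction_mod\<^esub> (X \<oplus>\<^bsub>fraction_mod\<^esub> Y) =
        a \<odot>\<^bsub>fraction_mod\<^esub> X \<oplus>\<^bsub>fraction_mod\<^esub> a \<odot>\<^bsub>fraction_mod\<^esub> Y"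
      using a by (simp add: fraction_mod_smult fraction_mod_add smult_r_distr)
  qed
qed

lemma fraction_mod_divide:
  assumes s: "s \<in> S" and X: "X \<in> carrier fraction_mod"
  obtains Y where "Y \<in> carrier fraction_mod" "s \<odot>\<^bsub>fraction_mod\<^esub> Y = X"
proof -
  obtain x t where *: "x \<in> carrier M" "t \<in> S" "X = fraction x t"
    using X unfolding fraction_mod_carrier by blast
  show ?thesis
  proof (rule that)
    show "fraction x (s \<otimes> t) \<in> carrier fraction_mod"
      using * s S_mult unfolding fraction_mod_carrier by blast
    show "s \<odot>\<^bsub>fraction_mod\<^esub> fraction x (s \<otimes> t) = X"
      using * s S_mult S_carrier by (simp add: fraction_mod_smult fraction_cancel)
  qed
qed

lemma fraction_mod_cancel:
  assumes s: "s \<in> S" and X: "X \<in> carrier fraction_mod" and Y: "Y \<in> carrier fraction_mod"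
    and eq: "s \<odot>\<^bsub>fraction_mod\<^esub> X = s \<odot>\<^bsub>fraction_mod\<^esub> Y"
  shows "X = Y"
proof -
  obtain x y t where *: "x \<in> carrier M" "y \<in> carrier M" "t \<in> S" "X = fraction x t" "Y = fraction y t"
    using common_denominator[OF X Y] .
  then have "fraction (s \<odot>\<^bsub>M\<^esub> x) t = fraction (s \<odot>\<^bsub>M\<^esub> y) t"
    using eq s S_carrier by (simp add: fraction_mod_smult)
  then obtain u where u: "u \<in> S" "u \<odot>\<^bsub>M\<^esub> (t \<odot>\<^bsub>M\<^esub> (s \<odot>\<^bsub>M\<^esub> x)) = u \<odot>\<^bsub>M\<^esub> (t \<odot>\<^bsub>M\<^esub> (s \<odot>\<^bsub>M\<^esub> y))"
    using loc_frac_eq_iff[of "s \<odot>\<^bsub>M\<^esub> x" "s \<odot>\<^bsub>M\<^esub> y" t t] * s S_carrier by auto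
  then have "(u \<otimes> s) \<odot>\<^bsub>M\<^esub> (t \<odot>\<^bsub>M\<^esub> x) = (u \<otimes> s) \<odot>\<^bsub>M\<^esub> (t \<odot>\<^bsub>M\<^esub> y)"
    using * s S_carrier by (simp add: m_ac flip: smult_assoc1)
  then show ?thesis
    unfolding *(4,5) using loc_frac_eq_iff[OF *(1,2,3,3)] S_mult[OF u(1) s] by blast
qed

text \<open>Elements of \<open>S\<close> act bijectively on \<open>S\<^sup>-\<^sup>1M\<close>.  If \<open>s \<in> J \<inter> S\<close> and \<open>g : J \<rightarrow> S\<^sup>-\<^sup>1M\<close>, then
  \<open>s g(j) = j g(s)\<close> shows that \<open>g\<close> is multiplication by \<open>g(s)/s\<close>.\<close>

lemma fraction_mod_w_module:
  assumes meets: "\<And>J. J \<in> GV R \<Longrightarrow> J \<inter> S \<noteq> {}"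
  shows "w_module R fraction_mod"
  unfolding w_module_iff[OF fraction_mod_module]
proof (intro conjI ballI)
  interpret K: module R fraction_mod by (rule fraction_mod_module)
  show "GV_torsion_free R fraction_mod"
  proof (rule GV_torsion_freeI[OF fraction_mod_module])
    fix J X assume "J \<in> GV R" and X: "X \<in> carrier fraction_mod"
      and 0: "\<And>a. a \<in> J \<Longrightarrow> a \<odot>\<^bsub>fraction_mod\<^esub> X = \<zero>\<^bsub>fraction_mod\<^esub>"
    then obtain s where s: "s \<in> J" "s \<in> S" using meets by blast
    then show "X = \<zero>\<^bsub>fraction_mod\<^esub>"
      using 0[OF s(1)] S_carrier[OF s(2)] by (intro fraction_mod_cancel[OF s(2) X]) auto
  qed
  fix J g assume J: "J \<in> GV R" and g: "g \<in> mod_hom R (ideal_mod R J) fraction_mod"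
  then obtain s where s: "s \<in> J" "s \<in> S" using meets by blast
  have sR: "s \<in> carrier R" using S_carrier s by simp
  obtain Y where Y: "Y \<in> carrier fraction_mod" "s \<odot>\<^bsub>fraction_mod\<^esub> Y = g s"
    using fraction_mod_divide[OF s(2)] mod_hom_closed[OF g] s(1) by auto
  have "g j = j \<odot>\<^bsub>fraction_mod\<^esub> Y" if j: "j \<in> J" for j
  proof (rule fraction_mod_cancel[OF s(2)])
    have jR: "j \<in> carrier R" using j GV_D(4)[OF J] by auto
    show "g j \<in> carrier fraction_mod" using mod_hom_closed[OF g] j by simp
    show "j \<odot>\<^bsub>fraction_mod\<^esub> Y \<in> carrier fraction_mod" using jR Y(1) by simp
    have "s \<odot>\<^bsub>fraction_mod\<^esub> g j = j \<odot>\<^bsub>fraction_mod\<^esub> g s"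
      using mod_hom_smult[OF g sR, of j] mod_hom_smult[OF g jR, of s] s(1) j jR sR
      by (simp add: m_comm)
    also have "\<dots> = s \<odot>\<^bsub>fraction_mod\<^esub> (j \<odot>\<^bsub>fraction_mod\<^esub> Y)"
      unfolding Y(2)[symmetric] using jR sR Y(1) by (simp add: m_comm flip: K.smult_assoc1)
    finally show "s \<odot>\<^bsub>fraction_mod\<^esub> g j = s \<odot>\<^bsub>fraction_mod\<^esub> (j \<odot>\<^bsub>fraction_mod\<^esub> Y)" .
  qed
  then show "\<exists>m\<in>carrier fraction_mod. \<forall>j\<in>J. g j = j \<odot>\<^bsub>fraction_mod\<^esub> m" using Y(1) by blast
qed

end

context cring
begin

lemma prime_localization:
  assumes "primeideal P R" "module R M"
  shows "localization R M (carrier R - P)"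
proof -
  interpret primeideal P R by fact
  show ?thesis
    using assms(2) I_notcarr one_imp_carrier I_prime
    by (auto simp: localization_def localization_axioms_def)
qed

text \<open>The residue field has at most as many elements as \<open>R \<times> R\<close>, hence as \<open>R\<close> if \<open>R\<close> is infinite.  If
  \<open>R\<close> is finite, \<open>R/P\<close> is a finite domain and thus a field, and every fraction has denominator \<open>1\<close>.\<close>

lemma residue_field_lepoll:
  assumes P: "primeideal P R"
  shows "carrier (localization.fraction_mod R (quot_by_ideal R P) (carrier R - P)) \<lesssim> carrier R"
proof -
  interpret P: primeideal P R by (rule P)
  let ?N = "quot_by_ideal R P" and ?S = "carrier R - P"
  interpret L: localization R ?N ?S
    by (rule prime_localization[OF P quot_by_ideal_module[OF P.is_ideal]])
  let ?\<kappa> = "carrier L.fraction_mod"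
  show ?thesis
  proof (cases "finite (carrier R)")
    case False
    have "?\<kappa> \<subseteq> (\<lambda>(r, s). L.fraction (residue P r) s) ` (carrier R \<times> carrier R)"
      by (fastforce simp: L.fraction_mod_carrier quot_by_ideal_carrier)
    then have "?\<kappa> \<lesssim> carrier R \<times> carrier R"
      by (rule lepoll_trans[OF subset_imp_lepoll image_lepoll])
    also have "carrier R \<times> carrier R \<approx> carrier R"
      using card_of_Times_same_infinite[OF False] by (simp add: eqpoll_iff_card_of_ordIso)
    finally show ?thesis .
  next
    case True
    have fin: "finite (carrier ?N)" using True by (simp add: quot_by_ideal_carrier)
    have "\<exists>t\<in>carrier R. L.fraction (residue P r) s = L.fraction (residue P t) \<one>"
      if r: "r \<in> carrier R" and s: "s \<in> ?S" for r s
    proof -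
      have sR: "s \<in> carrier R" "s \<notin> P" using s by auto
      have "inj_on (\<lambda>n. s \<odot>\<^bsub>?N\<^esub> n) (carrier ?N)"
      proof (rule inj_onI)
        fix m n assume "m \<in> carrier ?N" "n \<in> carrier ?N" and eq: "s \<odot>\<^bsub>?N\<^esub> m = s \<odot>\<^bsub>?N\<^esub> n"
        then obtain x y where *: "x \<in> carrier R" "y \<in> carrier R" "m = residue P x" "n = residue P y"
          by (auto simp: quot_by_ideal_carrier)
        have "s \<otimes> x \<ominus> s \<otimes> y \<in> P"
          using eq * sR residue_eq_iff[OF P.is_ideal, of "s \<otimes> x" "s \<otimes> y"]
          by (simp add: residue_smult[OF P.is_ideal])
        then have "s \<otimes> (x \<ominus> y) \<in> P" using * sR by (simp add: minus_eq r_distr r_minus)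
        then have "x \<ominus> y \<in> P" using P.I_prime[of s "x \<ominus> y"] * sR by simp
        then show "m = n" using * residue_eq_iff[OF P.is_ideal] by simp
      qed
      moreover have "(\<lambda>n. s \<odot>\<^bsub>?N\<^esub> n) ` carrier ?N \<subseteq> carrier ?N" using sR by auto
      ultimately have "(\<lambda>n. s \<odot>\<^bsub>?N\<^esub> n) ` carrier ?N = carrier ?N"
        using endo_inj_surj[OF fin] by blast
      then have "residue P r \<in> (\<lambda>n. s \<odot>\<^bsub>?N\<^esub> n) ` carrier ?N" using residue_closed[OF r] by simp
      then obtain t where t: "t \<in> carrier R" "residue P r = s \<odot>\<^bsub>?N\<^esub> residue P t"
        unfolding quot_by_ideal_carrier by blast
      have "L.fraction (residue P r) s = L.fraction (residue P t) \<one>"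
        using L.loc_frac_eq_iff[of "residue P r" "residue P t" s \<one>] L.S_one s t r
        by (auto simp: residue_closed)
      then show ?thesis using t(1) by blast
    qed
    then have "?\<kappa> \<subseteq> (\<lambda>t. L.fraction (residue P t) \<one>) ` carrier R"
      by (auto simp: L.fraction_mod_carrier quot_by_ideal_carrier image_iff)
    then show ?thesis by (rule lepoll_trans[OF subset_imp_lepoll image_lepoll])
  qed
qed

end

section \<open>The ring of finite fractions\<close>

context cring
begin

lemma regular_elements_cancel:
  assumes s: "s \<in> regular_elements R" and "x \<in> carrier R" "y \<in> carrier R" "s \<otimes> x = s \<otimes> y"
  shows "x = y"
proof -
  have "s \<otimes> (x \<ominus> y) = \<zero>"
    using assms by (simp add: regular_elements_def minus_eq r_distr r_minus r_neg)
  then have "x \<ominus> y = \<zero>" using assms by (auto simp: regular_elements_def)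
  then show ?thesis
    by (intro module.eq_if_minus_eq_zero[OF self_mod_module, of x y])
      (simp_all add: self_mod_minus assms)
qed

lemma total_quotient_localization: "localization R (self_mod R) (regular_elements R)"
proof -
  have "s \<otimes> t \<in> regular_elements R" if "s \<in> regular_elements R" "t \<in> regular_elements R" for s t
  proof -
    have st: "s \<in> carrier R" "t \<in> carrier R" using that by (simp_all add: regular_elements_def)
    have "r = \<zero>" if r: "r \<in> carrier R" "s \<otimes> t \<otimes> r = \<zero>" for r
    proof -
      have "s \<otimes> (t \<otimes> r) = \<zero>" using r st by (simp add: m_assoc)
      then have "t \<otimes> r = \<zero>"
        using \<open>s \<in> regular_elements R\<close> st r(1) by (simp add: regular_elements_def)
      then show ?thesis using \<open>t \<in> regular_elements R\<close> r(1) by (simp add: regular_elements_def)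
    qed
    then show ?thesis using st by (simp add: regular_elements_def)
  qed
  moreover have "regular_elements R \<subseteq> carrier R" "\<one> \<in> regular_elements R"
    by (auto simp: regular_elements_def)
  ultimately show ?thesis
    using self_mod_module by (simp add: localization_def localization_axioms_def)
qed

lemma total_quotient_frac_eq_iff:
  assumes "x \<in> carrier R" "y \<in> carrier R" "s \<in> regular_elements R" "t \<in> regular_elements R"
  shows "loc_frac R (regular_elements R) (self_mod R) x s = loc_frac R (regular_elements R) (self_mod R) y t
    \<longleftrightarrow> t \<otimes> x = s \<otimes> y"
proof -
  interpret L: localization R "self_mod R" "regular_elements R" by (rule total_quotient_localization)
  have eq: "t \<otimes> x = s \<otimes> y" if "u \<in> regular_elements R" "u \<otimes> (t \<otimes> x) = u \<otimes> (s \<otimes> y)" for u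
    using regular_elements_cancel[OF that(1) _ _ that(2)] assms L.S_carrier by simp
  show ?thesis
    using L.loc_frac_eq_iff[of x y s t] assms eq L.S_one by auto
qed

end

context UP_cring
begin

text \<open>McCoy's theorem.  Let \<open>f g = 0\<close> with \<open>g \<noteq> 0\<close>.  The multiples \<open>h \<noteq> 0\<close> of \<open>g\<close> constructed here are killed
  by more and more coefficients of \<open>f\<close>.  Suppose that \<open>h\<close> is killed by the coefficients below \<open>k\<close>, and
  let \<open>a\<close> be the coefficient at \<open>k\<close>.  Comparing coefficients in \<open>f h = 0\<close> shows by induction on \<open>j\<close>
  that \<open>a^(j+1)\<close> kills the coefficient of \<open>h\<close> at \<open>j\<close>, so some power of \<open>a\<close> kills \<open>h\<close>.  If
  \<open>a^m\<close> is the least one, replace \<open>h\<close> by \<open>a^(m-1) h\<close>.  In the end a nonzero coefficient of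
  \<open>h\<close> is killed by all coefficients of \<open>f\<close>.\<close>

lemma content_dense_regular:
  assumes f: "f \<in> carrier P"
    and dense: "\<And>r. r \<in> carrier R \<Longrightarrow> (\<And>i. coeff P f i \<otimes> r = \<zero>) \<Longrightarrow> r = \<zero>"
  shows "f \<in> regular_elements P"
proof -
  have coeff_eq0: "h = \<zero>\<^bsub>P\<^esub>" if "h \<in> carrier P" "\<And>j. coeff P h j = \<zero>" for h
    by (rule up_eqI) (use that in auto)
  have "g = \<zero>\<^bsub>P\<^esub>" if g: "g \<in> carrier P" and fg: "f \<otimes>\<^bsub>P\<^esub> g = \<zero>\<^bsub>P\<^esub>" for g
  proof (rule ccontr)
    assume "g \<noteq> \<zero>\<^bsub>P\<^esub>"
    have chain: "\<exists>h\<in>carrier P. h \<noteq> \<zero>\<^bsub>P\<^esub> \<and> f \<otimes>\<^bsub>P\<^esub> h = \<zero>\<^bsub>P\<^esub> \<and>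
        (\<forall>i<k. \<forall>j. coeff P f i \<otimes> coeff P h j = \<zero>)" for k
    proof (induction k)
      case 0
      then show ?case using g fg \<open>g \<noteq> \<zero>\<^bsub>P\<^esub>\<close> by auto
    next
      case (Suc k)
      then obtain h where h: "h \<in> carrier P" "h \<noteq> \<zero>\<^bsub>P\<^esub>" "f \<otimes>\<^bsub>P\<^esub> h = \<zero>\<^bsub>P\<^esub>"
        and kill: "\<And>i j. i < k \<Longrightarrow> coeff P f i \<otimes> coeff P h j = \<zero>" by auto
      define a where "a = coeff P f k"
      have a: "a \<in> carrier R" unfolding a_def by (rule coeff_closed[OF f])
      note hc = coeff_closed[OF h(1)] and fc = coeff_closed[OF f]
      have pow: "a [^] Suc j \<otimes> coeff P h j = \<zero>" for j
      proof (induction j rule: less_induct)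
        case (less j)
        have "\<zero> = a [^] j \<otimes> coeff P (f \<otimes>\<^bsub>P\<^esub> h) (k + j)"
          unfolding h(3) coeff_zero using a by simp
        also have "\<dots> = a [^] j \<otimes> (\<Oplus>i\<in>{..k + j}. coeff P f i \<otimes> coeff P h (k + j - i))"
          unfolding coeff_mult[OF f h(1)] ..
        also have "\<dots> = (\<Oplus>i\<in>{..k + j}. a [^] j \<otimes> (coeff P f i \<otimes> coeff P h (k + j - i)))"
          by (rule R.finsum_rdistr) (use a fc hc in auto)
        also have "\<dots> = (\<Oplus>i\<in>{..k + j}. if k = i then a [^] Suc i \<otimes> \<zero> \<oplus> a [^] Suc j \<otimes> coeff P h j else \<zero>)"
        proof (rule R.finsum_cong')
          fix i assume i: "i \<in> {..k + j}"
          consider "i < k" | "i = k" | "k < i" by linarith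
          then show "a [^] j \<otimes> (coeff P f i \<otimes> coeff P h (k + j - i)) =
              (if k = i then a [^] Suc i \<otimes> \<zero> \<oplus> a [^] Suc j \<otimes> coeff P h j else \<zero>)"
          proof cases
            case 1
            then show ?thesis using a kill by simp
          next
            case 2
            then show ?thesis using a hc by (simp add: R.m_assoc flip: a_def)
          next
            case 3
            define l where "l = k + j - i"
            have "l < j" and "j = Suc l + (j - Suc l)" using 3 i by (auto simp: l_def)
            then have "a [^] j = a [^] Suc l \<otimes> a [^] (j - Suc l)"
              using R.nat_pow_mult[OF a, of "Suc l" "j - Suc l"] by simp
            then have "a [^] j \<otimes> (coeff P f i \<otimes> coeff P h l) =
                coeff P f i \<otimes> (a [^] (j - Suc l) \<otimes> (a [^] Suc l \<otimes> coeff P h l))"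
              using a fc hc by (simp add: R.m_ac del: R.nat_pow_Suc)
            also have "\<dots> = \<zero>" unfolding less.IH[OF \<open>l < j\<close>] using a fc by simp
            finally show ?thesis using 3 by (simp add: l_def)
          qed
        qed (use a hc in auto)
        also have "\<dots> = a [^] Suc k \<otimes> \<zero> \<oplus> a [^] Suc j \<otimes> coeff P h j"
          by (rule R.add.finprod_singleton) (use a hc in auto)
        also have "\<dots> = a [^] Suc j \<otimes> coeff P h j" using a hc by simp
        finally show ?case by simp
      qed
      define N where "N = deg R h"
      have N: "coeff P h j = \<zero>" if "N < j" for j
        using that h(1) unfolding N_def by (rule deg_aboveD)
      have ex: "\<forall>j. a [^] Suc N \<otimes> coeff P h j = \<zero>"
      proof
        fix j
        show "a [^] Suc N \<otimes> coeff P h j = \<zero>"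
        proof (cases "N < j")
          case True
          then show ?thesis using N a by simp
        next
          case False
          then have "a [^] Suc N = a [^] (N - j) \<otimes> a [^] Suc j"
            using R.nat_pow_mult[OF a, of "N - j" "Suc j"] by simp
          then show ?thesis
            using pow[of j] a hc by (simp add: R.m_assoc del: R.nat_pow_Suc)
        qed
      qed
      define m where "m = (LEAST m. \<forall>j. a [^] (m::nat) \<otimes> coeff P h j = \<zero>)"
      have m: "\<forall>j. a [^] m \<otimes> coeff P h j = \<zero>" unfolding m_def
        by (rule LeastI[where P = "\<lambda>m. \<forall>j. a [^] m \<otimes> coeff P h j = \<zero>", OF ex])
      have "m \<noteq> 0"
      proof
        assume "m = 0"
        then have "\<And>j. coeff P h j = \<zero>" using m hc by simp
        then show False using coeff_eq0[OF h(1)] h(2) by simp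
      qed
      then obtain l where l: "m = Suc l" by (cases m) auto
      define h' where "h' = a [^] l \<odot>\<^bsub>P\<^esub> h"
      have al: "a [^] l \<in> carrier R" using a by simp
      have h': "h' \<in> carrier P" unfolding h'_def by (rule UP_smult_closed[OF al h(1)])
      have h'c: "coeff P h' j = a [^] l \<otimes> coeff P h j" for j
        unfolding h'_def by (rule coeff_smult[OF al h(1)])
      have "\<not> (\<forall>j. a [^] l \<otimes> coeff P h j = \<zero>)"
        using not_less_Least[of l "\<lambda>m. \<forall>j. a [^] m \<otimes> coeff P h j = \<zero>"] l
        unfolding m_def[symmetric] by simp
      then have "h' \<noteq> \<zero>\<^bsub>P\<^esub>" using h'c coeff_zero by metis
      moreover have "f \<otimes>\<^bsub>P\<^esub> h' = \<zero>\<^bsub>P\<^esub>"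
      proof -
        have "f \<otimes>\<^bsub>P\<^esub> h' = a [^] l \<odot>\<^bsub>P\<^esub> (h \<otimes>\<^bsub>P\<^esub> f)"
          unfolding h'_def using al f h(1) UP_smult_closed[OF al h(1)]
          by (simp add: UP_m_comm[of f] UP_smult_assoc2)
        also have "\<dots> = \<zero>\<^bsub>P\<^esub>"
          unfolding UP_m_comm[OF h(1) f] h(3) by (rule smult_r_null[OF al])
        finally show ?thesis .
      qed
      moreover have "coeff P f i \<otimes> coeff P h' j = \<zero>" if "i < Suc k" for i j
      proof (cases "i = k")
        case True
        have "coeff P f i \<otimes> coeff P h' j = a [^] m \<otimes> coeff P h j"
          unfolding True h'c a_def[symmetric] l using a hc by (simp add: R.m_ac)
        then show ?thesis using m by simp
      next
        case False
        have "coeff P f i \<otimes> coeff P h' j = a [^] l \<otimes> (coeff P f i \<otimes> coeff P h j)"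
          unfolding h'c using al fc hc by (simp add: R.m_ac)
        then show ?thesis using kill[of i j] that False al by simp
      qed
      ultimately show ?case using h' by blast
    qed
    define N where "N = deg R f"
    have N: "coeff P f i = \<zero>" if "N < i" for i
      using that f unfolding N_def by (rule deg_aboveD)
    obtain h where h: "h \<in> carrier P" "h \<noteq> \<zero>\<^bsub>P\<^esub>"
      "\<And>i j. i < Suc N \<Longrightarrow> coeff P f i \<otimes> coeff P h j = \<zero>"
      using chain[of "Suc N"] by blast
    have "coeff P h j = \<zero>" for j
    proof (rule dense[OF coeff_closed[OF h(1)]])
      fix i
      show "coeff P f i \<otimes> coeff P h j = \<zero>"
        using h(3)[of i j] N[of i] coeff_closed[OF h(1), of j] by (cases "i < Suc N") auto
    qed
    then show False using coeff_eq0[OF h(1)] h(2) by blast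
  qed
  then show ?thesis unfolding regular_elements_def using f by blast
qed

abbreviation "reg \<equiv> regular_elements P"

abbreviation quotient :: "(nat \<Rightarrow> 'a) \<Rightarrow> (nat \<Rightarrow> 'a) \<Rightarrow> ((nat \<Rightarrow> 'a) \<times> (nat \<Rightarrow> 'a)) set" where
  "quotient p q \<equiv> loc_frac P reg (self_mod P) p q"

lemma one_reg: "\<one>\<^bsub>P\<^esub> \<in> reg"
  using localization.S_one[OF P.total_quotient_localization] .

lemma reg_carrier: "q \<in> reg \<Longrightarrow> q \<in> carrier P"
  by (simp add: regular_elements_def)

lemma to_TRx_eq_quotient: "to_TRx R r = quotient (monom P r 0) \<one>\<^bsub>P\<^esub>"
  unfolding to_TRx_def P_def ..

lemma to_TRx_eq_iff:
  assumes "r \<in> carrier R" "p \<in> carrier P" "q \<in> reg"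
  shows "quotient p q = to_TRx R r \<longleftrightarrow> p = r \<odot>\<^bsub>P\<^esub> q"
proof -
  have "quotient p q = to_TRx R r \<longleftrightarrow> \<one>\<^bsub>P\<^esub> \<otimes>\<^bsub>P\<^esub> p = q \<otimes>\<^bsub>P\<^esub> monom P r 0"
    unfolding to_TRx_eq_quotient
    by (rule P.total_quotient_frac_eq_iff[OF assms(2) monom_closed[OF assms(1)] assms(3) one_reg])
  also have "\<one>\<^bsub>P\<^esub> \<otimes>\<^bsub>P\<^esub> p = p" using assms by (rule_tac UP_l_one)
  also have "q \<otimes>\<^bsub>P\<^esub> monom P r 0 = r \<odot>\<^bsub>P\<^esub> q"
    by (simp only: UP_m_comm[OF reg_carrier[OF assms(3)] monom_closed[OF assms(1)]]
      monom_mult_is_smult[OF assms(1) reg_carrier[OF assms(3)]])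
  finally show ?thesis .
qed

lemma to_TRx_mult_quotient:
  assumes "a \<in> carrier R" "p \<in> carrier P" "q \<in> reg"
  shows "to_TRx R a \<otimes>\<^bsub>total_quotient P\<^esub> quotient p q = quotient (a \<odot>\<^bsub>P\<^esub> p) q"
proof -
  interpret L: localization P "self_mod P" reg by (rule P.total_quotient_localization)
  have "to_TRx R a \<otimes>\<^bsub>total_quotient P\<^esub> quotient p q = quotient (monom P a 0 \<otimes>\<^bsub>P\<^esub> p) (\<one>\<^bsub>P\<^esub> \<otimes>\<^bsub>P\<^esub> q)"
    unfolding to_TRx_eq_quotient total_quotient_def loc_ring_def Let_def
    using L.loc_mod_smult[of "monom P a 0" "\<one>\<^bsub>P\<^esub>" p q] assms one_reg monom_closed[OF assms(1)]
    by (simp)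
  also have "\<dots> = quotient (a \<odot>\<^bsub>P\<^esub> p) q"
    by (simp only: monom_mult_is_smult[OF assms(1,2)] UP_l_one[OF reg_carrier[OF assms(3)]])
  finally show ?thesis .
qed

lemma Q0_iff:
  "\<alpha> \<in> Q0 R \<longleftrightarrow> (\<exists>p\<in>carrier P. \<exists>q\<in>reg. \<alpha> = quotient p q \<and>
    (\<exists>I\<in>Q_ideals R. \<forall>a\<in>I. \<exists>r\<in>carrier R. a \<odot>\<^bsub>P\<^esub> p = r \<odot>\<^bsub>P\<^esub> q))"
proof -
  have carr: "\<alpha> \<in> carrier (total_quotient P) \<longleftrightarrow> (\<exists>p\<in>carrier P. \<exists>q\<in>reg. \<alpha> = quotient p q)"
    by (auto simp: total_quotient_def loc_ring_def Let_def loc_mod_def)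
  have mem: "to_TRx R a \<otimes>\<^bsub>total_quotient P\<^esub> quotient p q \<in> to_TRx R ` carrier R \<longleftrightarrow>
      (\<exists>r\<in>carrier R. a \<odot>\<^bsub>P\<^esub> p = r \<odot>\<^bsub>P\<^esub> q)"
    if "p \<in> carrier P" "q \<in> reg" "a \<in> carrier R" for p q a
    unfolding to_TRx_mult_quotient[OF that(3,1,2)]
    using to_TRx_eq_iff[OF _ UP_smult_closed[OF that(3,1)] that(2)] by blast
  have quot: "(\<exists>I\<in>Q_ideals R. \<forall>a\<in>I.
        to_TRx R a \<otimes>\<^bsub>total_quotient P\<^esub> quotient p q \<in> to_TRx R ` carrier R) \<longleftrightarrow>
      (\<exists>I\<in>Q_ideals R. \<forall>a\<in>I. \<exists>r\<in>carrier R. a \<odot>\<^bsub>P\<^esub> p = r \<odot>\<^bsub>P\<^esub> q)"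
    if "p \<in> carrier P" "q \<in> reg" for p q
  proof (intro bex_cong ball_cong refl)
    fix I a assume "I \<in> Q_ideals R" "a \<in> I"
    then show "to_TRx R a \<otimes>\<^bsub>total_quotient P\<^esub> quotient p q \<in> to_TRx R ` carrier R \<longleftrightarrow>
        (\<exists>r\<in>carrier R. a \<odot>\<^bsub>P\<^esub> p = r \<odot>\<^bsub>P\<^esub> q)"
      using mem[OF that] R.Q_idealsD(4) by blast
  qed
  have Q0: "\<alpha> \<in> Q0 R \<longleftrightarrow> \<alpha> \<in> carrier (total_quotient P) \<and>
      (\<exists>I\<in>Q_ideals R. \<forall>a\<in>I. to_TRx R a \<otimes>\<^bsub>total_quotient P\<^esub> \<alpha> \<in> to_TRx R ` carrier R)"
    by (simp add: Q0_def P_def)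
  show ?thesis
  proof
    assume "\<alpha> \<in> Q0 R"
    then obtain p q where "p \<in> carrier P" "q \<in> reg" "\<alpha> = quotient p q"
      unfolding Q0 carr by blast
    then show "\<exists>p\<in>carrier P. \<exists>q\<in>reg. \<alpha> = quotient p q \<and>
        (\<exists>I\<in>Q_ideals R. \<forall>a\<in>I. \<exists>r\<in>carrier R. a \<odot>\<^bsub>P\<^esub> p = r \<odot>\<^bsub>P\<^esub> q)"
      using \<open>\<alpha> \<in> Q0 R\<close> quot[of p q] unfolding Q0 by blast
  next
    assume "\<exists>p\<in>carrier P. \<exists>q\<in>reg. \<alpha> = quotient p q \<and>
        (\<exists>I\<in>Q_ideals R. \<forall>a\<in>I. \<exists>r\<in>carrier R. a \<odot>\<^bsub>P\<^esub> p = r \<odot>\<^bsub>P\<^esub> q)"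
    then obtain p q where pq: "p \<in> carrier P" "q \<in> reg" "\<alpha> = quotient p q"
      "\<exists>I\<in>Q_ideals R. \<forall>a\<in>I. \<exists>r\<in>carrier R. a \<odot>\<^bsub>P\<^esub> p = r \<odot>\<^bsub>P\<^esub> q" by blast
    then show "\<alpha> \<in> Q0 R" unfolding Q0 carr using quot[OF pq(1,2)] by blast
  qed
qed

lemma smult_reg_cancel:
  assumes "r \<in> carrier R" "s \<in> carrier R" "q \<in> reg" "r \<odot>\<^bsub>P\<^esub> q = s \<odot>\<^bsub>P\<^esub> q"
  shows "r = s"
proof -
  have "q \<otimes>\<^bsub>P\<^esub> monom P r 0 = q \<otimes>\<^bsub>P\<^esub> monom P s 0"
    by (simp only: UP_m_comm[OF reg_carrier[OF assms(3)] monom_closed[OF assms(1)]]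
      UP_m_comm[OF reg_carrier[OF assms(3)] monom_closed[OF assms(2)]]
      monom_mult_is_smult[OF assms(1) reg_carrier[OF assms(3)]]
      monom_mult_is_smult[OF assms(2) reg_carrier[OF assms(3)]] assms(4))
  then have "monom P r 0 = monom P s 0"
    by (rule P.regular_elements_cancel[OF assms(3) monom_closed[OF assms(1)] monom_closed[OF assms(2)]])
  then show ?thesis using monom_inj[of 0] assms(1,2) by (auto dest: inj_onD)
qed

lemma to_TRx_subset_Q0: "to_TRx R ` carrier R \<subseteq> Q0 R"
proof
  fix \<alpha> assume "\<alpha> \<in> to_TRx R ` carrier R"
  then obtain r where r: "r \<in> carrier R" "\<alpha> = to_TRx R r" by blast
  have "\<alpha> = quotient (r \<odot>\<^bsub>P\<^esub> \<one>\<^bsub>P\<^esub>) \<one>\<^bsub>P\<^esub>"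
    using to_TRx_eq_iff[OF r(1) UP_smult_closed[OF r(1) UP_one_closed] one_reg] r(2) by simp
  moreover have "a \<odot>\<^bsub>P\<^esub> (r \<odot>\<^bsub>P\<^esub> \<one>\<^bsub>P\<^esub>) = (a \<otimes> r) \<odot>\<^bsub>P\<^esub> \<one>\<^bsub>P\<^esub>" if "a \<in> carrier R" for a
    using UP_smult_assoc1[OF that r(1) UP_one_closed] by simp
  moreover have "carrier R \<in> Q_ideals R" using R.GV_D(5)[OF R.carrier_GV] .
  ultimately show "\<alpha> \<in> Q0 R"
    unfolding Q0_iff using one_reg r(1) UP_smult_closed[OF r(1) UP_one_closed] R.m_closed by metis
qed

text \<open>A finite fraction \<open>\<alpha> = p/q\<close> with \<open>I \<alpha> \<subseteq> R\<close> defines the homomorphism \<open>a \<mapsto> a \<alpha>\<close> on the GV-ideal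
  \<open>I\<close>.  It is multiplication by some \<open>r \<in> R\<close>, and \<open>I (\<alpha> - r) = 0\<close> forces \<open>p = r q\<close> coefficient by
  coefficient.\<close>

lemma Q0_subset_if_WQ:
  assumes "WQ_ring R"
  shows "Q0 R \<subseteq> to_TRx R ` carrier R"
proof
  fix \<alpha> assume "\<alpha> \<in> Q0 R"
  then obtain p q I where p: "p \<in> carrier P" and q: "q \<in> reg" and \<alpha>: "\<alpha> = quotient p q"
    and I: "I \<in> Q_ideals R" and "\<forall>a\<in>I. \<exists>r\<in>carrier R. a \<odot>\<^bsub>P\<^esub> p = r \<odot>\<^bsub>P\<^esub> q"
    unfolding Q0_iff by blast
  then obtain g where g: "\<And>a. a \<in> I \<Longrightarrow> g a \<in> carrier R" "\<And>a. a \<in> I \<Longrightarrow> a \<odot>\<^bsub>P\<^esub> p = g a \<odot>\<^bsub>P\<^esub> q"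
    by metis
  note qP = reg_carrier[OF q]
  interpret I: ideal I R by (rule R.Q_idealsD(3)[OF I])
  have g_hom: "g \<in> mod_hom R (ideal_mod R I) (self_mod R)"
  proof (rule mod_homI; simp)
    fix a b assume ab: "a \<in> I" "b \<in> I"
    have "g (a \<oplus> b) \<odot>\<^bsub>P\<^esub> q = (g a \<oplus> g b) \<odot>\<^bsub>P\<^esub> q"
      using g(2)[OF I.a_closed[OF ab]] g(2)[OF ab(1)] g(2)[OF ab(2)]
        UP_smult_l_distr[OF I.Icarr[OF ab(1)] I.Icarr[OF ab(2)] p]
        UP_smult_l_distr[OF g(1)[OF ab(1)] g(1)[OF ab(2)] qP] by metis
    then show "g (a \<oplus> b) = g a \<oplus> g b"
      using g(1) ab by - (rule smult_reg_cancel[OF _ _ q], auto)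
  next
    fix r a assume ra: "r \<in> carrier R" "a \<in> I"
    have "g (r \<otimes> a) \<odot>\<^bsub>P\<^esub> q = (r \<otimes> g a) \<odot>\<^bsub>P\<^esub> q"
      using g(2)[OF I.I_l_closed[OF ra(2,1)]] g(2)[OF ra(2)]
        UP_smult_assoc1[OF ra(1) I.Icarr[OF ra(2)] p] UP_smult_assoc1[OF ra(1) g(1)[OF ra(2)] qP]
      by metis
    then show "g (r \<otimes> a) = r \<otimes> g a"
      using g(1) ra I.I_l_closed by - (rule smult_reg_cancel[OF _ _ q], auto)
  qed (rule g(1))
  have "I \<in> GV R" using assms I by (simp add: WQ_ring_def)
  from R.GV_extend[OF this g_hom]
  obtain r where r: "r \<in> carrier R" "\<And>a. a \<in> I \<Longrightarrow> g a = r \<otimes> a" by blast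
  have "p = r \<odot>\<^bsub>P\<^esub> q"
  proof (rule up_eqI)
    fix n
    show "coeff P p n = coeff P (r \<odot>\<^bsub>P\<^esub> q) n"
    proof (rule R.dense_ideal_cancel[OF R.Q_idealsD(2)[OF I]])
      fix a assume a: "a \<in> I"
      have "a \<otimes> coeff P p n = (r \<otimes> a) \<otimes> coeff P q n"
        using arg_cong[OF g(2)[OF a], of "\<lambda>p. coeff P p n"] r(2)[OF a] g(1)[OF a] I.Icarr[OF a] p qP
        by (metis coeff_smult)
      then show "coeff P p n \<otimes> a = coeff P (r \<odot>\<^bsub>P\<^esub> q) n \<otimes> a"
        unfolding coeff_smult[OF r(1) qP]
        using R.m_comm[OF I.Icarr[OF a] coeff_closed[OF p, of n]] coeff_closed[OF qP, of n] r(1)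
          I.Icarr[OF a] by (simp add: R.m_ac)
    qed (use coeff_closed p UP_smult_closed r qP in auto)
  qed (use p UP_smult_closed r qP in auto)
  then show "\<alpha> \<in> to_TRx R ` carrier R" using to_TRx_eq_iff[OF r(1) p q] r(1) \<alpha> by blast
qed

text \<open>Here \<open>f\<close> is the polynomial whose coefficients are the chosen generators of \<open>I\<close>, and \<open>p\<close> has their
  images under \<open>g\<close> as coefficients.  The identity \<open>a g(c) = g(a c) = c g(a)\<close> gives
  \<open>a p = g(a) f\<close>, so \<open>p/f\<close> is a finite fraction.\<close>

lemma WQ_if_Q0_subset:
  assumes Q0: "Q0 R \<subseteq> to_TRx R ` carrier R"
  shows "WQ_ring R"
  unfolding WQ_ring_def
proof
  fix I assume I: "I \<in> Q_ideals R"
  note ID = R.Q_idealsD[OF I]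
  interpret I: ideal I R by (rule ID)
  obtain X where X: "finite X" "X \<subseteq> carrier R" "I = Idl X" using ID(1) by (auto simp: fg_ideal_def)
  have XI: "X \<subseteq> I" using X R.genideal_self by simp
  obtain n and c :: "nat \<Rightarrow> 'a" where c: "X = c ` {i. i < n}"
    using finite_imp_nat_seg_image_inj_on[OF X(1)] by blast
  have cI: "c i \<in> I" if "i < n" for i using XI c that by auto
  have poly: "\<exists>p\<in>carrier P. \<forall>i. coeff P p i = (if i < n then d i else \<zero>)"
    if d: "\<And>i. i < n \<Longrightarrow> d i \<in> carrier R" for d
  proof -
    have "(\<lambda>i. if i < n then d i else \<zero>) \<in> up R"
      by (rule mem_upI) (use d in \<open>auto intro!: exI[of _ n]\<close>)
    then show ?thesis by (intro bexI[of _ "\<lambda>i. if i < n then d i else \<zero>"]) (auto simp: P_def UP_def)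
  qed
  obtain f where f: "f \<in> carrier P" "\<And>i. coeff P f i = (if i < n then c i else \<zero>)"
    using poly[of c] cI I.Icarr by blast
  have f_reg: "f \<in> reg"
  proof (rule content_dense_regular[OF f(1)])
    fix r assume r: "r \<in> carrier R" and 0: "\<And>i. coeff P f i \<otimes> r = \<zero>"
    have "X \<subseteq> {s \<in> carrier R. \<forall>t\<in>{r}. t \<otimes> s \<in> {\<zero>}}"
    proof
      fix x assume "x \<in> X"
      then obtain i where i: "i < n" "x = c i" using c by auto
      then show "x \<in> {s \<in> carrier R. \<forall>t\<in>{r}. t \<otimes> s \<in> {\<zero>}}"
        using 0[of i] f(2)[of i] r I.Icarr[OF cI[OF i(1)]] by (simp add: R.m_comm)
    qed
    then have "I \<subseteq> {s \<in> carrier R. \<forall>t\<in>{r}. t \<otimes> s \<in> {\<zero>}}"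
      unfolding X(3) using r by (intro R.genideal_minimal R.colon_ideal R.zeroideal) auto
    then have "\<forall>s\<in>I. s \<otimes> r = \<zero>" using r by (auto simp: R.m_comm)
    then show "r = \<zero>" using ID(2) r by (simp add: R.dense_ideal_iff)
  qed
  show "I \<in> GV R"
    unfolding R.GV_iff
  proof (intro conjI ballI ID)
    fix g assume g: "g \<in> mod_hom R (ideal_mod R I) (self_mod R)"
    have gI: "g a \<in> carrier R" if "a \<in> I" for a using mod_hom_closed[OF g] that by simp
    obtain p where p: "p \<in> carrier P" "\<And>i. coeff P p i = (if i < n then g (c i) else \<zero>)"
      using poly[of "\<lambda>i. g (c i)"] gI cI by blast
    have ap: "a \<odot>\<^bsub>P\<^esub> p = g a \<odot>\<^bsub>P\<^esub> f" if a: "a \<in> I" for a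
    proof (rule up_eqI)
      fix i
      have "a \<otimes> g (c i) = g a \<otimes> c i" if i: "i < n"
      proof -
        have "a \<otimes> g (c i) = g (a \<otimes> c i)" using mod_hom_smult[OF g I.Icarr[OF a], of "c i"] cI[OF i] by simp
        also have "a \<otimes> c i = c i \<otimes> a" using R.m_comm a cI[OF i] I.Icarr by simp
        also have "g (c i \<otimes> a) = c i \<otimes> g a"
          using mod_hom_smult[OF g I.Icarr[OF cI[OF i]], of a] a by simp
        finally show ?thesis using R.m_comm gI[OF a] I.Icarr[OF cI[OF i]] by simp
      qed
      then show "coeff P (a \<odot>\<^bsub>P\<^esub> p) i = coeff P (g a \<odot>\<^bsub>P\<^esub> f) i"
        unfolding coeff_smult[OF I.Icarr[OF a] p(1)] coeff_smult[OF gI[OF a] f(1)] p(2) f(2)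
        using I.Icarr[OF a] gI[OF a] by simp
    qed (use UP_smult_closed I.Icarr[OF a] gI[OF a] p(1) f(1) in auto)
    then have "quotient p f \<in> Q0 R" unfolding Q0_iff using p(1) f_reg I gI by blast
    then obtain r where r: "r \<in> carrier R" "p = r \<odot>\<^bsub>P\<^esub> f"
      using Q0 to_TRx_eq_iff[OF _ p(1) f_reg] by blast
    have "g a = r \<otimes> a" if a: "a \<in> I" for a
    proof (rule smult_reg_cancel[OF gI[OF a] _ f_reg])
      have aR: "a \<in> carrier R" using a I.Icarr by simp
      show "r \<otimes> a \<in> carrier R" using r aR by simp
      show "g a \<odot>\<^bsub>P\<^esub> f = (r \<otimes> a) \<odot>\<^bsub>P\<^esub> f"
        using ap[OF a] r(2) UP_smult_assoc1[OF aR r(1) f(1)] R.m_comm[OF aR r(1)] by metis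
    qed
    then show "\<exists>r\<in>carrier R. \<forall>x\<in>I. g x = r \<otimes> x" using r(1) by blast
  qed
qed

lemma WQ_ring_iff_Q0: "WQ_ring R \<longleftrightarrow> Q0 R = to_TRx R ` carrier R"
proof
  assume "WQ_ring R"
  from Q0_subset_if_WQ[OF this] to_TRx_subset_Q0 show "Q0 R = to_TRx R ` carrier R"
    by (rule subset_antisym)
next
  assume "Q0 R = to_TRx R ` carrier R"
  then show "WQ_ring R" by (intro WQ_if_Q0_subset) simp
qed

end

section \<open>The equivalences\<close>

context cring
begin

text \<open>The local hypothesis holds because \<open>J\<close> is not contained in \<open>P\<close>.\<close>

lemma Q_ideal_GV_if:
  assumes I: "I \<in> Q_ideals R"
    and J: "\<And>a. a \<in> I \<Longrightarrow> \<exists>J\<in>GV R. \<forall>j\<in>J. j \<otimes> a \<in> I \<cdot> I"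
  shows "I \<in> GV R"
proof (rule GV_if_locally_idempotent[OF I])
  fix P a assume P: "max_GV_free P" and "a \<in> I"
  then obtain J where J: "J \<in> GV R" "\<forall>j\<in>J. j \<otimes> a \<in> I \<cdot> I" using J by blast
  then obtain s where "s \<in> J" "s \<notin> P" using max_GV_freeD(3)[OF P] by blast
  then show "\<exists>s\<in>carrier R - P. s \<otimes> a \<in> I \<cdot> I" using J GV_D(4) by blast
qed

lemma WQ_ring_iff_idempotent:
  "WQ_ring R \<longleftrightarrow> (\<forall>I. fg_ideal R I \<and> semi_regular_ideal R I \<longrightarrow> I \<subseteq> w_env_ideal R (I \<cdot> I))"
proof
  assume WQ: "WQ_ring R"
  show "\<forall>I. fg_ideal R I \<and> semi_regular_ideal R I \<longrightarrow> I \<subseteq> w_env_ideal R (I \<cdot> I)"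
  proof (intro allI impI subsetI)
    fix I a assume "fg_ideal R I \<and> semi_regular_ideal R I" and a: "a \<in> I"
    then have "I \<in> GV R" using WQ by (simp add: WQ_ring_def Q_ideals_def)
    moreover have "a \<in> carrier R" using GV_D(4)[OF \<open>I \<in> GV R\<close>] a by blast
    moreover have "\<forall>j\<in>I. j \<otimes> a \<in> I \<cdot> I" using a by (blast intro: ideal_prod.prod)
    ultimately show "a \<in> w_env_ideal R (I \<cdot> I)" unfolding w_env_ideal_def by blast
  qed
next
  assume idem: "\<forall>I. fg_ideal R I \<and> semi_regular_ideal R I \<longrightarrow> I \<subseteq> w_env_ideal R (I \<cdot> I)"
  have "I \<in> GV R" if I: "I \<in> Q_ideals R" for I
    using idem I by (intro Q_ideal_GV_if[OF I]) (auto simp: Q_ideals_def w_env_ideal_def)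
  then show "WQ_ring R" by (simp add: WQ_ring_def)
qed

lemma semi_regular_w_flat_if_WQ:
  assumes WQ: "WQ_ring R" and M: "module R M"
  shows "semi_regular_w_flat R M"
  unfolding semi_regular_w_flat_def
proof
  fix I assume I: "I \<in> Q_ideals R"
  note ID = Q_idealsD[OF I]
  have GV: "I \<in> GV R" using WQ I by (simp add: WQ_ring_def)
  let ?T = "Tor1 R (quot_by_ideal R I) M"
  have "a \<odot>\<^bsub>?T\<^esub> X = \<zero>\<^bsub>?T\<^esub>" if "a \<in> I" "X \<in> carrier ?T" for a X
  proof (rule tor_resolution.Tor1_annihilated[OF tor_resolutionI[OF quot_by_ideal_module[OF ID(3)] M] _ _ that(2)])
    show "a \<in> carrier R" using that ID(4) by auto
  qed (rule quot_by_ideal_annihilated[OF ID(3) that(1)])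
  then show "GV_torsion R ?T" using GV unfolding GV_torsion_def tor_GV_def by blast
qed

lemma copy_mod_exists:
  assumes M: "module R M" and "carrier M \<lesssim> (UNIV :: 'u set)"
  obtains N :: "('a, 'u) module" and f g
  where "module R N" "f \<in> mod_hom R M N" "g \<in> mod_hom R N M"
    "\<And>x. x \<in> carrier M \<Longrightarrow> g (f x) = x" "\<And>y. y \<in> carrier N \<Longrightarrow> f (g y) = y"
proof -
  obtain f :: "_ \<Rightarrow> 'u" where f: "inj_on f (carrier M)" using assms(2) by (auto simp: lepoll_def)
  show ?thesis
  proof (rule that)
    show "module R (copy_mod f M)" "inv_into (carrier M) f \<in> mod_hom R (copy_mod f M) M"
      by (rule copy_mod[OF M f])+
    show "f \<in> mod_hom R M (copy_mod f M)" using copy_mod(2)[OF M f] by (simp add: mod_iso_def)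
    show "f (inv_into (carrier M) f y) = y" if "y \<in> carrier (copy_mod f M)" for y
      using that by (simp add: copy_mod_def f_inv_into_f)
  qed (use f in simp)
qed

lemma WQ_if_semi_regular_w_flat:
  assumes size: "carrier R \<lesssim> (UNIV :: 'u set)"
    and flat: "\<And>M :: ('a, 'u) module. module R M \<Longrightarrow> semi_regular_w_flat R M"
  shows "WQ_ring R"
  unfolding WQ_ring_def
proof
  fix I assume I: "I \<in> Q_ideals R"
  note ID = Q_idealsD[OF I]
  let ?N = "quot_by_ideal R I"
  note N = quot_by_ideal_module[OF ID(3)]
  have "carrier ?N \<lesssim> (UNIV :: 'u set)"
    unfolding quot_by_ideal_carrier by (rule lepoll_trans[OF image_lepoll size])
  from copy_mod_exists[OF N this]
  obtain M :: "('a, 'u) module" and f g where M: "module R M" and f: "f \<in> mod_hom R ?N M"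
    and g: "g \<in> mod_hom R M ?N" and gf: "\<And>x. x \<in> carrier ?N \<Longrightarrow> g (f x) = x" by metis
  define m where "m = f (residue I \<one>)"
  have one: "residue I \<one> \<in> carrier ?N" by (simp add: residue_closed)
  have m: "m \<in> carrier M" "g m = residue I \<one>"
    using mod_hom_closed[OF f one] gf[OF one] by (simp_all add: m_def)
  have "a \<odot>\<^bsub>M\<^esub> m = \<zero>\<^bsub>M\<^esub>" if a: "a \<in> I" for a
  proof -
    have "a \<in> carrier R" using a ID(4) by auto
    then have "a \<odot>\<^bsub>M\<^esub> m = f (a \<odot>\<^bsub>?N\<^esub> residue I \<one>)"
      using mod_hom_smult[OF f _ one] by (simp add: m_def)
    also have "\<dots> = \<zero>\<^bsub>M\<^esub>"
      unfolding quot_by_ideal_annihilated[OF ID(3) a one] by (rule mod_hom_zero[OF N M f])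
    finally show ?thesis .
  qed
  moreover have "GV_torsion R (Tor1 R ?N M)"
    using flat[OF M] I by (simp add: semi_regular_w_flat_def)
  ultimately show "I \<in> GV R"
    using Q_ideal_GV_if[OF I] Tor1_torsion_imp_idempotent[OF ID(3) M g m] by blast
qed

lemma tensor_annihilated:
  assumes M: "module R M" and N: "module R N" and a: "a \<in> carrier R"
    and aN: "\<And>n. n \<in> carrier N \<Longrightarrow> a \<odot>\<^bsub>N\<^esub> n = \<zero>\<^bsub>N\<^esub>" and z: "z \<in> carrier (tensor R M N)"
  shows "a \<odot>\<^bsub>tensor R M N\<^esub> z = \<zero>\<^bsub>tensor R M N\<^esub>"
proof -
  interpret T: tensor_product R M N by (rule tensor_productI[OF M N])
  interpret X: module R "tensor R M N" by (rule T.tensor_module)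
  show ?thesis
  proof (rule T.tensor_hom_eq[OF T.tensor_module X.mod_hom_scalar[OF a] _ _ z])
    show "(\<lambda>_. \<zero>\<^bsub>tensor R M N\<^esub>) \<in> mod_hom R (tensor R M N) (tensor R M N)"
      by (rule mod_homI) auto
    fix x n assume x: "x \<in> carrier M" and n: "n \<in> carrier N"
    have t: "tens M N x \<in> mod_hom R N (tensor R M N)"
      using T.bilinear_tens x by (simp add: bilinear_def)
    show "a \<odot>\<^bsub>tensor R M N\<^esub> tens M N x n = \<zero>\<^bsub>tensor R M N\<^esub>"
      using mod_hom_smult[OF t a n] aN[OF n] mod_hom_zero[OF N T.tensor_module t] by simp
  qed
qed

text \<open>An element \<open>u \<in> I - P\<close> annihilates \<open>A \<otimes> R/I\<close>, so the localization of this module at \<open>P\<close> has only one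
  element and every map out of it is injective.\<close>

lemma w_flat_if_GV:
  assumes I: "I \<in> GV R"
  shows "w_flat TYPE('u) R (quot_by_ideal R I)"
  unfolding w_flat_def
proof (intro allI impI)
  fix A B :: "('a, 'u) module" and f
  assume "module R A \<and> module R B \<and> w_mono R A f B"
  then have A: "module R A" and B: "module R B" and f: "f \<in> mod_hom R A B"
    by (simp_all add: w_mono_def)
  note ID = GV_D[OF I]
  let ?N = "quot_by_ideal R I"
  note N = quot_by_ideal_module[OF ID(3)]
  interpret T: tensor_product R A ?N by (rule tensor_productI[OF A N])
  show "w_mono R (tensor R A ?N) (tensor_map R A ?N f B) (tensor R B ?N)"
    unfolding w_mono_def
  proof (intro conjI ballI)
    show "tensor_map R A ?N f B \<in> mod_hom R (tensor R A ?N) (tensor R B ?N)"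
      by (rule tensor_map(1)[OF A B N f])
    fix P assume "P \<in> w_Max R"
    then have P: "max_GV_free P" by (simp add: w_Max_iff)
    interpret L: localization R "tensor R A ?N" "carrier R - P"
      by (rule prime_localization[OF max_GV_freeD(1)[OF P] T.tensor_module])
    obtain u where u: "u \<in> I" "u \<notin> P" using max_GV_freeD(3)[OF P I] by blast
    have uS: "u \<in> carrier R - P" using u ID(4) by auto
    have 0: "u \<odot>\<^bsub>tensor R A ?N\<^esub> z = \<zero>\<^bsub>tensor R A ?N\<^esub>" if "z \<in> carrier (tensor R A ?N)" for z
      using tensor_annihilated[OF A N _ quot_by_ideal_annihilated[OF ID(3) u(1)] that] uS by blast
    have "X = Y" if XY: "X \<in> carrier (loc_mod R (carrier R - P) (tensor R A ?N))"
      "Y \<in> carrier (loc_mod R (carrier R - P) (tensor R A ?N))" for X Y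
    proof -
      obtain x s where x: "x \<in> carrier (tensor R A ?N)" "s \<in> carrier R - P" "X = L.fraction x s"
        using XY(1) unfolding L.loc_mod_carrier by blast
      obtain y t where y: "y \<in> carrier (tensor R A ?N)" "t \<in> carrier R - P" "Y = L.fraction y t"
        using XY(2) unfolding L.loc_mod_carrier by blast
      have "u \<odot>\<^bsub>tensor R A ?N\<^esub> (t \<odot>\<^bsub>tensor R A ?N\<^esub> x) = u \<odot>\<^bsub>tensor R A ?N\<^esub> (s \<odot>\<^bsub>tensor R A ?N\<^esub> y)"
        using 0 x y by simp
      then show ?thesis
        unfolding x(3) y(3) using L.loc_frac_eq_iff[OF x(1) y(1) x(2) y(2)] uS by blast
    qed
    then show "inj_on (loc_map R (carrier R - P) (tensor R B ?N) (tensor_map R A ?N f B))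
        (carrier (loc_mod R (carrier R - P) (tensor R A ?N)))" by (blast intro: inj_onI)
  qed
qed

lemma w_mono_if_inj:
  assumes M: "module R M" and N: "module R N" and f: "f \<in> mod_hom R M N" and inj: "inj_on f (carrier M)"
  shows "w_mono R M f N"
  unfolding w_mono_def
proof (intro conjI ballI f)
  fix P assume "P \<in> w_Max R"
  then interpret localization R M "carrier R - P"
    by (intro prime_localization max_GV_freeD(1) M) (simp add: w_Max_iff)
  show "inj_on (loc_map R (carrier R - P) N f) (carrier (loc_mod R (carrier R - P) M))"
    by (rule loc_map_inj[OF N f inj])
qed

text \<open>The modules \<open>A\<close> and \<open>B\<close> are copies of \<open>I\<close> and \<open>R\<close> in the universe, and \<open>f\<close> is the inclusion.  For
  \<open>a \<in> I\<close> the element \<open>z = a \<otimes> 1\<close> of \<open>I \<otimes> R/I\<close> becomes \<open>1 \<otimes> a = 0\<close> in \<open>R \<otimes> R/I\<close>, so it is zero locally at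
  \<open>P\<close>: some \<open>u \<notin> P\<close> has \<open>u z = 0\<close>.  The pairing with values in \<open>R/I\<^sup>2\<close> then gives \<open>u a \<in> I\<^sup>2\<close>.\<close>

lemma GV_if_w_flat:
  assumes size: "carrier R \<lesssim> (UNIV :: 'u set)"
    and I: "I \<in> Q_ideals R" and flat: "w_flat TYPE('u) R (quot_by_ideal R I)"
  shows "I \<in> GV R"
proof (rule GV_if_locally_idempotent[OF I])
  fix P a assume P: "max_GV_free P" and a: "a \<in> I"
  note ID = Q_idealsD[OF I]
  note Imod = ideal_mod_module[OF ID(3)]
  have aR: "a \<in> carrier R" using a ID(4) by auto
  have II: "ideal (I \<cdot> I) R" by (rule ideal_prod_is_ideal[OF ID(3) ID(3)])
  let ?N = "quot_by_ideal R I"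
  note N = quot_by_ideal_module[OF ID(3)]
  have "carrier (ideal_mod R I) \<lesssim> (UNIV :: 'u set)"
    using lepoll_trans[OF subset_imp_lepoll[OF ID(4)] size] by simp
  from copy_mod_exists[OF Imod this]
  obtain A :: "('a, 'u) module" and i j where A: "module R A"
    and i: "i \<in> mod_hom R (ideal_mod R I) A" and j: "j \<in> mod_hom R A (ideal_mod R I)"
    and ji: "\<And>x. x \<in> I \<Longrightarrow> j (i x) = x" and ij: "\<And>y. y \<in> carrier A \<Longrightarrow> i (j y) = y"
    by (auto; metis)
  have "carrier (self_mod R) \<lesssim> (UNIV :: 'u set)" using size by simp
  from copy_mod_exists[OF self_mod_module this]
  obtain B :: "('a, 'u) module" and b c where B: "module R B"
    and b: "b \<in> mod_hom R (self_mod R) B" and cb: "\<And>x. x \<in> carrier R \<Longrightarrow> c (b x) = x"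
    by (auto; metis)
  have incl: "(\<lambda>x. x) \<in> mod_hom R (ideal_mod R I) (self_mod R)"
    using ID(4) by (auto simp: mod_hom_def)
  define f where "f y = b (j y)" for y
  have f: "f \<in> mod_hom R A B"
    unfolding f_def by (rule mod_hom_comp[OF mod_hom_comp[OF j incl] b])
  have jR: "j y \<in> carrier R" if "y \<in> carrier A" for y
    using mod_hom_closed[OF j that] ID(4) by auto
  have "inj_on f (carrier A)"
  proof (rule inj_onI)
    fix x y assume "x \<in> carrier A" "y \<in> carrier A" "f x = f y"
    then show "x = y" using cb[OF jR] ij unfolding f_def by metis
  qed
  then have mono: "w_mono R (tensor R A ?N) (tensor_map R A ?N f B) (tensor R B ?N)"
    using flat A B w_mono_if_inj[OF A B f] by (simp add: w_flat_def)
  interpret TA: tensor_product R A ?N by (rule tensor_productI[OF A N])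
  interpret TB: tensor_product R B ?N by (rule tensor_productI[OF B N])
  interpret B: module R B by (rule B)
  note T = tensor_map[OF A B N f]
  have one: "residue I \<one> \<in> carrier ?N" by (simp add: residue_closed)
  have ia: "i a \<in> carrier A" using mod_hom_closed[OF i] a by simp
  define z where "z = tens A ?N (i a) (residue I \<one>)"
  have z: "z \<in> carrier (tensor R A ?N)" unfolding z_def by (rule TA.tens_closed[OF ia one])
  have b1: "b \<one> \<in> carrier B" using mod_hom_closed[OF b] by simp
  have tl: "(\<lambda>x. tens B ?N x (residue I \<one>)) \<in> mod_hom R B (tensor R B ?N)"
    using TB.bilinear_tens one by (simp add: bilinear_def)
  have tr: "tens B ?N (b \<one>) \<in> mod_hom R ?N (tensor R B ?N)"
    using TB.bilinear_tens b1 by (simp add: bilinear_def)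
  have "f (i a) = a \<odot>\<^bsub>B\<^esub> b \<one>"
    using mod_hom_smult[OF b aR, of \<one>] ji[OF a] aR by (simp add: f_def)
  then have "tensor_map R A ?N f B z = tens B ?N (b \<one>) (a \<odot>\<^bsub>?N\<^esub> residue I \<one>)"
    using T(2)[OF ia one] mod_hom_smult[OF tl aR b1] mod_hom_smult[OF tr aR one] by (simp add: z_def)
  also have "\<dots> = \<zero>\<^bsub>tensor R B ?N\<^esub>"
    unfolding quot_by_ideal_annihilated[OF ID(3) a one] by (rule mod_hom_zero[OF N TB.tensor_module tr])
  finally have Tz: "tensor_map R A ?N f B z = \<zero>\<^bsub>tensor R B ?N\<^esub>" .
  interpret L: localization R "tensor R A ?N" "carrier R - P"
    by (rule prime_localization[OF max_GV_freeD(1)[OF P] TA.tensor_module])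
  note loc = L.loc_map_frac[OF TB.tensor_module T(1) _ L.S_one]
  have "loc_map R (carrier R - P) (tensor R B ?N) (tensor_map R A ?N f B) (L.fraction z \<one>) =
      loc_map R (carrier R - P) (tensor R B ?N) (tensor_map R A ?N f B)
        (L.fraction \<zero>\<^bsub>tensor R A ?N\<^esub> \<one>)"
    using loc[OF z] loc[OF L.M.zero_closed] Tz
      mod_hom_zero[OF TA.tensor_module TB.tensor_module T(1)] by simp
  moreover have "P \<in> w_Max R" using P by (simp add: w_Max_iff)
  then have "inj_on (loc_map R (carrier R - P) (tensor R B ?N) (tensor_map R A ?N f B))
      (carrier (loc_mod R (carrier R - P) (tensor R A ?N)))"
    using mono by (simp add: w_mono_def)
  ultimately have "L.fraction z \<one> = L.fraction \<zero>\<^bsub>tensor R A ?N\<^esub> \<one>"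
    using L.loc_frac_closed z L.S_one L.M.zero_closed inj_onD by metis
  then obtain u where u: "u \<in> carrier R - P" "u \<odot>\<^bsub>tensor R A ?N\<^esub> z = \<zero>\<^bsub>tensor R A ?N\<^esub>"
    using L.loc_frac_eq_iff[OF z L.M.zero_closed L.S_one L.S_one] L.S_carrier z by auto
  let ?Q = "quot_by_ideal R (I \<cdot> I)"
  note Q = quot_by_ideal_module[OF II]
  obtain \<mu> where \<mu>: "bilinear (ideal_mod R I) ?N ?Q \<mu>"
    "\<And>b r. b \<in> I \<Longrightarrow> r \<in> carrier R \<Longrightarrow> \<mu> b (residue I r) = residue (I \<cdot> I) (b \<otimes> r)"
    using conormal_pairing[OF ID(3)] by metis
  have "(\<lambda>n. n) \<in> mod_hom R ?N ?N" by (rule mod_homI) auto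
  from TA.tensor_hom_exists[OF Q bilinear_comp[OF A N \<mu>(1) j this]]
  obtain h where h: "h \<in> mod_hom R (tensor R A ?N) ?Q"
    "\<And>x n. x \<in> carrier A \<Longrightarrow> n \<in> carrier ?N \<Longrightarrow> h (tens A ?N x n) = \<mu> (j x) n" by metis
  have "h z = residue (I \<cdot> I) a"
    using h(2)[OF ia one] ji[OF a] \<mu>(2)[OF a, of \<one>] aR by (simp add: z_def)
  moreover have uR: "u \<in> carrier R" using u by simp
  ultimately have "residue (I \<cdot> I) (u \<otimes> a) = I \<cdot> I"
    using mod_hom_smult[OF h(1) uR z] u(2) mod_hom_zero[OF TA.tensor_module Q h(1)]
      residue_smult[OF II uR aR] by (simp add: quot_by_ideal_zero)
  then have "u \<otimes> a \<in> I \<cdot> I" using residue_eq_zero_iff[OF II, of "u \<otimes> a"] uR aR by simp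
  then show "\<exists>s\<in>carrier R - P. s \<otimes> a \<in> I \<cdot> I" using u(1) by blast
qed

lemma w_module_extend:
  assumes "w_module R M" "J \<in> GV R" "g \<in> mod_hom R (ideal_mod R J) M"
  shows "\<exists>m\<in>carrier M. \<forall>j\<in>J. g j = j \<odot>\<^bsub>M\<^esub> m"
proof -
  have "module R M" using assms(1) by (simp add: w_module_def)
  from assms(1)[unfolded w_module_iff[OF this]] show ?thesis using assms(2,3) by simp
qed

text \<open>If \<open>I x \<subseteq> M\<close> with \<open>x\<close> in the injective envelope, then \<open>a \<mapsto> a x\<close> is a homomorphism from the GV-ideal
  \<open>I\<close> to \<open>M\<close>, hence multiplication by some \<open>m \<in> M\<close>, and \<open>I (x - m) = 0\<close>.  As the extension is essential,
  the envelope inherits from \<open>M\<close> that only \<open>0\<close> is annihilated by \<open>I\<close>.\<close>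

lemma Lucas_module_if_WQ:
  fixes M :: "('a, 'm, 'p) module_scheme"
  assumes WQ: "WQ_ring R" and w: "w_module R M"
  shows "Lucas_module R M"
proof -
  have M: "module R M" and tf: "GV_torsion_free R M" using w by (simp_all add: w_module_def)
  interpret M: module R M by (rule M)
  have QGV: "I \<in> GV R" if "I \<in> Q_ideals R" for I using WQ that by (simp add: WQ_ring_def)
  have "Q_torsion_free R M"
    unfolding Q_torsion_free_def using GV_torsion_freeD[OF tf QGV] by blast
  moreover have "Lucas_envelope R M E \<iota> = \<iota> ` carrier M"
    if env: "injective_envelope R M E \<iota>" for E :: "('a, ('a, 'm) envelope) module" and \<iota>
  proof -
    have E: "module R E" and \<iota>: "\<iota> \<in> mod_hom R M E" and inj: "inj_on \<iota> (carrier M)"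
      and ess: "\<And>H. submodule H R E \<Longrightarrow> H \<noteq> {\<zero>\<^bsub>E\<^esub>} \<Longrightarrow> H \<inter> \<iota> ` carrier M \<noteq> {\<zero>\<^bsub>E\<^esub>}"
      using env by (auto simp: injective_envelope_def injective_module_def)
    interpret E: module R E by (rule E)
    note \<iota>0 = mod_hom_zero[OF M E \<iota>]
    have E_tf: "y = \<zero>\<^bsub>E\<^esub>" if y: "y \<in> carrier E" and I: "I \<in> Q_ideals R"
      and Iy: "\<And>a. a \<in> I \<Longrightarrow> a \<odot>\<^bsub>E\<^esub> y = \<zero>\<^bsub>E\<^esub>" for y I
    proof (rule ccontr)
      assume "y \<noteq> \<zero>\<^bsub>E\<^esub>"
      have sub: "(\<lambda>r. r \<odot>\<^bsub>E\<^esub> y) \<in> mod_hom R (self_mod R) E"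
        using y by (intro mod_homI) (auto simp: E.smult_l_distr E.smult_assoc1)
      have H: "submodule ((\<lambda>r. r \<odot>\<^bsub>E\<^esub> y) ` carrier R) R E"
        using submodule_image[OF self_mod_module E sub] by simp
      have "y \<in> (\<lambda>r. r \<odot>\<^bsub>E\<^esub> y) ` carrier R" using y by (auto intro!: image_eqI[of _ _ \<one>])
      then have "(\<lambda>r. r \<odot>\<^bsub>E\<^esub> y) ` carrier R \<noteq> {\<zero>\<^bsub>E\<^esub>}" using \<open>y \<noteq> \<zero>\<^bsub>E\<^esub>\<close> by auto
      moreover have "\<zero>\<^bsub>E\<^esub> \<in> (\<lambda>r. r \<odot>\<^bsub>E\<^esub> y) ` carrier R \<inter> \<iota> ` carrier M"
        using submoduleD(2)[OF H] \<iota>0 by (auto intro!: image_eqI[of _ _ "\<zero>\<^bsub>M\<^esub>"])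
      ultimately have "\<exists>v\<in>(\<lambda>r. r \<odot>\<^bsub>E\<^esub> y) ` carrier R \<inter> \<iota> ` carrier M. v \<noteq> \<zero>\<^bsub>E\<^esub>"
        using ess[OF H] by (metis (no_types, lifting) is_singletonI' is_singleton_def singletonD empty_iff)
      then obtain r m where rm: "r \<in> carrier R" "m \<in> carrier M" "r \<odot>\<^bsub>E\<^esub> y = \<iota> m" "\<iota> m \<noteq> \<zero>\<^bsub>E\<^esub>"
        by auto
      have "a \<odot>\<^bsub>M\<^esub> m = \<zero>\<^bsub>M\<^esub>" if a: "a \<in> I" for a
      proof (rule inj_onD[OF inj])
        have aR: "a \<in> carrier R" using Q_idealsD(4)[OF I] a by auto
        have "\<iota> (a \<odot>\<^bsub>M\<^esub> m) = a \<odot>\<^bsub>E\<^esub> (r \<odot>\<^bsub>E\<^esub> y)"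
          using mod_hom_smult[OF \<iota> aR rm(2)] rm(3) by simp
        also have "\<dots> = r \<odot>\<^bsub>E\<^esub> (a \<odot>\<^bsub>E\<^esub> y)"
          using aR rm(1) y by (simp add: m_comm flip: E.smult_assoc1)
        finally show "\<iota> (a \<odot>\<^bsub>M\<^esub> m) = \<iota> \<zero>\<^bsub>M\<^esub>" using Iy[OF a] rm(1) \<iota>0 by simp
        show "a \<odot>\<^bsub>M\<^esub> m \<in> carrier M" using aR rm by simp
      qed simp
      then have "m = \<zero>\<^bsub>M\<^esub>" by (rule GV_torsion_freeD[OF tf QGV[OF I] rm(2)])
      then show False using rm(4) \<iota>0 by simp
    qed
    show ?thesis
    proof
      show "Lucas_envelope R M E \<iota> \<subseteq> \<iota> ` carrier M"
      proof
        fix x assume "x \<in> Lucas_envelope R M E \<iota>"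
        then obtain I where x: "x \<in> carrier E" and I: "I \<in> Q_ideals R"
          and "\<forall>a\<in>I. a \<odot>\<^bsub>E\<^esub> x \<in> \<iota> ` carrier M" by (auto simp: Lucas_envelope_def)
        then have "\<forall>a\<in>I. \<exists>m\<in>carrier M. a \<odot>\<^bsub>E\<^esub> x = \<iota> m" by blast
        then obtain g where g: "\<And>a. a \<in> I \<Longrightarrow> g a \<in> carrier M"
          "\<And>a. a \<in> I \<Longrightarrow> \<iota> (g a) = a \<odot>\<^bsub>E\<^esub> x" by metis
        interpret I: ideal I R by (rule Q_idealsD(3)[OF I])
        have "g \<in> mod_hom R (ideal_mod R I) M"
        proof (rule mod_homI; simp)
          fix a b assume ab: "a \<in> I" "b \<in> I"
          have "\<iota> (g (a \<oplus> b)) = \<iota> (g a \<oplus>\<^bsub>M\<^esub> g b)"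
            using mod_hom_add[OF \<iota> g(1)[OF ab(1)] g(1)[OF ab(2)]] g(2) ab x
            by (simp add: E.smult_l_distr I.Icarr)
          then show "g (a \<oplus> b) = g a \<oplus>\<^bsub>M\<^esub> g b"
            by (rule inj_onD[OF inj]) (use g(1) ab in auto)
        next
          fix r a assume ra: "r \<in> carrier R" "a \<in> I"
          have "\<iota> (g (r \<otimes> a)) = \<iota> (r \<odot>\<^bsub>M\<^esub> g a)"
            using mod_hom_smult[OF \<iota> ra(1) g(1)[OF ra(2)]] g(2) ra x I.I_l_closed
            by (simp add: E.smult_assoc1 I.Icarr)
          then show "g (r \<otimes> a) = r \<odot>\<^bsub>M\<^esub> g a"
            by (rule inj_onD[OF inj]) (use g(1) ra I.I_l_closed in auto)
        qed (rule g(1))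
        from w_module_extend[OF w QGV[OF I] this]
        obtain m where m: "m \<in> carrier M" "\<And>a. a \<in> I \<Longrightarrow> g a = a \<odot>\<^bsub>M\<^esub> m" by blast
        have \<iota>m: "\<iota> m \<in> carrier E" by (rule mod_hom_closed[OF \<iota> m(1)])
        have "x \<ominus>\<^bsub>E\<^esub> \<iota> m = \<zero>\<^bsub>E\<^esub>"
        proof (rule E_tf[OF _ I])
          show "x \<ominus>\<^bsub>E\<^esub> \<iota> m \<in> carrier E" using x \<iota>m by simp
          fix a assume a: "a \<in> I"
          have "a \<odot>\<^bsub>E\<^esub> x = a \<odot>\<^bsub>E\<^esub> \<iota> m"
            using g(2)[OF a] m(2)[OF a] mod_hom_smult[OF \<iota> I.Icarr[OF a] m(1)] by simp
          then show "a \<odot>\<^bsub>E\<^esub> (x \<ominus>\<^bsub>E\<^esub> \<iota> m) = \<zero>\<^bsub>E\<^esub>"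
            using x \<iota>m I.Icarr[OF a] by (simp add: E.M.minus_eq E.smult_r_distr E.smult_r_minus E.M.r_neg)
        qed
        then have "x = \<iota> m" by (rule E.eq_if_minus_eq_zero[OF x \<iota>m])
        then show "x \<in> \<iota> ` carrier M" using m(1) by blast
      qed
    next
      have "a \<odot>\<^bsub>E\<^esub> \<iota> m \<in> \<iota> ` carrier M" if "a \<in> carrier R" "m \<in> carrier M" for a m
        using mod_hom_smult[OF \<iota> that] that by (metis M.smult_closed imageI)
      moreover have "carrier R \<in> Q_ideals R" by (rule GV_D(5)[OF carrier_GV])
      ultimately show "\<iota> ` carrier M \<subseteq> Lucas_envelope R M E \<iota>"
        using mod_hom_closed[OF \<iota>] by (auto simp: Lucas_envelope_def)
    qed
  qed
  ultimately show ?thesis using M by (simp add: Lucas_module_def)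
qed

lemma w_module_iso:
  assumes M: "module R M" and N: "module R N" and w: "w_module R M"
    and f: "f \<in> mod_hom R M N" and g: "g \<in> mod_hom R N M" and fg: "\<And>y. y \<in> carrier N \<Longrightarrow> f (g y) = y"
  shows "w_module R N"
  unfolding w_module_iff[OF N]
proof (intro conjI ballI)
  show "GV_torsion_free R N"
  proof (rule GV_torsion_freeI[OF N])
    fix J y assume J: "J \<in> GV R" and y: "y \<in> carrier N" and 0: "\<And>a. a \<in> J \<Longrightarrow> a \<odot>\<^bsub>N\<^esub> y = \<zero>\<^bsub>N\<^esub>"
    have "g y = \<zero>\<^bsub>M\<^esub>"
    proof (rule GV_torsion_freeD[OF _ J mod_hom_closed[OF g y]])
      show "GV_torsion_free R M" using w by (simp add: w_module_def)
      fix a assume a: "a \<in> J"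
      then have aR: "a \<in> carrier R" using GV_D(4)[OF J] by auto
      show "a \<odot>\<^bsub>M\<^esub> g y = \<zero>\<^bsub>M\<^esub>"
        using mod_hom_smult[OF g aR y] 0[OF a] mod_hom_zero[OF N M g] by simp
    qed
    then show "y = \<zero>\<^bsub>N\<^esub>" using fg[OF y] mod_hom_zero[OF M N f] by simp
  qed
  fix J u assume J: "J \<in> GV R" and u: "u \<in> mod_hom R (ideal_mod R J) N"
  have "(\<lambda>j. g (u j)) \<in> mod_hom R (ideal_mod R J) M" by (rule mod_hom_comp[OF u g])
  from w_module_extend[OF w J this]
  obtain m where m: "m \<in> carrier M" "\<And>j. j \<in> J \<Longrightarrow> g (u j) = j \<odot>\<^bsub>M\<^esub> m" by blast
  have "u j = j \<odot>\<^bsub>N\<^esub> f m" if j: "j \<in> J" for j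
  proof -
    have "u j = f (g (u j))" using fg mod_hom_closed[OF u] j by simp
    then show ?thesis using m(2)[OF j] mod_hom_smult[OF f _ m(1)] GV_D(4)[OF J] j by auto
  qed
  then show "\<exists>m\<in>carrier N. \<forall>j\<in>J. u j = j \<odot>\<^bsub>N\<^esub> m" using mod_hom_closed[OF f m(1)] by blast
qed

text \<open>The module that fails to be Lucas is the residue field of a prime \<open>P \<supseteq> I\<close>: its element \<open>1\<close> is
  annihilated by \<open>I\<close>.\<close>

lemma WQ_if_Lucas:
  assumes size: "carrier R \<lesssim> (UNIV :: 'u set)"
    and Lucas: "\<And>M :: ('a, 'u) module. w_module R M \<Longrightarrow> Lucas_module R M"
  shows "WQ_ring R"
  unfolding WQ_ring_def
proof (intro ballI, rule ccontr)
  fix I assume I: "I \<in> Q_ideals R" and "I \<notin> GV R"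
  note ID = Q_idealsD[OF I]
  have "\<not> contains_GV I" using GV_superset[OF _ ID(1)] \<open>I \<notin> GV R\<close> by (auto simp: contains_GV_def)
  then obtain P where P: "max_GV_free P" "I \<subseteq> P" using GV_free_subset_max[OF ID(3)] by metis
  note PD = max_GV_freeD[OF P(1)]
  let ?N = "quot_by_ideal R P"
  interpret L: localization R ?N "carrier R - P"
    by (rule prime_localization[OF PD(1) quot_by_ideal_module[OF PD(2)]])
  have w: "w_module R L.fraction_mod"
    by (rule L.fraction_mod_w_module) (use PD(3) GV_D(4) in blast)
  from copy_mod_exists[OF L.fraction_mod_module lepoll_trans[OF residue_field_lepoll[OF PD(1)] size]]
  obtain M :: "('a, 'u) module" and f g where M: "module R M" and f: "f \<in> mod_hom R L.fraction_mod M"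
    and g: "g \<in> mod_hom R M L.fraction_mod" and gf: "\<And>x. x \<in> carrier L.fraction_mod \<Longrightarrow> g (f x) = x"
    and fg: "\<And>y. y \<in> carrier M \<Longrightarrow> f (g y) = y" by metis
  have "Q_torsion_free R M"
    using Lucas[OF w_module_iso[OF L.fraction_mod_module M w f g fg]] by (simp add: Lucas_module_def)
  define e where "e = L.fraction (residue P \<one>) \<one>"
  have one: "residue P \<one> \<in> carrier ?N" by (simp add: residue_closed)
  have e: "e \<in> carrier L.fraction_mod"
    unfolding L.fraction_mod_carrier e_def using one L.S_one by blast
  have "a \<odot>\<^bsub>M\<^esub> f e = \<zero>\<^bsub>M\<^esub>" if a: "a \<in> I" for a
  proof -
    have aR: "a \<in> carrier R" and aP: "a \<in> P" using a ID(4) P(2) by auto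
    have "a \<odot>\<^bsub>L.fraction_mod\<^esub> e = \<zero>\<^bsub>L.fraction_mod\<^esub>"
      unfolding e_def L.fraction_mod_smult[OF aR one L.S_one] L.fraction_mod_zero[OF L.S_one]
        quot_by_ideal_annihilated[OF PD(2) aP one] ..
    then show ?thesis
      using mod_hom_smult[OF f aR e] mod_hom_zero[OF L.fraction_mod_module M f] by simp
  qed
  then have "f e = \<zero>\<^bsub>M\<^esub>"
    using \<open>Q_torsion_free R M\<close> I mod_hom_closed[OF f e] by (auto simp: Q_torsion_free_def)
  then have "e = \<zero>\<^bsub>L.fraction_mod\<^esub>"
    using gf[OF e] mod_hom_zero[OF M L.fraction_mod_module g] by simp
  then obtain u where u: "u \<in> carrier R - P" "u \<odot>\<^bsub>?N\<^esub> residue P \<one> = \<zero>\<^bsub>?N\<^esub>"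
    unfolding e_def L.fraction_mod_zero[OF L.S_one]
    using L.loc_frac_eq_iff[OF one L.M.zero_closed L.S_one L.S_one] one by auto
  then have "u \<in> P"
    using residue_smult[OF PD(2), of u \<one>] residue_eq_zero_iff[OF PD(2), of u]
    by (simp add: quot_by_ideal_zero)
  then show False using u(1) by simp
qed

end

theorem theorem3p2:
  fixes R :: "('a, 'r) ring_scheme"
  assumes "cring R"
    and universe: "\<exists>h :: 'a \<Rightarrow> 'u. inj_on h (carrier R)"
  shows
    "(WQ_ring R \<longleftrightarrow>
        (\<forall>M :: ('a, 'u) module. module R M \<longrightarrow> semi_regular_w_flat R M)) \<and>
     (WQ_ring R \<longleftrightarrow>
        (\<forall>I. fg_ideal R I \<and> semi_regular_ideal R I \<longrightarrow> w_flat TYPE('u) R (quot_by_ideal R I))) \<and>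
     (WQ_ring R \<longleftrightarrow>
        (\<forall>I. fg_ideal R I \<and> semi_regular_ideal R I \<longrightarrow> I \<subseteq> w_env_ideal R (I \<cdot>\<^bsub>R\<^esub> I))) \<and>
     (WQ_ring R \<longleftrightarrow>
        (\<forall>M :: ('a, 'u) module. w_module R M \<longrightarrow> Lucas_module R M)) \<and>
     (WQ_ring R \<longleftrightarrow> Q0 R = to_TRx R ` carrier R)"
proof (intro conjI)
  interpret cring R by fact
  interpret U: UP_cring R "UP R" by unfold_locales
  have size: "carrier R \<lesssim> (UNIV :: 'u set)" using universe by (simp add: lepoll_def)
  show "WQ_ring R \<longleftrightarrow> (\<forall>M :: ('a, 'u) module. module R M \<longrightarrow> semi_regular_w_flat R M)"
    using semi_regular_w_flat_if_WQ WQ_if_semi_regular_w_flat[OF size] by blast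
  show "WQ_ring R \<longleftrightarrow>
      (\<forall>I. fg_ideal R I \<and> semi_regular_ideal R I \<longrightarrow> w_flat TYPE('u) R (quot_by_ideal R I))"
  proof
    assume "WQ_ring R"
    then show "\<forall>I. fg_ideal R I \<and> semi_regular_ideal R I \<longrightarrow> w_flat TYPE('u) R (quot_by_ideal R I)"
      by (auto simp: WQ_ring_def Q_ideals_def intro: w_flat_if_GV)
  next
    assume flat: "\<forall>I. fg_ideal R I \<and> semi_regular_ideal R I \<longrightarrow> w_flat TYPE('u) R (quot_by_ideal R I)"
    have "I \<in> GV R" if "I \<in> Q_ideals R" for I
      using GV_if_w_flat[OF size that] flat that by (simp add: Q_ideals_def)
    then show "WQ_ring R" by (simp add: WQ_ring_def)
  qed
  show "WQ_ring R \<longleftrightarrow> (\<forall>I. fg_ideal R I \<and> semi_regular_ideal R I \<longrightarrow> I \<subseteq> w_env_ideal R (I \<cdot>\<^bsub>R\<^esub> I))"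
    by (rule WQ_ring_iff_idempotent)
  show "WQ_ring R \<longleftrightarrow> (\<forall>M :: ('a, 'u) module. w_module R M \<longrightarrow> Lucas_module R M)"
    using Lucas_module_if_WQ WQ_if_Lucas[OF size] by blast
  show "WQ_ring R \<longleftrightarrow> Q0 R = to_TRx R ` carrier R"
    by (rule U.WQ_ring_iff_Q0)
qed

end
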